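(* Assume the standing conditions on $F$ and $\sigma$ written out in the context. Suppose that the top Lyapunov exponent satisfies $\lambda_1<0$ and that there exist $r\in(0,1]$, $\overline{C}_F>0$ and $p_1\ge1$ such that for all $y,z\in\mathbb{R}^d$ $$\|D_yF-D_zF\|_{L(\mathbb{R}^d,\mathbb{R}^d)}\le\overline{C}_F(1+|y|+|z|)^{p_1}|y-z|^r.$$ Then there exist $p\in\mathbb{N}$ and random variables $b_i:\tilde{\mathcal{B}}\to\mathbb{R}^d$, $1\le i\le p$, such that for $\mathbf{P}$-almost every $\omega^-$ $$\mu_{\omega^-}=\frac1p\sum_{i=1}^p\delta_{\{b_i(\omega^-)\}}.$$ In particular, the disintegrated measures $\mu_{\omega^-}$ are discrete.
   Context: **Noise.** Fix $d\ge1$, $H\in(0,1)$. For $h\in(0,1)$ let $\mathcal{B}_h$ be the closure of $C_0^\infty(\mathbb{R}^-,\mathbb{R}^d)$ (smooth compactly supported $\omega:\mathbb{R}^-=(-\infty,0]\to\mathbb{R}^d$ with $\omega(0)=0$) under $\|\omega\|_{\mathcal{B}_h}:=\sup_{s,t\in\mathbb{R}^-}\frac{|\omega(t)-\omega(s)|}{\sqrt{1+|t|+|s|}\,|t-s|^{(1-h)/2}}$ (a separable Banach space), and write $\mathcal{B}:=\mathcal{B}_H$. $\mathbf{P}$ is the Gaussian measure on $\mathcal{B}$ under which the canonical process is a time-reversed Brownian motion. $\mathcal{D}_H:\mathcal{B}_H\to\mathcal{B}_{1-H}$ is the continuous extension of $\mathcal{D}_H\omega(t)=\frac1{\alpha_H}\int_{-\infty}^0(-r)^{H-1/2}(\dot\omega(t+r)-\dot\omega(r))\,dr$,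 where $\alpha_H$ is the normalizing constant for which the canonical process under $(\mathcal{D}_H)_*\mathbf{P}$ is a time-reversed fractional Brownian motion with Hurst parameter $H$. For $t\ge0$ put $\vartheta_t\omega(s):=\omega(s-t)-\omega(-t)$ ($s\le0$) and $P_t(\omega^-,\omega^+)(s):=\omega^+(-s-t)-\omega^+(-t)$ for $-t\le s\le0$, $:=\omega^-(s+t)-\omega^+(-t)$ for $s\le-t$. Let $\Omega:=\mathcal{B}\times\mathcal{B}$, $\mathbb{P}:=\mathbf{P}\times\mathbf{P}$, $\theta_t(\omega^-,\omega^+):=(P_t(\omega^-,\omega^+),\vartheta_t\omega^+)$ for $t\ge0$ and $\theta_t(\omega^-,\omega^+):=(\vartheta_{-t}\omega^-,P_{-t}(\omega^+,\omega^-))$ for $t<0$. Then $B^H_t(\omega):=-(\mathcal{D}_HP_t(\omega^-,\omega^+))(-t)$, $t\ge0$, is a fractional Brownian motion under $\mathbb{P}$. **SDE and standing conditions.** Consider $dY_t=F(Y_t)\,dt+\sigma\,dB^H_t$, $Y_0=x\in\mathbb{R}^d$, with: (1) $\sigma$ an invertible $d\times d$ matrix; (2) for some $C_1^F,C_2^F,C_3^F>0$ and all $\xi_1,\xi_2\in\mathbb{R}^d$, $\langle F(\xi_2)-F(\xi_1),\xi_2-\xi_1\rangle\le\min\{C_1^F-C_2^F|\xi_2-\xi_1|^2,\;C_3^F|\xi_2-\xi_1|^2\}$; (3) $F$ is differentiable and for some $C_F>0$, $N\ge1$: $|F(\xi)|\le C_F(1+|\xi|)^N$ and $|D_\xi F|\le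 C_F(1+|\xi|)^N$ for all $\xi$; (4) if $H>1/2$, the derivative of $F$ is globally bounded. Let $\Phi^t_\omega(x)$ be the solution: $\Phi^t_\omega(x)=x+\int_0^tF(\Phi^s_\omega(x))\,ds+\sigma B^H_t(\omega)$. Set $\varphi^t_{\omega^-}(x):=\Phi^t_{\theta_{-t}(\omega^-,\omega^+)}(x)$, which depends only on $\omega^-$; then $\Phi^t_{(\omega^-,\omega^+)}(x)=\varphi^t_{P_t(\omega^-,\omega^+)}(x)$. **Invariant measure.** $\mu$ is the (known to exist and be) unique probability measure on $\mathbb{R}^d\times\mathcal{B}$ with $\mathcal{B}$-marginal $\mathbf{P}$ that is invariant under the Feller transition semigroup $\mathcal{Q}_t((x,\omega^-);\Gamma):=\int_{\mathcal{B}}\chi_\Gamma\big(\varphi^t_{P_t(\omega^-,\omega^+)}(x),P_t(\omega^-,\omega^+)\big)\mathbf{P}(d\omega^+)$. **Disintegration.** Fix a measurable $\tilde{\mathcal{B}}\subseteq\mathcal{B}$ with $\mathbf{P}(\tilde{\mathcal{B}})=1$ and probability measures $\{\mu_{\omega^-}\}$ on $\mathbb{R}^d$ (known to exist) such that $\omega^-\mapsto\mu_{\omega^-}(A)$ is measurable and $\mu(A\times D)=\int_D\mu_{\omega^-}(A)\,\mathbf{P}(d\omega^-)$ for Borel $A,D$, and such that for all $(\omega^-,\omega^+)\in\tilde{\mathcal{B}}\times\mathcal{B}$, $t\ge0$: $P_t(\omega^-,\omega^+)\in\tilde{\mathcal{B}}$ and $(\Phi^t_{(\omega^-,\omega^+)})_*\mu_{\omega^-}=\mu_{P_t(\omega^-,\omega^+)}$.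 **Top Lyapunov exponent.** $\lambda_1\in[-\infty,\infty)$ is the deterministic constant (known to exist) with $\lambda_1=\lim_{t\to\infty}\frac1t\log\|D_x\Phi^t_\omega\|$ for $(\mu\times\mathbf{P})$-almost every $(x,\omega^-,\omega^+)\in\mathbb{R}^d\times\mathcal{B}\times\mathcal{B}$. *)

theory Defs
  imports "HOL-Probability.Probability"
begin

section \<open>The path spaces\<close>

text \<open>
  A path on the half line \<open>(-\<infinity>, 0]\<close> starting from \<open>0\<close> is represented by a function on all of
  \<open>real\<close> that vanishes on \<open>[0, \<infinity>)\<close>.  The values at positive times carry no information; fixing
  them makes the representation unique.
\<close>

type_synonym 'd path = "real \<Rightarrow> real ^ 'd"

text \<open>Smoothness up to the boundary point \<open>0\<close>, with one-sided derivatives there.\<close>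

definition test_paths :: "('d::finite) path set" where
  "test_paths = {\<omega>. (\<forall>t\<ge>0. \<omega> t = 0) \<and> (\<exists>T. \<forall>t<T. \<omega> t = 0) \<and>
     (\<exists>D :: nat \<Rightarrow> 'd path. D 0 = \<omega> \<and>
        (\<forall>n. \<forall>t\<le>0. (D n has_vector_derivative D (Suc n) t) (at t within {..0})))}"

text \<open>
  The terms with \<open>s = t\<close> are \<open>0 / 0 = 0\<close> and do not contribute.  The supremum is taken in
  \<open>[0, \<infinity>]\<close>, so it is \<open>\<infinity>\<close> when the quotients are unbounded.
\<close>

definition path_norm :: "real \<Rightarrow> ('d::finite) path \<Rightarrow> ennreal" where
  "path_norm h \<omega> = (SUP s\<in>{..0}. SUP t\<in>{..0}.
     ennreal (norm (\<omega> t - \<omega> s) / (sqrt (1 + \<bar>t\<bar> + \<bar>s\<bar>) * \<bar>t - s\<bar> powr ((1 - h) / 2))))"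

definition path_space :: "real \<Rightarrow> ('d::finite) path set" where
  "path_space h = {\<omega>. (\<forall>t\<ge>0. \<omega> t = 0) \<and> path_norm h \<omega> < \<infinity> \<and>
     (\<forall>\<epsilon>>0. \<exists>\<phi>\<in>test_paths. path_norm h (\<lambda>t. \<omega> t - \<phi> t) < ennreal \<epsilon>)}"

definition path_dist :: "real \<Rightarrow> ('d::finite) path \<Rightarrow> 'd path \<Rightarrow> real" where
  "path_dist h \<omega> \<eta> = enn2real (path_norm h (\<lambda>t. \<omega> t - \<eta> t))"

lemma path_norm_ge:
  assumes "s \<le> 0" "t \<le> 0"
  shows "ennreal (norm (\<omega> t - \<omega> s) / (sqrt (1 + \<bar>t\<bar> + \<bar>s\<bar>) * \<bar>t - s\<bar> powr ((1 - h) / 2)))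
    \<le> path_norm h \<omega>"
  unfolding path_norm_def
  by (rule SUP_upper2[of s], use assms in simp, rule SUP_upper2[of t], use assms in auto)

lemma path_norm_le:
  assumes "\<And>s t. s \<le> 0 \<Longrightarrow> t \<le> 0 \<Longrightarrow>
    ennreal (norm (\<omega> t - \<omega> s) / (sqrt (1 + \<bar>t\<bar> + \<bar>s\<bar>) * \<bar>t - s\<bar> powr ((1 - h) / 2))) \<le> c"
  shows "path_norm h \<omega> \<le> c"
  unfolding path_norm_def by (intro SUP_least assms) simp_all

lemma path_norm_minus_commute:
  "path_norm h (\<lambda>t. \<omega> t - \<eta> t) = path_norm h (\<lambda>t. \<eta> t - \<omega> t)"
proof -
  have "norm ((\<omega> t - \<eta> t) - (\<omega> s - \<eta> s)) = norm ((\<eta> t - \<omega> t) - (\<eta> s - \<omega> s))" for s t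
    using norm_minus_cancel[of "(\<omega> t - \<eta> t) - (\<omega> s - \<eta> s)"]
    by (simp only: minus_diff_eq diff_diff_eq2 diff_add_eq) (simp add: algebra_simps)
  then show ?thesis unfolding path_norm_def by (simp only:)
qed

lemma path_norm_triangle:
  "path_norm h (\<lambda>t. \<omega> t - \<zeta> t) \<le> path_norm h (\<lambda>t. \<omega> t - \<eta> t) + path_norm h (\<lambda>t. \<eta> t - \<zeta> t)"
proof (rule path_norm_le)
  fix s t :: real assume st: "s \<le> 0" "t \<le> 0"
  define w where "w = sqrt (1 + \<bar>t\<bar> + \<bar>s\<bar>) * \<bar>t - s\<bar> powr ((1 - h) / 2)"
  have w: "0 \<le> w" by (simp add: w_def)
  have "norm ((\<omega> t - \<zeta> t) - (\<omega> s - \<zeta> s)) \<le>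
    norm ((\<omega> t - \<eta> t) - (\<omega> s - \<eta> s)) + norm ((\<eta> t - \<zeta> t) - (\<eta> s - \<zeta> s))"
    by (rule order_trans[OF _ norm_triangle_ineq]) (simp add: algebra_simps)
  then have "norm ((\<omega> t - \<zeta> t) - (\<omega> s - \<zeta> s)) / w \<le>
    norm ((\<omega> t - \<eta> t) - (\<omega> s - \<eta> s)) / w + norm ((\<eta> t - \<zeta> t) - (\<eta> s - \<zeta> s)) / w"
    using divide_right_mono[OF _ w] by (simp only: add_divide_distrib[symmetric])
  then have "ennreal (norm ((\<omega> t - \<zeta> t) - (\<omega> s - \<zeta> s)) / w) \<le>
    ennreal (norm ((\<omega> t - \<eta> t) - (\<omega> s - \<eta> s)) / w) + ennreal (norm ((\<eta> t - \<zeta> t) - (\<eta> s - \<zeta> s)) / w)"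
    using w by (simp add: ennreal_plus[symmetric] ennreal_leI del: ennreal_plus)
  also have "\<dots> \<le> path_norm h (\<lambda>t. \<omega> t - \<eta> t) + path_norm h (\<lambda>t. \<eta> t - \<zeta> t)"
    unfolding w_def
    using path_norm_ge[OF st, where \<omega>="\<lambda>t. \<omega> t - \<eta> t" and h=h]
      path_norm_ge[OF st, where \<omega>="\<lambda>t. \<eta> t - \<zeta> t" and h=h]
    by (intro add_mono) auto
  finally show "ennreal (norm ((\<omega> t - \<zeta> t) - (\<omega> s - \<zeta> s)) /
      (sqrt (1 + \<bar>t\<bar> + \<bar>s\<bar>) * \<bar>t - s\<bar> powr ((1 - h) / 2)))
    \<le> path_norm h (\<lambda>t. \<omega> t - \<eta> t) + path_norm h (\<lambda>t. \<eta> t - \<zeta> t)"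
    unfolding w_def .
qed

lemma path_norm_diff_finite:
  assumes "\<omega> \<in> path_space h" "\<eta> \<in> path_space h"
  shows "path_norm h (\<lambda>t. \<omega> t - \<eta> t) < \<infinity>"
proof -
  have "path_norm h (\<lambda>t. \<omega> t - \<eta> t) \<le> path_norm h (\<lambda>t. \<omega> t - 0) + path_norm h (\<lambda>t. 0 - \<eta> t)"
    by (rule path_norm_triangle)
  also have "\<dots> = path_norm h \<omega> + path_norm h \<eta>"
    by (simp only: path_norm_minus_commute[of h "\<lambda>_. 0" \<eta>] diff_zero)
  also have "\<dots> < \<infinity>" using assms by (auto simp: path_space_def)
  finally show ?thesis .
qed

lemma Metric_space_path_space:
  "Metric_space (path_space h :: ('d::finite) path set) (path_dist h)"
proof
  fix \<omega> \<eta> :: "'d path"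
  show "0 \<le> path_dist h \<omega> \<eta>" by (simp add: path_dist_def)
  show "path_dist h \<omega> \<eta> = path_dist h \<eta> \<omega>"
    unfolding path_dist_def by (subst path_norm_minus_commute) (rule refl)
next
  fix \<omega> \<eta> :: "'d path" assume A: "\<omega> \<in> path_space h" "\<eta> \<in> path_space h"
  show "path_dist h \<omega> \<eta> = 0 \<longleftrightarrow> \<omega> = \<eta>"
  proof
    assume "path_dist h \<omega> \<eta> = 0"
    then have z: "path_norm h (\<lambda>t. \<omega> t - \<eta> t) = 0"
      using path_norm_diff_finite[OF A] by (auto simp: path_dist_def enn2real_eq_0_iff)
    have "\<omega> t = \<eta> t" for t
    proof (cases "t < 0")
      case True
      have "ennreal (norm ((\<omega> t - \<eta> t) - (\<omega> 0 - \<eta> 0)) /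
          (sqrt (1 + \<bar>t\<bar> + \<bar>0\<bar>) * \<bar>t - 0\<bar> powr ((1 - h) / 2))) \<le> 0"
        using path_norm_ge[of 0 t "\<lambda>t. \<omega> t - \<eta> t" h] True z by simp
      moreover have "\<omega> 0 = 0" "\<eta> 0 = 0" using A by (auto simp: path_space_def)
      ultimately have "norm (\<omega> t - \<eta> t) / (sqrt (1 + \<bar>t\<bar>) * \<bar>t\<bar> powr ((1 - h) / 2)) \<le> 0"
        by (simp add: ennreal_eq_0_iff)
      moreover have "0 < sqrt (1 + \<bar>t\<bar>) * \<bar>t\<bar> powr ((1 - h) / 2)" using True by simp
      ultimately have "norm (\<omega> t - \<eta> t) \<le> 0" by (simp only: divide_le_0_iff) auto
      then show ?thesis by simp
    next
      case False
      then show ?thesis using A by (auto simp: path_space_def)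
    qed
    then show "\<omega> = \<eta>" by auto
  next
    assume "\<omega> = \<eta>"
    then have "path_norm h (\<lambda>t. \<omega> t - \<eta> t) \<le> 0" by (intro path_norm_le) simp
    then show "path_dist h \<omega> \<eta> = 0" by (simp add: path_dist_def)
  qed
next
  fix \<omega> \<eta> \<zeta> :: "'d path"
  assume A: "\<omega> \<in> path_space h" "\<eta> \<in> path_space h" "\<zeta> \<in> path_space h"
  have "path_dist h \<omega> \<zeta> \<le>
      enn2real (path_norm h (\<lambda>t. \<omega> t - \<eta> t) + path_norm h (\<lambda>t. \<eta> t - \<zeta> t))"
    unfolding path_dist_def
    using path_norm_triangle path_norm_diff_finite[OF A(1,2)] path_norm_diff_finite[OF A(2,3)]
    by (intro enn2real_mono) auto
  also have "\<dots> = path_dist h \<omega> \<eta> + path_dist h \<eta> \<zeta>"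
    unfolding path_dist_def
    using path_norm_diff_finite[OF A(1,2)] path_norm_diff_finite[OF A(2,3)]
    by (intro enn2real_plus) auto
  finally show "path_dist h \<omega> \<zeta> \<le> path_dist h \<omega> \<eta> + path_dist h \<eta> \<zeta>" .
qed

definition path_top :: "real \<Rightarrow> ('d::finite) path topology" where
  "path_top h = Metric_space.mtopology (path_space h) (path_dist h)"

definition path_borel :: "real \<Rightarrow> ('d::finite) path measure" where
  "path_borel h = sigma (path_space h) {U. openin (path_top h) U}"


section \<open>Brownian motion and fractional Brownian motion\<close>

definition normal_law :: "real \<Rightarrow> real \<Rightarrow> real measure" where
  "normal_law m v = (if v = 0 then return borel m
                     else density lborel (normal_density m (sqrt v)))"

text \<open>
  An \<open>'d\<close>-dimensional process indexed by \<open>[0, \<infinity>)\<close> that is centered and Gaussian and has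
  i.i.d. components with covariance function \<open>R\<close>.
\<close>

definition centered_gaussian_process ::
  "'w measure \<Rightarrow> (real \<Rightarrow> 'w \<Rightarrow> real ^ ('d::finite)) \<Rightarrow> (real \<Rightarrow> real \<Rightarrow> real) \<Rightarrow> bool" where
  "centered_gaussian_process M X R \<longleftrightarrow>
     prob_space M \<and>
     (\<forall>t\<ge>0. X t \<in> borel_measurable M) \<and>
     (\<forall>J u. finite J \<and> J \<subseteq> {0..} \<longrightarrow>
        (\<exists>m v. 0 \<le> v \<and> distr M borel (\<lambda>w. \<Sum>t\<in>J. u t \<bullet> X t w) = normal_law m v)) \<and>
     (\<forall>t\<ge>0. \<forall>i. (LINT w|M. X t w $ i) = 0) \<and>
     (\<forall>s\<ge>0. \<forall>t\<ge>0. \<forall>i j. (LINT w|M. X s w $ i * X t w $ j) = (if i = j then R s t else 0))"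

definition brownian_motion :: "'w measure \<Rightarrow> (real \<Rightarrow> 'w \<Rightarrow> real ^ ('d::finite)) \<Rightarrow> bool" where
  "brownian_motion M X \<longleftrightarrow> centered_gaussian_process M X min"

definition fractional_brownian_motion ::
  "real \<Rightarrow> 'w measure \<Rightarrow> (real \<Rightarrow> 'w \<Rightarrow> real ^ ('d::finite)) \<Rightarrow> bool" where
  "fractional_brownian_motion H M X \<longleftrightarrow> centered_gaussian_process M X
     (\<lambda>s t. (s powr (2 * H) + t powr (2 * H) - \<bar>t - s\<bar> powr (2 * H)) / 2)"

text \<open>The canonical process on negative times, read backwards in time, is a Brownian motion.\<close>

definition wiener_measure :: "real \<Rightarrow> ('d::finite) path measure \<Rightarrow> bool" where
  "wiener_measure H P \<longleftrightarrow> sets P = sets (path_borel H) \<and> brownian_motion P (\<lambda>t \<omega>. \<omega> (- t))"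

definition frac_integral :: "real \<Rightarrow> ('d::finite) path \<Rightarrow> 'd path" where
  "frac_integral H \<omega> t = (LINT r:{..0}|lborel. (- r) powr (H - 1/2) *\<^sub>R
     (vector_derivative \<omega> (at (t + r) within {..0}) - vector_derivative \<omega> (at r within {..0})))"

text \<open>
  \<open>D\<close> is the (unique) continuous extension of \<open>frac_integral H\<close> divided by \<open>\<alpha>\<close>, where \<open>\<alpha> > 0\<close>
  is determined by the requirement on the law of the canonical process under the image measure.
\<close>

definition frac_operator ::
  "real \<Rightarrow> ('d::finite) path measure \<Rightarrow> real \<Rightarrow> ('d path \<Rightarrow> 'd path) \<Rightarrow> bool" where
  "frac_operator H P \<alpha> D \<longleftrightarrow>
     0 < \<alpha> \<and>
     continuous_map (path_top H) (path_top (1 - H)) D \<and>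
     (\<forall>\<omega>\<in>test_paths. \<forall>t\<le>0. D \<omega> t = (1 / \<alpha>) *\<^sub>R frac_integral H \<omega> t) \<and>
     fractional_brownian_motion H (distr P (path_borel (1 - H)) D) (\<lambda>t \<omega>. \<omega> (- t))"


section \<open>Shifts\<close>

definition shift :: "real \<Rightarrow> ('d::finite) path \<Rightarrow> 'd path" where
  "shift t \<omega> s = (if s \<le> 0 then \<omega> (s - t) - \<omega> (- t) else 0)"

definition glue :: "real \<Rightarrow> ('d::finite) path \<times> 'd path \<Rightarrow> 'd path" where
  "glue t = (\<lambda>(\<omega>m, \<omega>p) s.
     if - t \<le> s \<and> s \<le> 0 then \<omega>p (- s - t) - \<omega>p (- t)
     else if s \<le> - t then \<omega>m (s + t) - \<omega>p (- t)
     else 0)"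

definition theta :: "real \<Rightarrow> ('d::finite) path \<times> 'd path \<Rightarrow> 'd path \<times> 'd path" where
  "theta t = (\<lambda>(\<omega>m, \<omega>p).
     if t \<ge> 0 then (glue t (\<omega>m, \<omega>p), shift t \<omega>p)
     else (shift (- t) \<omega>m, glue (- t) (\<omega>p, \<omega>m)))"


section \<open>The equation\<close>

definition driving_fbm ::
  "('d path \<Rightarrow> 'd path) \<Rightarrow> real \<Rightarrow> ('d::finite) path \<times> 'd path \<Rightarrow> real ^ 'd" where
  "driving_fbm D t \<omega> = - D (glue t \<omega>) (- t)"

definition standing_conditions ::
  "real \<Rightarrow> (real ^ 'd \<Rightarrow> real ^ 'd) \<Rightarrow> real ^ 'd ^ ('d::finite) \<Rightarrow> bool" where
  "standing_conditions H F \<sigma> \<longleftrightarrow>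
     invertible \<sigma> \<and>
     (\<exists>C1>0. \<exists>C2>0. \<exists>C3>0. \<forall>\<xi>1 \<xi>2.
        (F \<xi>2 - F \<xi>1) \<bullet> (\<xi>2 - \<xi>1)
          \<le> min (C1 - C2 * (norm (\<xi>2 - \<xi>1))\<^sup>2) (C3 * (norm (\<xi>2 - \<xi>1))\<^sup>2)) \<and>
     (\<forall>\<xi>. F differentiable (at \<xi>)) \<and>
     (\<exists>C>0. \<exists>N\<ge>1. \<forall>\<xi>. norm (F \<xi>) \<le> C * (1 + norm \<xi>) powr N \<and>
        onorm (frechet_derivative F (at \<xi>)) \<le> C * (1 + norm \<xi>) powr N) \<and>
     (H > 1/2 \<longrightarrow> (\<exists>C. \<forall>\<xi>. onorm (frechet_derivative F (at \<xi>)) \<le> C))"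

definition solution_flow ::
  "real \<Rightarrow> ('d path \<Rightarrow> 'd path) \<Rightarrow> (real ^ 'd \<Rightarrow> real ^ 'd) \<Rightarrow> real ^ 'd ^ ('d::finite) \<Rightarrow>
   (real \<Rightarrow> 'd path \<times> 'd path \<Rightarrow> real ^ 'd \<Rightarrow> real ^ 'd) \<Rightarrow> bool" where
  "solution_flow H D F \<sigma> \<Phi> \<longleftrightarrow> (\<forall>\<omega>\<in>path_space H \<times> path_space H. \<forall>x.
     continuous_on {0..} (\<lambda>t. \<Phi> t \<omega> x) \<and>
     (\<forall>t\<ge>0. ((\<lambda>s. F (\<Phi> s \<omega> x)) has_integral (\<Phi> t \<omega> x - x - \<sigma> *v driving_fbm D t \<omega>)) {0..t}))"

text \<open>
  The flow evaluated at \<open>theta (- t) (\<omega>m, \<omega>p)\<close> does not depend on \<open>\<omega>p\<close>; the zero path is used.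
\<close>

definition past_flow ::
  "(real \<Rightarrow> 'd path \<times> 'd path \<Rightarrow> real ^ 'd \<Rightarrow> real ^ 'd) \<Rightarrow>
   real \<Rightarrow> ('d::finite) path \<Rightarrow> real ^ 'd \<Rightarrow> real ^ 'd" where
  "past_flow \<Phi> t \<omega>m x = \<Phi> t (theta (- t) (\<omega>m, \<lambda>_. 0)) x"

definition transition ::
  "('d::finite) path measure \<Rightarrow> (real \<Rightarrow> 'd path \<times> 'd path \<Rightarrow> real ^ 'd \<Rightarrow> real ^ 'd) \<Rightarrow>
   real \<Rightarrow> (real ^ 'd) \<times> 'd path \<Rightarrow> ((real ^ 'd) \<times> 'd path) set \<Rightarrow> ennreal" where
  "transition P \<Phi> t = (\<lambda>(x, \<omega>m) \<Gamma>.
     \<integral>\<^sup>+ \<omega>p. indicator \<Gamma> (past_flow \<Phi> t (glue t (\<omega>m, \<omega>p)) x, glue t (\<omega>m, \<omega>p)) \<partial>P)"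

definition invariant_measure ::
  "('d::finite) path measure \<Rightarrow> (real \<Rightarrow> 'd path \<times> 'd path \<Rightarrow> real ^ 'd \<Rightarrow> real ^ 'd) \<Rightarrow>
   ((real ^ 'd) \<times> 'd path) measure \<Rightarrow> bool" where
  "invariant_measure P \<Phi> \<mu> \<longleftrightarrow>
     prob_space \<mu> \<and>
     sets \<mu> = sets (borel \<Otimes>\<^sub>M P) \<and>
     distr \<mu> P snd = P \<and>
     (\<forall>t\<ge>0. \<forall>\<Gamma>\<in>sets \<mu>. (\<integral>\<^sup>+ z. transition P \<Phi> t z \<Gamma> \<partial>\<mu>) = emeasure \<mu> \<Gamma>)"

text \<open>The disintegration is only required on the set \<open>Bt\<close>, which has full measure.\<close>

definition equivariant_disintegration ::
  "real \<Rightarrow> ('d::finite) path measure \<Rightarrow> (real \<Rightarrow> 'd path \<times> 'd path \<Rightarrow> real ^ 'd \<Rightarrow> real ^ 'd) \<Rightarrow>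
   ((real ^ 'd) \<times> 'd path) measure \<Rightarrow> 'd path set \<Rightarrow> ('d path \<Rightarrow> (real ^ 'd) measure) \<Rightarrow> bool" where
  "equivariant_disintegration H P \<Phi> \<mu> Bt \<kappa> \<longleftrightarrow>
     Bt \<in> sets P \<and> emeasure P Bt = 1 \<and>
     (\<forall>\<omega>\<in>Bt. prob_space (\<kappa> \<omega>) \<and> sets (\<kappa> \<omega>) = sets borel) \<and>
     (\<forall>A\<in>sets borel. (\<lambda>\<omega>. emeasure (\<kappa> \<omega>) A) \<in> borel_measurable (restrict_space P Bt)) \<and>
     (\<forall>A\<in>sets borel. \<forall>E\<in>sets P.
        emeasure \<mu> (A \<times> E) = (\<integral>\<^sup>+ \<omega>\<in>E \<inter> Bt. emeasure (\<kappa> \<omega>) A \<partial>P)) \<and>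
     (\<forall>\<omega>m\<in>Bt. \<forall>\<omega>p\<in>path_space H. \<forall>t\<ge>0.
        glue t (\<omega>m, \<omega>p) \<in> Bt \<and>
        distr (\<kappa> \<omega>m) borel (\<Phi> t (\<omega>m, \<omega>p)) = \<kappa> (glue t (\<omega>m, \<omega>p)))"

definition ereal_ln :: "real \<Rightarrow> ereal" where
  "ereal_ln x = (if x = 0 then - \<infinity> else ereal (ln x))"

definition top_lyapunov_exponent ::
  "('d::finite) path measure \<Rightarrow> (real \<Rightarrow> 'd path \<times> 'd path \<Rightarrow> real ^ 'd \<Rightarrow> real ^ 'd) \<Rightarrow>
   ((real ^ 'd) \<times> 'd path) measure \<Rightarrow> ereal \<Rightarrow> bool" where
  "top_lyapunov_exponent P \<Phi> \<mu> l \<longleftrightarrow> l < \<infinity> \<and>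
     (AE ((x, \<omega>m), \<omega>p) in \<mu> \<Otimes>\<^sub>M P.
        ((\<lambda>t. ereal (1 / t) * ereal_ln (onorm (frechet_derivative (\<Phi> t (\<omega>m, \<omega>p)) (at x))))
          \<longlongrightarrow> l) at_top)"

definition discrete_measure :: "'a measure \<Rightarrow> bool" where
  "discrete_measure M \<longleftrightarrow> (\<exists>S\<in>sets M. countable S \<and> emeasure M (space M - S) = 0)"

end

(*
  A negative exponent makes the mean of log L negative, where L is the Lipschitz constant of the
  time-N flow on a small ball. By the maximal ergodic inequality all Birkhoff sums of log L, shifted by a
  margin, stay nonpositive with positive probability; on that event the flow contracts a ball of
  fixed radius exponentially along the whole trajectory. By equivariance the image balls carry at
  least the initial mass, and stationarity turns mass on balls of vanishing radius into an atom of
  mass at least delta, with positive probability.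

  The flow maps atoms of mass at least c to atoms of mass at least c, so the total mass of these atoms is
  nondecreasing, hence invariant. Normalizing the disintegration to these atoms gives another
  equivariant one, so by uniqueness the total mass is 0 or 1, and the zero-one law for the gluing maps
  makes it deterministic. At the largest c with total mass 1 all atoms have mass exactly c = 1/p.
  The invariance of P under gluing is the marginal of the invariance of mu.
*)
theory Submission
  imports Defs
begin

section \<open>The path space and its Borel sets\<close>

text \<open>Gluing adds random noise at the present end of a past, so the dynamics on pasts is a
  Markov chain. It becomes a single measure-preserving map by adjoining an i.i.d. stream of futures
  and consuming one per step. The maximal inequality then has to deliver only a set of positive
  measure, because the dichotomy for the atomic mass promotes it to full measure later. The obstacle
  in the contraction argument is that a derivative controls the flow only on a ball whose radius
  depends on the point and on the noise. The global one-sided Lipschitz bound on F repairs this: it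
  bounds log L from above everywhere, so a fixed radius that fails with small probability still
  leaves the mean negative. The Hoelder condition on DF yields differentiability of the flow in the
  initial value, obtained without solving a variational equation. The equation determines the flow
  only path by path. Its measurability comes from continuous dependence on the noise and from
  evaluations generating the Borel sets of the path space, which rests on separability.\<close>

lemma path_norm_le_iff:
  assumes "0 \<le> C"
  shows "path_norm h \<omega> \<le> ennreal C \<longleftrightarrow> (\<forall>s\<le>0. \<forall>t\<le>0.
    norm (\<omega> t - \<omega> s) \<le> C * (sqrt (1 + \<bar>t\<bar> + \<bar>s\<bar>) * \<bar>t - s\<bar> powr ((1 - h) / 2)))"
proof -
  have pt: "ennreal (norm (\<omega> t - \<omega> s) / (sqrt (1 + \<bar>t\<bar> + \<bar>s\<bar>) * \<bar>t - s\<bar> powr ((1 - h) / 2)))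
      \<le> ennreal C \<longleftrightarrow>
    norm (\<omega> t - \<omega> s) \<le> C * (sqrt (1 + \<bar>t\<bar> + \<bar>s\<bar>) * \<bar>t - s\<bar> powr ((1 - h) / 2))" for s t
  \<comment> \<open>On the diagonal both sides hold: the quotient is \<open>0 / 0 = 0\<close> and
    the increment vanishes.\<close>
  proof (cases "s = t")
    case False
    then have "0 < sqrt (1 + \<bar>t\<bar> + \<bar>s\<bar>) * \<bar>t - s\<bar> powr ((1 - h) / 2)" by simp
    then show ?thesis using assms by (simp add: ennreal_le_iff pos_divide_le_eq del: times_divide_eq_left)
  qed (use assms in simp)
  show ?thesis
    unfolding pt[symmetric] by (auto simp: path_norm_def SUP_le_iff)
qed

section \<open>Linear structure and regularity of paths\<close>

lemma test_paths_diff: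
  assumes "\<phi> \<in> test_paths" "\<psi> \<in> test_paths"
  shows "(\<lambda>t. \<phi> t - \<psi> t) \<in> test_paths"
proof -
  obtain T D T' D' where *: "\<forall>t<T. \<phi> t = 0" "D 0 = \<phi>"
      "\<forall>n. \<forall>t\<le>0. (D n has_vector_derivative D (Suc n) t) (at t within {..0})"
      "\<forall>t<T'. \<psi> t = 0" "D' 0 = \<psi>"
      "\<forall>n. \<forall>t\<le>0. (D' n has_vector_derivative D' (Suc n) t) (at t within {..0})"
    using assms by (auto simp: test_paths_def)
  have "\<forall>t<min T T'. \<phi> t - \<psi> t = 0" using * by simp
  moreover have "(\<lambda>n t. D n t - D' n t) 0 = (\<lambda>t. \<phi> t - \<psi> t)" using * by simp
  moreover have "\<forall>n. \<forall>t\<le>0. ((\<lambda>n t. D n t - D' n t) n has_vector_derivative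
      (\<lambda>n t. D n t - D' n t) (Suc n) t) (at t within {..0})"
    using * by (auto intro!: has_vector_derivative_diff)
  ultimately show ?thesis
    using assms unfolding test_paths_def mem_Collect_eq
    by (intro conjI exI[of _ "min T T'"] exI[of _ "\<lambda>n t. D n t - D' n t"]) auto
qed

lemma test_paths_zero: "(\<lambda>_. 0) \<in> test_paths"
  unfolding test_paths_def by (auto intro!: exI[of _ "\<lambda>_ _. 0"])

lemma path_norm_zero: "path_norm h (\<lambda>_. 0) = 0"
proof -
  have "path_norm h (\<lambda>_. 0) \<le> ennreal 0" by (subst path_norm_le_iff) auto
  then show ?thesis by simp
qed

lemma path_space_zero: "(\<lambda>_. 0) \<in> path_space h"
  unfolding path_space_def by (auto simp: path_norm_zero intro!: bexI[OF _ test_paths_zero])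

lemma path_space_diff:
  assumes \<omega>: "\<omega> \<in> path_space h" and \<eta>: "\<eta> \<in> path_space h"
  shows "(\<lambda>t. \<omega> t - \<eta> t) \<in> path_space h"
proof -
  have "\<exists>\<phi>\<in>test_paths. path_norm h (\<lambda>t. (\<omega> t - \<eta> t) - \<phi> t) < ennreal \<epsilon>" if "\<epsilon> > 0" for \<epsilon>
  proof -
    have "\<epsilon> / 2 > 0" using that by simp
    then obtain \<phi> \<psi> where *: "\<phi> \<in> test_paths" "path_norm h (\<lambda>t. \<omega> t - \<phi> t) < ennreal (\<epsilon>/2)"
        "\<psi> \<in> test_paths" "path_norm h (\<lambda>t. \<eta> t - \<psi> t) < ennreal (\<epsilon>/2)"
      using \<omega> \<eta> unfolding path_space_def by blast
    have "path_norm h (\<lambda>t. (\<omega> t - \<eta> t) - (\<phi> t - \<psi> t)) \<le>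
        path_norm h (\<lambda>t. (\<omega> t - \<eta> t) - (\<phi> t - \<eta> t)) + path_norm h (\<lambda>t. (\<phi> t - \<eta> t) - (\<phi> t - \<psi> t))"
      by (rule path_norm_triangle)
    also have "\<dots> = path_norm h (\<lambda>t. \<omega> t - \<phi> t) + path_norm h (\<lambda>t. \<eta> t - \<psi> t)"
      by (subst (3) path_norm_minus_commute) simp
    also have "\<dots> < ennreal (\<epsilon>/2) + ennreal (\<epsilon>/2)" using * by (intro add_strict_mono)
    also have "\<dots> = ennreal \<epsilon>" using that by (simp add: ennreal_plus[symmetric] del: ennreal_plus)
    finally show ?thesis using test_paths_diff[OF *(1,3)] by (intro bexI[of _ "\<lambda>t. \<phi> t - \<psi> t"])
  qed
  then show ?thesis
    using assms path_norm_diff_finite[OF \<omega> \<eta>] by (auto simp: path_space_def)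
qed

lemma path_space_holder:
  assumes "\<omega> \<in> path_space h"
  obtains C where "0 \<le> C" "\<And>s t. s \<le> 0 \<Longrightarrow> t \<le> 0 \<Longrightarrow>
    norm (\<omega> t - \<omega> s) \<le> C * (sqrt (1 + \<bar>t\<bar> + \<bar>s\<bar>) * \<bar>t - s\<bar> powr ((1 - h) / 2))"
proof -
  define C where "C = enn2real (path_norm h \<omega>)"
  have "path_norm h \<omega> \<le> ennreal C" "0 \<le> C"
    using assms by (auto simp: C_def path_space_def)
  then show ?thesis using that[of C] path_norm_le_iff[of C h \<omega>] by blast
qed

lemma path_space_continuous_on:
  assumes "h < 1" "\<omega> \<in> path_space h"
  shows "continuous_on {..0} \<omega>"
proof -
  obtain C where C: "\<And>s t. s \<le> 0 \<Longrightarrow> t \<le> 0 \<Longrightarrow>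
    norm (\<omega> t - \<omega> s) \<le> C * (sqrt (1 + \<bar>t\<bar> + \<bar>s\<bar>) * \<bar>t - s\<bar> powr ((1 - h) / 2))"
    using path_space_holder[OF assms(2)] by metis
  show ?thesis unfolding continuous_on_def
  proof
    fix s :: real assume s: "s \<in> {..0}"
    have "((\<lambda>t. C * (sqrt (1 + \<bar>t\<bar> + \<bar>s\<bar>) * \<bar>t - s\<bar> powr ((1 - h) / 2))) \<longlongrightarrow>
        C * (sqrt (1 + \<bar>s\<bar> + \<bar>s\<bar>) * \<bar>s - s\<bar> powr ((1 - h) / 2))) (at s within {..0})"
      using assms(1) by (intro tendsto_intros) auto
    then have "((\<lambda>t. C * (sqrt (1 + \<bar>t\<bar> + \<bar>s\<bar>) * \<bar>t - s\<bar> powr ((1 - h) / 2))) \<longlongrightarrow> 0)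
        (at s within {..0})" by simp
    then have "((\<lambda>t. \<omega> t - \<omega> s) \<longlongrightarrow> 0) (at s within {..0})"
    proof (rule Lim_null_comparison[rotated])
      show "\<forall>\<^sub>F t in at s within {..0}. norm (\<omega> t - \<omega> s) \<le>
          C * (sqrt (1 + \<bar>t\<bar> + \<bar>s\<bar>) * \<bar>t - s\<bar> powr ((1 - h) / 2))"
        unfolding eventually_at_filter by (rule always_eventually) (use s C in auto)
    qed
    then show "(\<omega> \<longlongrightarrow> \<omega> s) (at s within {..0})" by (simp add: Lim_null[symmetric])
  qed
qed

section \<open>Separability of the path space\<close>

lemma path_norm_interpolation:
  assumes h: "0 < h" "h < 1" and L: "0 \<le> L" and \<epsilon>: "0 \<le> \<epsilon>"
    and lip: "\<And>s t. s \<le> 0 \<Longrightarrow> t \<le> 0 \<Longrightarrow> norm (f t - f s) \<le> L * \<bar>t - s\<bar>"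
    and small: "\<And>t. t \<le> 0 \<Longrightarrow> norm (f t) \<le> \<epsilon>"
  shows "path_norm h f \<le> ennreal ((2 * \<epsilon>) powr ((1 + h) / 2) * L powr ((1 - h) / 2))"
proof (subst path_norm_le_iff)
  show "\<forall>s\<le>0. \<forall>t\<le>0. norm (f t - f s) \<le> (2 * \<epsilon>) powr ((1 + h) / 2) * L powr ((1 - h) / 2) *
      (sqrt (1 + \<bar>t\<bar> + \<bar>s\<bar>) * \<bar>t - s\<bar> powr ((1 - h) / 2))"
  proof (intro allI impI)
    fix s t :: real assume st: "s \<le> 0" "t \<le> 0"
    define n where "n = norm (f t - f s)"
    have n: "n \<le> 2 * \<epsilon>" "n \<le> L * \<bar>t - s\<bar>" "0 \<le> n"
      using lip[OF st] small[OF st(1)] small[OF st(2)] norm_triangle_ineq4[of "f t" "f s"]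
      by (auto simp: n_def)
    \<comment> \<open>Interpolation: an increment bounded both by 2 \<epsilon> and by
      \<open>L * \<bar>t - s\<bar>\<close> is at most the product of these bounds with exponents (1
      + h) / 2 and (1 - h) / 2, which add up to 1. The second is the Hoelder exponent of the norm,
      so uniformly close paths with a common Lipschitz constant are close in the norm.\<close>
    have "n = n powr ((1 + h) / 2 + (1 - h) / 2)" using n by (simp add: field_simps)
    also have "\<dots> = n powr ((1 + h) / 2) * n powr ((1 - h) / 2)" by (rule powr_add)
    also have "\<dots> \<le> (2 * \<epsilon>) powr ((1 + h) / 2) * (L * \<bar>t - s\<bar>) powr ((1 - h) / 2)"
      using n h by (intro mult_mono powr_mono2) auto
    also have "\<dots> = (2 * \<epsilon>) powr ((1 + h) / 2) * L powr ((1 - h) / 2) * (1 * \<bar>t - s\<bar> powr ((1 - h) / 2))"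
      using L by (simp add: powr_mult)
    also have "\<dots> \<le> (2 * \<epsilon>) powr ((1 + h) / 2) * L powr ((1 - h) / 2) *
        (sqrt (1 + \<bar>t\<bar> + \<bar>s\<bar>) * \<bar>t - s\<bar> powr ((1 - h) / 2))"
      by (intro mult_left_mono mult_right_mono) auto
    finally show "norm (f t - f s) \<le> (2 * \<epsilon>) powr ((1 + h) / 2) * L powr ((1 - h) / 2) *
      (sqrt (1 + \<bar>t\<bar> + \<bar>s\<bar>) * \<bar>t - s\<bar> powr ((1 - h) / 2))" by (simp add: n_def)
  qed
qed simp

text \<open>A single natural number bounds support and slope together, so test paths fall into
  countably many classes, and interpolation is uniform on each of them.\<close>

lemma test_paths_lipschitz:
  assumes "\<phi> \<in> test_paths"
  obtains n :: nat where "\<And>t. t < - real n \<Longrightarrow> \<phi> t = 0"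
    "\<And>s t. s \<le> 0 \<Longrightarrow> t \<le> 0 \<Longrightarrow> norm (\<phi> t - \<phi> s) \<le> real n * \<bar>t - s\<bar>"
proof -
  obtain T D where TD: "\<forall>t<T. \<phi> t = 0" "D 0 = \<phi>"
      "\<And>n t. t\<le>0 \<Longrightarrow> (D n has_vector_derivative D (Suc n) t) (at t within {..0})"
    using assms by (auto simp: test_paths_def)
  \<comment> \<open>One unit beyond \<bar>T\<bar>: then -R < T, so the path vanishes at -R, and the
    interval is nondegenerate whatever the sign of T.\<close>
  define R where "R = \<bar>T\<bar> + 1"
  have "continuous_on {..0} (D 1)"
    unfolding continuous_on_eq_continuous_within
    using TD(3)[of _ 1] by (auto intro: has_vector_derivative_continuous)
  then have "bounded (D 1 ` {-R..0})"
    by (intro compact_imp_bounded compact_continuous_image) (auto intro: continuous_on_subset)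
  then obtain B where B: "\<And>t. t \<in> {-R..0} \<Longrightarrow> norm (D 1 t) \<le> B"
    unfolding bounded_iff by (metis image_eqI)
  have cl: "norm (\<phi> t - \<phi> s) \<le> B * norm (t - s)" if "s \<in> {-R..0}" "t \<in> {-R..0}" for s t
  proof (rule differentiable_bound[of "{-R..0}" \<phi> "\<lambda>x h. h *\<^sub>R D 1 x"])
    fix x assume x: "x \<in> {-R..0}"
    show "(\<phi> has_derivative (\<lambda>h. h *\<^sub>R D 1 x)) (at x within {-R..0})"
      using TD(3)[of x 0] x TD(2) unfolding has_vector_derivative_def
      by (auto intro: has_derivative_subset)
    show "onorm (\<lambda>h. h *\<^sub>R D 1 x) \<le> B" using B[OF x] 
      by (intro onorm_le) (simp, metis mult.commute mult_left_mono abs_ge_zero)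
  qed (use that in auto)
  have z: "\<phi> t = 0" if "t \<le> - R" for t using TD(1) that by (auto simp: R_def)
  have B0: "0 \<le> B" using order_trans[OF norm_ge_zero B[of 0]] by (simp add: R_def)
  have lip: "norm (\<phi> t - \<phi> s) \<le> B * \<bar>t - s\<bar>" if st: "s \<le> t" "t \<le> 0" for s t
  proof (cases "-R \<le> s")
    case True then show ?thesis using cl[of s t] st by auto
  next
    case s: False
    show ?thesis
    proof (cases "-R \<le> t")
      case True
      have "norm (\<phi> t - \<phi> s) = norm (\<phi> t - \<phi> (-R))" using z[of s] z[of "-R"] s by simp
      also have "\<dots> \<le> B * \<bar>t + R\<bar>" using cl[of "-R" t] True st by (simp add: R_def algebra_simps)
      also have "\<dots> \<le> B * \<bar>t - s\<bar>" using B0 True s by (intro mult_left_mono) auto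
      finally show ?thesis .
    next
      case False then show ?thesis using z[of s] z[of t] s B0 by simp
    qed
  qed
  obtain n where n: "max B R < real n" using reals_Archimedean2 by blast
  show ?thesis
  proof (rule that[of n])
    show "\<phi> t = 0" if "t < - real n" for t using z[of t] that n by auto
    fix s t :: real assume "s \<le> 0" "t \<le> 0"
    then have "norm (\<phi> t - \<phi> s) \<le> B * \<bar>t - s\<bar>"
      using lip[of s t] lip[of t s] by (cases "s \<le> t") (auto simp: norm_minus_commute abs_minus_commute)
    also have "\<dots> \<le> n * \<bar>t - s\<bar>" using n by (intro mult_right_mono) auto
    finally show "norm (\<phi> t - \<phi> s) \<le> n * \<bar>t - s\<bar>" .
  qed
qed


lemma test_paths_finite_norm:
  assumes "0 < h" "h < 1" "\<phi> \<in> test_paths"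
  shows "path_norm h \<phi> < \<infinity>"
proof -
  obtain n :: nat where n: "\<And>t. t < - real n \<Longrightarrow> \<phi> t = 0"
    "\<And>s t. s \<le> 0 \<Longrightarrow> t \<le> 0 \<Longrightarrow> norm (\<phi> t - \<phi> s) \<le> real n * \<bar>t - s\<bar>"
    using test_paths_lipschitz[OF assms(3)] by blast
  have "norm (\<phi> t) \<le> real n * real n" if "t \<le> 0" for t
  proof (cases "t < - real n")
    case False
    have "norm (\<phi> t) = norm (\<phi> t - \<phi> 0)" using assms(3) by (simp add: test_paths_def)
    also have "\<dots> \<le> real n * \<bar>t - 0\<bar>" using n(2)[of 0 t] that by simp
    also have "\<dots> \<le> real n * real n" using False that by (intro mult_left_mono) auto
    finally show ?thesis .
  qed (use n(1) in simp)
  then have "path_norm h \<phi> \<le>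
      ennreal ((2 * (real n * real n)) powr ((1 + h) / 2) * real n powr ((1 - h) / 2))"
    using assms n by (intro path_norm_interpolation) auto
  then show ?thesis by (auto simp: less_top[symmetric] top_unique)
qed

lemma test_paths_subset_path_space:
  assumes "0 < h" "h < 1"
  shows "test_paths \<subseteq> path_space h"
proof
  fix \<phi> :: "real \<Rightarrow> real ^ 'd" assume \<phi>: "\<phi> \<in> test_paths"
  have "\<exists>\<psi>\<in>test_paths. path_norm h (\<lambda>t. \<phi> t - \<psi> t) < ennreal \<epsilon>" if "\<epsilon> > 0" for \<epsilon>
    using \<phi> that by (intro bexI[of _ \<phi>]) (auto simp: path_norm_zero)
  then show "\<phi> \<in> path_space h"
    using \<phi> test_paths_finite_norm[OF assms \<phi>] by (auto simp: path_space_def test_paths_def)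
qed

text \<open>Test paths are sorted by countably many codes: a bound n for support and slope, a mesh
  1/m, and a list of indices of dense points close to the grid values. Two paths with the same code
  differ uniformly by at most (2 n + 2) / m, two slopes across a mesh cell plus two grid errors,
  hence by little in the norm. One representative per nonempty code is enough.\<close>

lemma path_space_separable:
  assumes h: "0 < h" "h < 1"
  obtains D :: "('d::finite) path set" where "countable D" "D \<subseteq> path_space h"
    "\<And>\<omega> \<epsilon>. \<omega> \<in> path_space h \<Longrightarrow> 0 < \<epsilon> \<Longrightarrow> \<exists>\<phi>\<in>D. path_norm h (\<lambda>t. \<omega> t - \<phi> t) < ennreal \<epsilon>"
proof -
  obtain E :: "(real ^ 'd) set" where E: "countable E" "\<And>X. open X \<Longrightarrow> X \<noteq> {} \<Longrightarrow> \<exists>d\<in>E. d \<in> X"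
    using countable_dense_exists by metis
  then have "E \<noteq> {}" using E(2)[of UNIV] by auto
  define e where "e = from_nat_into E"
  have e: "\<exists>k. dist x (e k) < r" if "r > 0" for x r
  proof -
    obtain d where "d \<in> E" "d \<in> ball x r" using E(2)[of "ball x r"] \<open>r > 0\<close> by auto
    moreover have "d \<in> range e" using \<open>d \<in> E\<close> E(1) \<open>E \<noteq> {}\<close> by (simp add: e_def)
    ultimately show ?thesis by auto
  qed
  define Q where "Q = (\<lambda>(n::nat, m::nat, c::nat list) \<phi>. \<phi> \<in> (test_paths :: 'd path set) \<and>
    (\<forall>t. t < - real n \<longrightarrow> \<phi> t = 0) \<and>
    (\<forall>s\<le>0. \<forall>t\<le>0. norm (\<phi> t - \<phi> s) \<le> real n * \<bar>t - s\<bar>) \<and>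
    (\<forall>k\<le>n*m. dist (\<phi> (- (real k / real m))) (e (c ! k)) < 1 / real m))"
  define D where "D = (\<lambda>i. Eps (Q i)) ` {i. \<exists>\<phi>. Q i \<phi>}"
  have DQ: "Q i (Eps (Q i))" if "\<exists>\<phi>. Q i \<phi>" for i using that by (rule someI_ex)
  have Dt: "D \<subseteq> test_paths"
  proof
    fix \<phi> assume "\<phi> \<in> D"
    then obtain i where "Q i \<phi>" using DQ unfolding D_def by blast
    then show "\<phi> \<in> test_paths" by (auto simp: Q_def split: prod.splits)
  qed
  have dense: "\<exists>\<psi>\<in>D. path_norm h (\<lambda>t. \<phi> t - \<psi> t) < ennreal \<epsilon>"
    if \<phi>: "\<phi> \<in> test_paths" and \<epsilon>: "0 < \<epsilon>" for \<phi> \<epsilon>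
  proof -
    obtain n :: nat where n: "\<And>t. t < - real n \<Longrightarrow> \<phi> t = 0"
      "\<And>s t. s \<le> 0 \<Longrightarrow> t \<le> 0 \<Longrightarrow> norm (\<phi> t - \<phi> s) \<le> real n * \<bar>t - s\<bar>"
      using test_paths_lipschitz[OF \<phi>] by blast
    \<comment> \<open>This is the interpolation bound for the uniform distance (2 n + 2) / m and the
      Lipschitz constant 2 n of a difference. It vanishes in the limit because (1 + h) / 2 is
      positive.\<close>
    have "((\<lambda>m. (2 * ((2 * real n + 2) * inverse (real m))) powr ((1 + h) / 2) * (2 * real n) powr ((1 - h) / 2))
        \<longlonglongrightarrow> (2 * ((2 * real n + 2) * 0)) powr ((1 + h) / 2) * (2 * real n) powr ((1 - h) / 2))"
      using h by (intro tendsto_intros tendsto_powr' lim_inverse_n) (auto intro!: always_eventually)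
    then have "((\<lambda>m. (2 * ((2 * real n + 2) * inverse (real m))) powr ((1 + h) / 2) * (2 * real n) powr ((1 - h) / 2))
        \<longlonglongrightarrow> 0)" by simp
    then have "eventually (\<lambda>m. (2 * ((2 * real n + 2) * inverse (real m))) powr ((1 + h) / 2) *
        (2 * real n) powr ((1 - h) / 2) < \<epsilon>) sequentially"
      using \<epsilon> by (rule order_tendstoD)
    then obtain m where m: "(2 * ((2 * real n + 2) * inverse (real m))) powr ((1 + h) / 2) *
        (2 * real n) powr ((1 - h) / 2) < \<epsilon>" "0 < m"
      using eventually_conj[OF _ eventually_gt_at_top[of 0]] eventually_happens'[OF sequentially_bot]
      by (metis (mono_tags, lifting))
    define c where "c = map (\<lambda>k. SOME j. dist (\<phi> (- (real k / real m))) (e j) < 1 / real m) [0..<Suc (n*m)]"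
    have "dist (\<phi> (- (real k / real m))) (e (c ! k)) < 1 / real m" if "k \<le> n*m" for k
    proof -
      have "c ! k = (SOME j. dist (\<phi> (- (real k / real m))) (e j) < 1 / real m)"
        using that by (simp add: c_def del: upt_Suc)
      then show ?thesis using someI_ex[OF e[of "1 / real m" "\<phi> (- (real k / real m))"]] m(2) by simp
    qed
    then have Q\<phi>: "Q (n, m, c) \<phi>" using \<phi> n by (auto simp: Q_def)
    define \<psi> where "\<psi> = Eps (Q (n, m, c))"
    have Q\<psi>: "Q (n, m, c) \<psi>" unfolding \<psi>_def by (rule someI[of "Q (n, m, c)", OF Q\<phi>])
    have "\<psi> \<in> D" unfolding D_def \<psi>_def using Q\<phi> by blast
    have "path_norm h (\<lambda>t. \<phi> t - \<psi> t) \<le> ennreal ((2 * ((2 * real n + 2) * inverse (real m))) powr ((1 + h) / 2) *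
        (2 * real n) powr ((1 - h) / 2))"
    proof (rule path_norm_interpolation)
      fix s t :: real assume st: "s \<le> 0" "t \<le> 0"
      have "norm ((\<phi> t - \<psi> t) - (\<phi> s - \<psi> s)) \<le> norm (\<phi> t - \<phi> s) + norm (\<psi> t - \<psi> s)"
        using norm_triangle_ineq4[of "\<phi> t - \<phi> s" "\<psi> t - \<psi> s"] by (simp add: algebra_simps)
      also have "\<dots> \<le> real n * \<bar>t - s\<bar> + real n * \<bar>t - s\<bar>"
        using Q\<phi> Q\<psi> st by (intro add_mono) (auto simp: Q_def)
      finally show "norm ((\<phi> t - \<psi> t) - (\<phi> s - \<psi> s)) \<le> 2 * real n * \<bar>t - s\<bar>" by simp
    next
      fix t :: real assume t: "t \<le> 0"
      show "norm (\<phi> t - \<psi> t) \<le> (2 * real n + 2) * inverse (real m)"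
      proof (cases "t < - real n")
        case True then show ?thesis using Q\<phi> Q\<psi> by (simp add: Q_def)
      next
        case False
        define k where "k = nat \<lfloor>- t * real m\<rfloor>"
        have nn: "0 \<le> - t * real m" using t by (simp add: mult_nonpos_nonneg)
        have k1: "real k \<le> - t * real m" "- t * real m < real k + 1"
          using nn by (auto simp: k_def)
        have "- t * real m \<le> real n * real m" using False by (intro mult_right_mono) auto
        then have "real k \<le> real (n * m)" using k1 by simp
        then have k: "k \<le> n * m" by (simp only: of_nat_le_iff)
        define u where "u = - (real k / real m)"
        have u: "\<bar>t - u\<bar> \<le> 1 / real m" "u \<le> 0"
        proof -
          have "t - u = (t * real m + real k) / real m" using m(2) by (simp add: u_def field_simps)
          also have "\<bar>\<dots>\<bar> \<le> 1 / real m"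
            unfolding abs_divide using k1 m(2) by (simp add: divide_right_mono)
          finally show "\<bar>t - u\<bar> \<le> 1 / real m" .
          show "u \<le> 0" by (simp add: u_def)
        qed
        have a: "norm (\<phi> t - \<phi> u) \<le> real n * (1 / real m)" "norm (\<psi> t - \<psi> u) \<le> real n * (1 / real m)"
        proof -
          have "norm (\<phi> t - \<phi> u) \<le> real n * \<bar>t - u\<bar>" "norm (\<psi> t - \<psi> u) \<le> real n * \<bar>t - u\<bar>"
            using Q\<phi> Q\<psi> t u by (auto simp: Q_def)
          moreover have "real n * \<bar>t - u\<bar> \<le> real n * (1 / real m)" using u by (intro mult_left_mono) auto
          ultimately show "norm (\<phi> t - \<phi> u) \<le> real n * (1 / real m)" "norm (\<psi> t - \<psi> u) \<le> real n * (1 / real m)"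
            by linarith+
        qed
        have b: "dist (\<phi> u) (e (c ! k)) < 1 / real m" "dist (\<psi> u) (e (c ! k)) < 1 / real m"
          using Q\<phi> Q\<psi> k by (auto simp: Q_def u_def)
        have "norm (\<phi> t - \<psi> t) \<le> norm (\<phi> t - \<phi> u) + norm (\<psi> t - \<psi> u) + dist (\<phi> u) (e (c ! k)) + dist (\<psi> u) (e (c ! k))"
          unfolding dist_norm
          using norm_triangle_ineq[of "\<phi> t - \<phi> u" "\<phi> u - e (c!k)"] norm_triangle_ineq[of "\<psi> t - \<psi> u" "\<psi> u - e (c!k)"]
            norm_triangle_ineq4[of "\<phi> t - e (c!k)" "\<psi> t - e (c!k)"] by simp
        also have "\<dots> \<le> real n * (1 / real m) + real n * (1 / real m) + 1 / real m + 1 / real m"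
          using a b by linarith
        also have "\<dots> = (2 * real n + 2) * inverse (real m)" using m(2) by (simp add: field_simps)
        finally show ?thesis .
      qed
    qed (use h in auto)
    also have "\<dots> < ennreal \<epsilon>" using m \<epsilon> by (simp add: ennreal_less_iff)
    finally show ?thesis using \<open>\<psi> \<in> D\<close> by auto
  qed
  show ?thesis
  proof (rule that[of D])
    show "countable D" unfolding D_def by (intro countable_image) auto
    show "D \<subseteq> path_space h" using Dt test_paths_subset_path_space[OF h] by auto
    fix \<omega> :: "'d path" and \<epsilon> :: real assume A: "\<omega> \<in> path_space h" "0 < \<epsilon>"
    then have "0 < \<epsilon>/2" by simp
    then obtain \<phi> where \<phi>: "\<phi> \<in> test_paths" "path_norm h (\<lambda>t. \<omega> t - \<phi> t) < ennreal (\<epsilon>/2)"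
      using A(1) unfolding path_space_def by blast
    obtain \<psi> where \<psi>: "\<psi> \<in> D" "path_norm h (\<lambda>t. \<phi> t - \<psi> t) < ennreal (\<epsilon>/2)"
      using dense[OF \<phi>(1) \<open>0 < \<epsilon>/2\<close>] by blast
    have "path_norm h (\<lambda>t. \<omega> t - \<psi> t) \<le> path_norm h (\<lambda>t. \<omega> t - \<phi> t) + path_norm h (\<lambda>t. \<phi> t - \<psi> t)"
      by (rule path_norm_triangle)
    also have "\<dots> < ennreal (\<epsilon>/2) + ennreal (\<epsilon>/2)" using \<phi> \<psi> by (intro add_strict_mono)
    also have "\<dots> = ennreal \<epsilon>" using A by (simp add: ennreal_plus[symmetric] del: ennreal_plus)
    finally show "\<exists>\<phi>\<in>D. path_norm h (\<lambda>t. \<omega> t - \<phi> t) < ennreal \<epsilon>" using \<psi>(1) by auto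
  qed
qed


section \<open>Evaluations generate the Borel sets\<close>

lemma space_path_borel [simp]: "space (path_borel h :: ('d::finite) path measure) = path_space h"
  and sets_path_borel: "sets (path_borel h :: ('d::finite) path measure) =
    sigma_sets (path_space h) {U. openin (path_top h) U}"
proof -
  interpret Metric_space "path_space h" "path_dist h" by (rule Metric_space_path_space)
  have "{U. openin (path_top h) U} \<subseteq> Pow (path_space h :: 'd path set)"
    using openin_subset[of mtopology] by (auto simp: path_top_def)
  then show "space (path_borel h :: 'd path measure) = path_space h"
    "sets (path_borel h :: 'd path measure) = sigma_sets (path_space h) {U. openin (path_top h) U}"
    by (auto simp: path_borel_def space_measure_of sets_measure_of)
qed

lemma openin_path_top_iff:
  "openin (path_top h) U \<longleftrightarrow> U \<subseteq> path_space h \<and>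
    (\<forall>\<omega>\<in>U. \<exists>\<epsilon>>0. \<forall>\<eta>\<in>path_space h. path_norm h (\<lambda>t. \<omega> t - \<eta> t) < ennreal \<epsilon> \<longrightarrow> \<eta> \<in> U)"
proof -
  interpret Metric_space "path_space h" "path_dist h" by (rule Metric_space_path_space)
  have *: "path_dist h \<omega> \<eta> < \<epsilon> \<longleftrightarrow> path_norm h (\<lambda>t. \<omega> t - \<eta> t) < ennreal \<epsilon>"
    if in_space: "\<omega> \<in> path_space h" "\<eta> \<in> path_space h" "\<epsilon> > 0" for \<omega> \<eta> \<epsilon>
  proof -
    obtain d where d: "path_norm h (\<lambda>t. \<omega> t - \<eta> t) = ennreal d" "0 \<le> d"
      using path_norm_diff_finite[OF in_space(1,2)] by (cases "path_norm h (\<lambda>t. \<omega> t - \<eta> t)") auto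
    then show ?thesis using in_space by (simp add: path_dist_def ennreal_less_iff)
  qed
  show ?thesis
  proof
    assume U: "openin (path_top h) U"
    then have sub: "U \<subseteq> path_space h" using openin_subset[of mtopology U] by (auto simp: path_top_def)
    have ball: "\<exists>\<epsilon>>0. \<forall>\<eta>\<in>path_space h. path_norm h (\<lambda>t. \<omega> t - \<eta> t) < ennreal \<epsilon> \<longrightarrow> \<eta> \<in> U"
      if w: "\<omega> \<in> U" for \<omega>
    proof -
      obtain r where r: "r > 0" "mball \<omega> r \<subseteq> U" using U w by (auto simp: path_top_def openin_mtopology)
      have "\<eta> \<in> U" if "\<eta> \<in> path_space h" "path_norm h (\<lambda>t. \<omega> t - \<eta> t) < ennreal r" for \<eta>
      proof -
        have "\<omega> \<in> path_space h" using sub w by blast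
        then have "\<eta> \<in> mball \<omega> r" using *[of \<omega> \<eta> r] that r(1) by (simp add: in_mball)
        then show ?thesis using r(2) by blast
      qed
      then show ?thesis using r(1) by blast
    qed
    show "U \<subseteq> path_space h \<and> (\<forall>\<omega>\<in>U. \<exists>\<epsilon>>0. \<forall>\<eta>\<in>path_space h.
      path_norm h (\<lambda>t. \<omega> t - \<eta> t) < ennreal \<epsilon> \<longrightarrow> \<eta> \<in> U)"
      by (intro conjI ballI sub ball)
  next
    assume U: "U \<subseteq> path_space h \<and> (\<forall>\<omega>\<in>U. \<exists>\<epsilon>>0. \<forall>\<eta>\<in>path_space h.
      path_norm h (\<lambda>t. \<omega> t - \<eta> t) < ennreal \<epsilon> \<longrightarrow> \<eta> \<in> U)"
    have "\<exists>r>0. mball \<omega> r \<subseteq> U" if w: "\<omega> \<in> U" for \<omega>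
    proof -
      obtain \<epsilon> where "\<epsilon> > 0" "\<forall>\<eta>\<in>path_space h. path_norm h (\<lambda>t. \<omega> t - \<eta> t) < ennreal \<epsilon> \<longrightarrow> \<eta> \<in> U"
        using U w by blast
      then have "mball \<omega> \<epsilon> \<subseteq> U" using *[of \<omega> _ \<epsilon>] by (fastforce simp: in_mball)
      then show ?thesis using \<open>\<epsilon> > 0\<close> by blast
    qed
    with U show "openin (path_top h) U" by (auto simp: path_top_def openin_mtopology)
  qed
qed

text \<open>Evaluation at t < 0 is continuous: paths vanish at 0, so the pair (0, t) in the norm
  controls the value at t up to the weight \<open>w\<close>. At nonnegative times every path is
  0.\<close>

lemma measurable_path_eval:
  assumes h: "h < 1"
  shows "(\<lambda>\<omega>. \<omega> t) \<in> borel_measurable (path_borel h :: ('d::finite) path measure)"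
proof (cases "t < 0")
  case True
  show ?thesis
  proof (rule borel_measurableI)
    fix S :: "(real ^ 'd) set" assume S: "open S"
    define w where "w = sqrt (1 + \<bar>t\<bar> + \<bar>0\<bar>) * \<bar>t - 0\<bar> powr ((1 - h) / 2)"
    have w: "w > 0" using True by (simp add: w_def)
    have "openin (path_top h) ((\<lambda>\<omega>. \<omega> t) -` S \<inter> path_space h)"
      unfolding openin_path_top_iff
    proof (safe)
      fix \<omega> :: "'d path" assume \<omega>: "\<omega> t \<in> S" "\<omega> \<in> path_space h"
      then obtain e where e: "e > 0" "ball (\<omega> t) e \<subseteq> S" using S openE by blast
      have "\<eta> t \<in> S" if \<eta>: "\<eta> \<in> path_space h" "path_norm h (\<lambda>t. \<omega> t - \<eta> t) < ennreal (e / w)" for \<eta>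
      proof -
        obtain C where C: "path_norm h (\<lambda>t. \<omega> t - \<eta> t) = ennreal C" "0 \<le> C"
          using \<eta>(2) by (cases "path_norm h (\<lambda>t. \<omega> t - \<eta> t)") auto
        then have "path_norm h (\<lambda>t. \<omega> t - \<eta> t) \<le> ennreal C" by simp
        then have "norm ((\<omega> t - \<eta> t) - (\<omega> 0 - \<eta> 0)) \<le> C * w"
          using True by (subst (asm) path_norm_le_iff[OF C(2)]) (auto simp: w_def)
        moreover have "\<omega> 0 = 0" "\<eta> 0 = 0" using \<omega> \<eta> by (auto simp: path_space_def)
        moreover have "C * w < e" using C \<eta>(2) w by (simp add: ennreal_less_iff pos_less_divide_eq)
        ultimately have "dist (\<omega> t) (\<eta> t) < e" by (simp add: dist_norm)
        then show ?thesis using e by auto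
      qed
      then show "\<exists>\<epsilon>>0. \<forall>\<eta>\<in>path_space h. path_norm h (\<lambda>t. \<omega> t - \<eta> t) < ennreal \<epsilon> \<longrightarrow>
          \<eta> \<in> (\<lambda>\<omega>. \<omega> t) -` S \<inter> path_space h"
        using e w by (intro exI[of _ "e / w"]) auto
    qed
    then show "(\<lambda>\<omega>. \<omega> t) -` S \<inter> space (path_borel h) \<in> sets (path_borel h)"
      by (auto simp: sets_path_borel)
  qed
next
  case False
  have "(\<lambda>\<omega>. \<omega> t) \<in> borel_measurable (path_borel h :: 'd path measure) \<longleftrightarrow>
      (\<lambda>\<omega>. 0 :: real ^ 'd) \<in> borel_measurable (path_borel h :: 'd path measure)"
    using False by (intro measurable_cong) (auto simp: path_space_def)
  then show ?thesis by simp
qed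

text \<open>Both sides of the Hoelder inequality are continuous in the two times, so rational times
  decide it. This turns a closed norm ball into a countable intersection of conditions on
  evaluations.\<close>

lemma path_norm_le_rational:
  fixes f :: "('d::finite) path"
  assumes h: "h < 1" and C: "0 \<le> C" and f: "continuous_on {..0} f"
    and le: "\<And>s t. s \<in> \<rat> \<Longrightarrow> t \<in> \<rat> \<Longrightarrow> s \<le> 0 \<Longrightarrow> t \<le> 0 \<Longrightarrow>
      norm (f t - f s) \<le> C * (sqrt (1 + \<bar>t\<bar> + \<bar>s\<bar>) * \<bar>t - s\<bar> powr ((1 - h) / 2))"
  shows "path_norm h f \<le> ennreal C"
proof (subst path_norm_le_iff[OF C], intro allI impI)
  fix s t :: real assume st: "s \<le> 0" "t \<le> 0"
  have ex: "\<exists>r. (\<forall>n. r n \<in> \<rat> \<and> r n \<le> 0) \<and> r \<longlonglongrightarrow> u" if "u \<le> 0" for u :: real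
  proof -
    have "\<exists>q\<in>\<rat>. u - inverse (real (Suc n)) < q \<and> q < u" for n by (intro Rats_dense_in_real) auto
    then obtain r where r: "\<And>n. r n \<in> \<rat>" "\<And>n. u - inverse (real (Suc n)) < r n" "\<And>n. r n < u" by metis
    have "r \<longlonglongrightarrow> u"
    proof (rule tendsto_sandwich[OF always_eventually always_eventually])
      show "(\<lambda>n. u - inverse (real (Suc n))) \<longlonglongrightarrow> u"
        using tendsto_diff[OF tendsto_const LIMSEQ_inverse_real_of_nat, of u] by simp
      show "(\<lambda>_. u) \<longlonglongrightarrow> u" by simp
    qed (use r in \<open>auto intro: less_imp_le\<close>)
    moreover have "r n \<le> 0" for n using r(3)[of n] that by simp
    ultimately show ?thesis using r by blast
  qed
  obtain a where a: "\<And>n. a n \<in> \<rat>" "\<And>n. a n \<le> 0" "a \<longlonglongrightarrow> s" using ex[OF st(1)] by blast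
  obtain b where b: "\<And>n. b n \<in> \<rat>" "\<And>n. b n \<le> 0" "b \<longlonglongrightarrow> t" using ex[OF st(2)] by blast
  have fa: "(\<lambda>n. f (a n)) \<longlonglongrightarrow> f s" "(\<lambda>n. f (b n)) \<longlonglongrightarrow> f t"
    using a b st by (auto intro!: continuous_on_tendsto_compose[OF f])
  have "(\<lambda>n. norm (f (b n) - f (a n))) \<longlonglongrightarrow> norm (f t - f s)"
    using fa by (intro tendsto_intros)
  moreover have "(\<lambda>n. C * (sqrt (1 + \<bar>b n\<bar> + \<bar>a n\<bar>) * \<bar>b n - a n\<bar> powr ((1 - h) / 2))) \<longlonglongrightarrow>
      C * (sqrt (1 + \<bar>t\<bar> + \<bar>s\<bar>) * \<bar>t - s\<bar> powr ((1 - h) / 2))"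
    using a b h by (intro tendsto_intros tendsto_powr') (auto intro!: always_eventually)
  ultimately show "norm (f t - f s) \<le> C * (sqrt (1 + \<bar>t\<bar> + \<bar>s\<bar>) * \<bar>t - s\<bar> powr ((1 - h) / 2))"
    by (rule LIMSEQ_le) (use le a b in auto)
qed

definition cylinders :: "real \<Rightarrow> ('d::finite) path set set" where
  "cylinders h = {{\<omega> \<in> path_space h. \<omega> t \<in> A} | t A. t < 0 \<and> A \<in> sets borel}"

text \<open>By separability an open set is a countable union of closed balls with centres in a
  countable dense set, and each such ball is described by evaluations at rational times. As a
  consequence, measurability into the path space can be checked at one time after another.\<close>

lemma sets_path_borel_cylinders:
  assumes h: "0 < h" "h < 1"
  shows "sets (path_borel h :: ('d::finite) path measure) = sigma_sets (path_space h) (cylinders h)"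
proof
  have "cylinders h \<subseteq> sets (path_borel h :: 'd path measure)"
  proof
    fix X :: "'d path set" assume "X \<in> cylinders h"
    then obtain t A where X: "X = {\<omega> \<in> path_space h. \<omega> t \<in> A}" "A \<in> sets borel"
      by (auto simp: cylinders_def)
    have "X = (\<lambda>\<omega>. \<omega> t) -` A \<inter> space (path_borel h)" using X by auto
    then show "X \<in> sets (path_borel h)"
      using measurable_sets[OF measurable_path_eval[OF h(2)] X(2)] by simp
  qed
  then show "sigma_sets (path_space h) (cylinders h) \<subseteq> sets (path_borel h :: 'd path measure)"
    using sets.sigma_sets_subset[of "cylinders h" "path_borel h"] by simp
next
  define S where "S = sigma (path_space h) (cylinders h :: 'd path set set)"
  have cyl: "cylinders h \<subseteq> Pow (path_space h :: 'd path set)" by (auto simp: cylinders_def)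
  have S: "space S = path_space h" "sets S = sigma_sets (path_space h) (cylinders h)"
    using cyl by (auto simp: S_def)
  have ev: "(\<lambda>\<omega>. \<omega> t) \<in> borel_measurable S" for t
  proof (cases "t < 0")
    case True
    show ?thesis
    proof (rule measurableI)
      fix A :: "(real ^ 'd) set" assume "A \<in> sets borel"
      then have "{\<omega> \<in> path_space h. \<omega> t \<in> A} \<in> cylinders h" using True by (auto simp: cylinders_def)
      moreover have "(\<lambda>\<omega>. \<omega> t) -` A \<inter> space S = {\<omega> \<in> path_space h. \<omega> t \<in> A}" using S by auto
      ultimately show "(\<lambda>\<omega>. \<omega> t) -` A \<inter> space S \<in> sets S" using S by auto
    qed simp
  next
    case False
    have "(\<lambda>\<omega>. \<omega> t) \<in> borel_measurable S \<longleftrightarrow> (\<lambda>\<omega>. 0 :: real ^ 'd) \<in> borel_measurable S"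
      using False S by (intro measurable_cong) (auto simp: path_space_def)
    then show ?thesis by simp
  qed
  obtain D :: "'d path set" where D: "countable D" "D \<subseteq> path_space h"
    "\<And>\<omega> \<epsilon>. \<omega> \<in> path_space h \<Longrightarrow> 0 < \<epsilon> \<Longrightarrow> \<exists>\<phi>\<in>D. path_norm h (\<lambda>t. \<omega> t - \<phi> t) < ennreal \<epsilon>"
    using path_space_separable[OF h] by metis
  define B where "B = (\<lambda>(\<phi> :: 'd path, k::nat). {\<omega>\<in>path_space h. path_norm h (\<lambda>t. \<omega> t - \<phi> t) \<le> ennreal (1 / Suc k)})"
  have B: "B i \<in> sets S" if "fst i \<in> D" for i
  proof -
    obtain \<phi> k where i: "i = (\<phi>, k)" by (cases i)
    have "B i = {\<omega>\<in>space S. \<forall>s\<in>\<rat>\<inter>{..0}. \<forall>t\<in>\<rat>\<inter>{..0}. norm ((\<omega> t - \<phi> t) - (\<omega> s - \<phi> s)) \<le>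
        1 / Suc k * (sqrt (1 + \<bar>t\<bar> + \<bar>s\<bar>) * \<bar>t - s\<bar> powr ((1 - h) / 2))}" (is "_ = ?R")
    proof (intro set_eqI iffI)
      fix \<omega> assume "\<omega> \<in> B i"
      then show "\<omega> \<in> ?R"
        using path_norm_le_iff[of "1 / Suc k" h "\<lambda>t. \<omega> t - \<phi> t"] by (auto simp: B_def i S)
    next
      fix \<omega> assume R: "\<omega> \<in> ?R"
      then have \<omega>: "\<omega> \<in> path_space h" using S by auto
      have "continuous_on {..0} (\<lambda>t. \<omega> t - \<phi> t)"
        using that D(2) i \<omega> by (intro path_space_continuous_on[OF h(2)] path_space_diff) auto
      then have "path_norm h (\<lambda>t. \<omega> t - \<phi> t) \<le> ennreal (1 / Suc k)"
        using R by (intro path_norm_le_rational[OF h(2)]) auto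
      then show "\<omega> \<in> B i" using \<omega> by (simp add: B_def i)
    qed
    also have "\<dots> \<in> sets S"
      by (intro sets.sets_Collect_countable_All' countable_Int1 countable_rat
        borel_measurable_le borel_measurable_const measurable_compose[OF _ borel_measurable_norm]
        borel_measurable_diff ev)
    finally show ?thesis .
  qed
  have "U \<in> sets S" if U: "openin (path_top h) U" for U :: "'d path set"
  proof -
    define I where "I = {i \<in> D \<times> UNIV. B i \<subseteq> U}"
    have "U = (\<Union>i\<in>I. B i)"
    proof
      show "U \<subseteq> (\<Union>i\<in>I. B i)"
      proof
        fix \<omega> assume w: "\<omega> \<in> U"
        then obtain \<epsilon> where \<epsilon>: "\<epsilon> > 0"
            "\<And>\<eta>. \<eta>\<in>path_space h \<Longrightarrow> path_norm h (\<lambda>t. \<omega> t - \<eta> t) < ennreal \<epsilon> \<Longrightarrow> \<eta> \<in> U"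
            and \<omega>: "\<omega> \<in> path_space h"
          using U unfolding openin_path_top_iff by blast
        obtain k :: nat where k: "inverse (real (Suc k)) < \<epsilon> / 2" using reals_Archimedean[of "\<epsilon>/2"] \<epsilon> by auto
        obtain \<phi> where \<phi>: "\<phi> \<in> D" "path_norm h (\<lambda>t. \<omega> t - \<phi> t) < ennreal (1 / Suc k)"
          using D(3)[OF \<omega>, of "1 / Suc k"] by auto
        have "B (\<phi>, k) \<subseteq> U"
        proof
          fix \<eta> assume \<eta>: "\<eta> \<in> B (\<phi>, k)"
          have "path_norm h (\<lambda>t. \<omega> t - \<eta> t) \<le> path_norm h (\<lambda>t. \<omega> t - \<phi> t) + path_norm h (\<lambda>t. \<phi> t - \<eta> t)"
            by (rule path_norm_triangle)
          also have "\<dots> \<le> ennreal (1 / Suc k) + ennreal (1 / Suc k)"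
            using \<phi> \<eta> by (intro add_mono) (auto simp: B_def path_norm_minus_commute[of h \<phi>])
          also have "\<dots> = ennreal (2 / Suc k)" by (simp add: ennreal_plus[symmetric] del: ennreal_plus)
          also have "\<dots> < ennreal \<epsilon>" using k by (simp add: ennreal_less_iff field_simps)
          finally show "\<eta> \<in> U" using \<eta> \<epsilon> by (auto simp: B_def)
        qed
        moreover have "\<omega> \<in> B (\<phi>, k)" using \<omega> \<phi> by (auto simp: B_def)
        ultimately show "\<omega> \<in> (\<Union>i\<in>I. B i)" using \<phi> by (auto simp: I_def)
      qed
    qed (auto simp: I_def)
    also have "\<dots> \<in> sets S"
      using D(1) B by (intro sets.countable_UN') (auto simp: I_def intro: countable_subset[of _ "D \<times> UNIV"])
    finally show ?thesis .
  qed
  then have "sigma_sets (path_space h) {U. openin (path_top h) U} \<subseteq> sets S"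
    using sets.sigma_sets_subset[of "{U. openin (path_top h) U}" S] S by auto
  then show "sets (path_borel h :: 'd path measure) \<subseteq> sigma_sets (path_space h) (cylinders h)"
    using S by (simp add: sets_path_borel)
qed

lemma measurable_path_borelI:
  fixes f :: "'a \<Rightarrow> ('d::finite) path"
  assumes h: "0 < h" "h < 1"
    and sp: "\<And>x. x \<in> space M \<Longrightarrow> f x \<in> path_space h"
    and ev: "\<And>t. t < 0 \<Longrightarrow> (\<lambda>x. f x t) \<in> borel_measurable M"
  shows "f \<in> measurable M (path_borel h)"
proof -
  have "f \<in> measurable M (sigma (path_space h) (cylinders h))"
  proof (rule measurable_measure_of)
    fix X :: "(real \<Rightarrow> real ^ 'd) set" assume "X \<in> cylinders h"
    then obtain t A where X: "X = {\<omega> \<in> path_space h. \<omega> t \<in> A}" "A \<in> sets borel" "t < 0"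
      by (auto simp: cylinders_def)
    have "f -` X \<inter> space M = (\<lambda>x. f x t) -` A \<inter> space M" using X sp by auto
    then show "f -` X \<inter> space M \<in> sets M" using measurable_sets[OF ev[OF X(3)] X(2)] by simp
  qed (use sp in \<open>auto simp: cylinders_def\<close>)
  moreover have "sets (sigma (path_space h) (cylinders h)) = sets (path_borel h :: 'd path measure)"
    using sets_path_borel_cylinders[OF h] by (subst sets_measure_of) (auto simp: cylinders_def)
  ultimately show ?thesis by (simp cong: measurable_cong_sets)
qed

section \<open>Equations driven by a continuous path\<close>

text \<open>The term 2 \<rho> \<open>norm (v t)\<close> is absorbed by completing a square, which
  makes \<open>norm (v t)\<close> squared plus \<rho> squared, discounted at rate 2 c + 1,
  nonincreasing. The hypothesis bounds an inner product and not the norm of f, since a one-sided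
  Lipschitz field offers no more.\<close>

lemma gronwall_inner:
  fixes v f :: "real \<Rightarrow> 'a::euclidean_space"
  assumes T: "0 \<le> T" and c: "0 \<le> c"
    and int: "\<And>t. t \<in> {0..T} \<Longrightarrow> (f has_integral (v t - v 0)) {0..t}"
    and f: "continuous_on {0..T} f"
    and le: "\<And>t. t \<in> {0..T} \<Longrightarrow> f t \<bullet> v t \<le> c * (norm (v t))\<^sup>2 + \<rho> * norm (v t)"
    and \<rho>: "0 \<le> \<rho>"
  shows "norm (v T) \<le> exp ((c + 1) * T) * (norm (v 0) + \<rho>)"
proof -
  have v: "v t = v 0 + integral {0..t} f" if "t \<in> {0..T}" for t
    using integral_unique[OF int[OF that]] by simp
  have dv: "(v has_vector_derivative f t) (at t within {0..T})" if t: "t \<in> {0..T}" for t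
  proof -
    have "((\<lambda>t. v 0 + integral {0..t} f) has_vector_derivative f t) (at t within {0..T})"
      using integral_has_vector_derivative[OF f t] by (auto intro!: derivative_eq_intros)
    then show ?thesis by (rule has_vector_derivative_transform[OF t v, rotated])
  qed
  have cv: "continuous_on {0..T} v"
    unfolding continuous_on_eq_continuous_within using dv by (blast intro: has_vector_derivative_continuous)
  define k where "k = 2 * c + 1"
  define \<phi> where "\<phi> t = (v t \<bullet> v t + \<rho>\<^sup>2) * exp (- k * t)" for t
  have "\<phi> T \<le> \<phi> 0"
  proof (rule DERIV_nonpos_imp_decreasing_open[OF T])
    fix t assume t: "0 < t" "t < T"
    have "(v has_vector_derivative f t) (at t)"
      using dv[of t] t at_within_interior[of t "{0..T}"] by simp
    then have d: "(\<phi> has_real_derivative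
        ((2 * (f t \<bullet> v t)) * exp (- k * t) + (v t \<bullet> v t + \<rho>\<^sup>2) * (- k * exp (- k * t)))) (at t)"
      unfolding \<phi>_def has_real_derivative_iff_has_vector_derivative has_vector_derivative_def
      by (auto intro!: derivative_eq_intros simp: algebra_simps inner_commute)
    have "2 * (f t \<bullet> v t) - k * (v t \<bullet> v t + \<rho>\<^sup>2) \<le> 0"
    proof -
      have "2 * (f t \<bullet> v t) - k * (v t \<bullet> v t + \<rho>\<^sup>2) \<le>
          - (norm (v t) - \<rho>)\<^sup>2 - 2 * c * \<rho>\<^sup>2"
        using le[of t] t by (simp add: k_def power2_eq_square algebra_simps flip: power2_norm_eq_inner)
      also have "\<dots> \<le> 0"
      proof -
        have "0 \<le> 2 * c * \<rho>\<^sup>2" using c by simp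
        then show ?thesis using zero_le_power2[of "norm (v t) - \<rho>"] by linarith
      qed
      finally show ?thesis .
    qed
    then have "(2 * (f t \<bullet> v t) - k * (v t \<bullet> v t + \<rho>\<^sup>2)) * exp (- k * t) \<le> 0"
      by (simp add: mult_le_0_iff)
    with d show "\<exists>y. (\<phi> has_real_derivative y) (at t) \<and> y \<le> 0"
      by (intro exI[of _ "(2 * (f t \<bullet> v t)) * exp (- k * t) + (v t \<bullet> v t + \<rho>\<^sup>2) * (- k * exp (- k * t))"])
        (simp add: algebra_simps)
  qed (auto simp: \<phi>_def intro!: continuous_intros cv)
  then have "v T \<bullet> v T + \<rho>\<^sup>2 \<le> exp (k * T) * (v 0 \<bullet> v 0 + \<rho>\<^sup>2)"
    by (simp add: \<phi>_def exp_minus field_simps)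
  then have "(norm (v T))\<^sup>2 + \<rho>\<^sup>2 \<le> exp ((2 * c + 1) * T) * ((norm (v 0))\<^sup>2 + \<rho>\<^sup>2)"
    by (simp only: power2_norm_eq_inner k_def)
  then have "(norm (v T))\<^sup>2 \<le> exp ((2 * c + 1) * T) * ((norm (v 0))\<^sup>2 + \<rho>\<^sup>2)"
    using zero_le_power2[of \<rho>] by linarith
  \<comment> \<open>The exponent is rounded up from 2 c + 1 to 2 (c + 1) so that the right-hand side
    becomes a perfect square.\<close>
  also have "\<dots> \<le> exp (2 * ((c + 1) * T)) * (norm (v 0) + \<rho>)\<^sup>2"
    using T \<rho> by (intro mult_mono) (auto simp: algebra_simps power2_eq_square)
  also have "\<dots> = (exp ((c + 1) * T) * (norm (v 0) + \<rho>))\<^sup>2"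
    by (simp add: power_mult_distrib exp_double)
  finally show ?thesis by (rule power2_le_imp_le) (use \<rho> in simp)
qed

text \<open>The noise \<beta> is an arbitrary path, so the equation is stated in integrated form.
  Since \<beta> need not start at 0, the value of X at time 0 is
  \<open>x + \<beta> 0\<close>.\<close>

definition driven_solution ::
  "('a::euclidean_space \<Rightarrow> 'a) \<Rightarrow> (real \<Rightarrow> 'a) \<Rightarrow> real \<Rightarrow> 'a \<Rightarrow> (real \<Rightarrow> 'a) \<Rightarrow> bool" where
  "driven_solution F \<beta> T x X \<longleftrightarrow> continuous_on {0..T} X \<and>
     (\<forall>t\<in>{0..T}. ((\<lambda>s. F (X s)) has_integral (X t - x - \<beta> t)) {0..t})"

lemma driven_solution_subinterval:
  "driven_solution F \<beta> T x X \<Longrightarrow> t \<in> {0..T} \<Longrightarrow> driven_solution F \<beta> t x X"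
  by (auto simp: driven_solution_def intro: continuous_on_subset)

lemma driven_solution_noise_cong:
  "(\<And>t. t \<in> {0..T} \<Longrightarrow> \<beta> t = \<beta>' t) \<Longrightarrow> driven_solution F \<beta> T x X \<longleftrightarrow> driven_solution F \<beta>' T x X"
  by (auto simp: driven_solution_def)

lemma driven_solution_initial:
  assumes "driven_solution F \<beta> T x X" "0 \<le> T"
  shows "X 0 = x + \<beta> 0"
proof -
  have "0 \<in> {0..T}" using assms(2) by simp
  then have "((\<lambda>s. F (X s)) has_integral (X 0 - x - \<beta> 0)) {0..0}"
    using assms(1) unfolding driven_solution_def by blast
  then have "X 0 - x - \<beta> 0 = 0" using has_integral_refl(1) by (metis has_integral_unique interval_cbox)
  then show ?thesis by (simp add: algebra_simps)
qed

section \<open>Dependence on the initial value and on the noise\<close>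

locale one_sided_lipschitz =
  fixes F :: "'a::euclidean_space \<Rightarrow> 'a" and C :: real
  assumes C_nonneg: "0 \<le> C"
    and one_sided: "\<And>x y. (F y - F x) \<bullet> (y - x) \<le> C * (norm (y - x))\<^sup>2"
    and F_continuous: "continuous_on UNIV F"
begin

lemma continuous_F_comp: "continuous_on S X \<Longrightarrow> continuous_on S (\<lambda>s. F (X s))"
  by (rule continuous_on_compose2[OF F_continuous]) auto

text \<open>The noise cancels in the difference of two solutions, which is therefore differentiable
  in time and obeys the Gronwall bound with \<rho> = 0.\<close>

lemma driven_solution_lipschitz:
  assumes T: "0 \<le> T" and X: "driven_solution F \<beta> T x X" and Y: "driven_solution F \<beta> T y Y"
  shows "norm (Y T - X T) \<le> exp ((C + 1) * T) * norm (y - x)"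
proof -
  have "norm (Y T - X T) \<le> exp ((C + 1) * T) * (norm (Y 0 - X 0) + 0)"
  proof (rule gronwall_inner[OF T C_nonneg, where f="\<lambda>s. F (Y s) - F (X s)"])
    fix t assume t: "t \<in> {0..T}"
    have "((\<lambda>s. F (Y s) - F (X s)) has_integral ((Y t - y - \<beta> t) - (X t - x - \<beta> t))) {0..t}"
      using X Y t by (intro has_integral_diff) (auto simp: driven_solution_def)
    then show "((\<lambda>s. F (Y s) - F (X s)) has_integral (Y t - X t - (Y 0 - X 0))) {0..t}"
      using driven_solution_initial[OF X T] driven_solution_initial[OF Y T] by (simp add: algebra_simps)
    show "(F (Y t) - F (X t)) \<bullet> (Y t - X t) \<le> C * (norm (Y t - X t))\<^sup>2 + 0 * norm (Y t - X t)"
      using one_sided by simp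
  qed (use X Y in \<open>auto simp: driven_solution_def intro!: continuous_intros continuous_F_comp\<close>)
  then show ?thesis
    using driven_solution_initial[OF X T] driven_solution_initial[OF Y T] by simp
qed

lemma driven_solution_unique:
  assumes "0 \<le> T" "driven_solution F \<beta> T x X" "driven_solution F \<beta> T x Y"
  shows "Y T = X T"
  using driven_solution_lipschitz[OF assms] by simp

text \<open>Subtracting its noise from each solution leaves a differentiable difference v. The field
  at Y is compared with the field at \<open>z\<close>, the solution X displaced by the difference of
  the noises: Y - z equals v, so the one-sided bound applies there, and the remaining error is small
  because F is uniformly continuous on a ball around the trajectory of X.\<close>

lemma driven_solution_noise_continuous:
  assumes T: "0 \<le> T" and X: "driven_solution F \<beta> T x X"
    and \<beta>: "continuous_on {0..T} \<beta>" and e: "0 < e"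
  obtains d where "0 < d"
    "\<And>\<beta>' Y. driven_solution F \<beta>' T x Y \<Longrightarrow> continuous_on {0..T} \<beta>' \<Longrightarrow>
      (\<And>t. t \<in> {0..T} \<Longrightarrow> norm (\<beta>' t - \<beta> t) \<le> d) \<Longrightarrow> norm (Y T - X T) < e"
proof -
  \<comment> \<open>After multiplication by the Gronwall factor this error contributes e / 2; the
    other half pays for the difference of the noises at time T.\<close>
  define \<rho> where "\<rho> = e / (2 * exp ((C + 1) * T))"
  have \<rho>: "\<rho> > 0" using e by (simp add: \<rho>_def)
  have "bounded (X ` {0..T})"
    using X by (intro compact_imp_bounded compact_continuous_image) (auto simp: driven_solution_def)
  then obtain R where R: "\<And>t. t \<in> {0..T} \<Longrightarrow> norm (X t) \<le> R" unfolding bounded_iff by (metis image_eqI)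
  have "uniformly_continuous_on (cball 0 (R + 1)) F"
    by (intro compact_uniformly_continuous continuous_on_subset[OF F_continuous]) auto
  then obtain d0 where d0: "d0 > 0"
      "\<And>a b. a \<in> cball 0 (R+1) \<Longrightarrow> b \<in> cball 0 (R+1) \<Longrightarrow> dist b a < d0 \<Longrightarrow> dist (F b) (F a) < \<rho>"
    unfolding uniformly_continuous_on_def using \<rho> by metis
  \<comment> \<open>The bound 1 keeps the displaced point in the ball of radius R + 1, d0 / 2 serves
    uniform continuity, and e / 3 is strictly below the e / 2 left over.\<close>
  define d where "d = min (min 1 (d0 / 2)) (e / 3)"
  have d: "0 < d" "d \<le> 1" "d < d0" "d < e / 2" using d0 e by (auto simp: d_def)
  show ?thesis
  proof (rule that[OF d(1)])
    fix \<beta>' Y assume Y: "driven_solution F \<beta>' T x Y" and \<beta>': "continuous_on {0..T} \<beta>'"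
      and near: "\<And>t. t \<in> {0..T} \<Longrightarrow> norm (\<beta>' t - \<beta> t) \<le> d"
    define v where "v t = (Y t - \<beta>' t) - (X t - \<beta> t)" for t
    have v0: "v 0 = 0"
      using driven_solution_initial[OF X T] driven_solution_initial[OF Y T] by (simp add: v_def)
    have "norm (v T) \<le> exp ((C + 1) * T) * (norm (v 0) + \<rho>)"
    proof (rule gronwall_inner[OF T C_nonneg, where f="\<lambda>s. F (Y s) - F (X s)"])
      fix t assume t: "t \<in> {0..T}"
      have "((\<lambda>s. F (Y s) - F (X s)) has_integral ((Y t - x - \<beta>' t) - (X t - x - \<beta> t))) {0..t}"
        using X Y t by (intro has_integral_diff) (auto simp: driven_solution_def)
      then show "((\<lambda>s. F (Y s) - F (X s)) has_integral (v t - v 0)) {0..t}"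
        by (rule has_integral_eq_rhs) (simp add: v0, simp add: v_def algebra_simps)
      define z where "z = X t + (\<beta>' t - \<beta> t)"
      have vz: "v t = Y t - z" by (simp add: v_def z_def)
      have "norm z \<le> R + 1" unfolding z_def
        using norm_triangle_ineq[of "X t" "\<beta>' t - \<beta> t"] R[OF t] near[OF t] d by linarith
      moreover have "norm (X t) \<le> R + 1" using R[OF t] by simp
      moreover have "dist z (X t) < d0" using near[OF t] d by (simp add: z_def dist_norm)
      ultimately have Fz: "norm (F z - F (X t)) \<le> \<rho>"
        using d0(2)[of "X t" z] by (simp add: dist_norm)
      have "(F (Y t) - F (X t)) \<bullet> v t = (F (Y t) - F z) \<bullet> (Y t - z) + (F z - F (X t)) \<bullet> v t"
        unfolding vz by (simp add: inner_diff_left inner_diff_right)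
      also have "\<dots> \<le> C * (norm (Y t - z))\<^sup>2 + norm (F z - F (X t)) * norm (v t)"
        by (intro add_mono one_sided norm_cauchy_schwarz)
      also have "\<dots> \<le> C * (norm (v t))\<^sup>2 + \<rho> * norm (v t)"
        unfolding vz by (intro add_mono mult_right_mono Fz) auto
      finally show "(F (Y t) - F (X t)) \<bullet> v t \<le> C * (norm (v t))\<^sup>2 + \<rho> * norm (v t)" .
    qed (use X Y \<rho> in \<open>auto simp: driven_solution_def intro!: continuous_intros continuous_F_comp\<close>)
    then have "norm (v T) \<le> e / 2" by (simp add: \<rho>_def v0)
    moreover have "Y T - X T = v T + (\<beta>' T - \<beta> T)" by (simp add: v_def)
    ultimately show "norm (Y T - X T) < e"
      using norm_triangle_ineq[of "v T" "\<beta>' T - \<beta> T"] near[of T] T d by simp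
  qed
qed

end

section \<open>Differentiability in the initial value\<close>

lemma small_factor:
  fixes e s :: real
  assumes e: "0 < e" and s: "0 \<le> s"
  shows "\<exists>e'>0. e' * s < e"
proof (intro exI[of _ "e / (s + 1)"] conjI)
  show "0 < e / (s + 1)" using e s by simp
  have "e * (s / (s + 1)) < e * 1" using e s by (intro mult_strict_left_mono) auto
  then show "e / (s + 1) * s < e" by simp
qed

text \<open>A criterion without a candidate for the derivative. The factors a and b may be large as
  long as the four vectors h, k, a h, b k are small, so increments at different scales can be
  compared. Hence the difference quotients are Cauchy, their limit is linear, and comparing an
  increment with its rescalings shows that the limit is the derivative.\<close>

lemma differentiable_from_asymptotic_linearity:
  fixes f :: "'a::euclidean_space \<Rightarrow> 'b::euclidean_space"
  assumes lin: "\<And>e. 0 < e \<Longrightarrow> \<exists>d>0. \<forall>h k. \<forall>a b::real.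
    norm h < d \<longrightarrow> norm k < d \<longrightarrow> norm (a *\<^sub>R h) < d \<longrightarrow> norm (b *\<^sub>R k) < d \<longrightarrow>
    norm ((f (x + (a *\<^sub>R h + b *\<^sub>R k)) - f x) - a *\<^sub>R (f (x + h) - f x) - b *\<^sub>R (f (x + k) - f x))
      \<le> e * (\<bar>a\<bar> * norm h + \<bar>b\<bar> * norm k)"
  shows "f differentiable at x"
proof -
  define G where "G h = f (x + h) - f x" for h
  have G0: "G 0 = 0" by (simp add: G_def)
  have lin': "\<exists>d>0. \<forall>h k. \<forall>a b::real.
    norm h < d \<longrightarrow> norm k < d \<longrightarrow> norm (a *\<^sub>R h) < d \<longrightarrow> norm (b *\<^sub>R k) < d \<longrightarrow>
    norm (G (a *\<^sub>R h + b *\<^sub>R k) - a *\<^sub>R G h - b *\<^sub>R G k) \<le> e * (\<bar>a\<bar> * norm h + \<bar>b\<bar> * norm k)"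
    if "0 < e" for e using lin[OF that] unfolding G_def .
  have hom: "\<exists>d>0. \<forall>h. \<forall>a::real. norm h < d \<longrightarrow> norm (a *\<^sub>R h) < d \<longrightarrow>
      norm (G (a *\<^sub>R h) - a *\<^sub>R G h) \<le> e * (\<bar>a\<bar> * norm h)" if e: "0 < e" for e
  proof -
    obtain d where d: "d > 0" "\<And>h k a b. norm h < d \<Longrightarrow> norm k < d \<Longrightarrow> norm (a *\<^sub>R h) < d \<Longrightarrow> norm (b *\<^sub>R k) < d \<Longrightarrow>
      norm (G (a *\<^sub>R h + b *\<^sub>R k) - a *\<^sub>R G h - b *\<^sub>R G k) \<le> e * (\<bar>a\<bar> * norm h + \<bar>b\<bar> * norm k)"
      using lin'[OF e] by metis
    show ?thesis using d(1) d(2)[of _ 0 _ 0] by (intro exI[of _ d]) (auto simp: G0)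
  qed
  define q where "q v n = real (Suc n) *\<^sub>R G ((1 / real (Suc n)) *\<^sub>R v)" for v n
  have small: "\<exists>n0. \<forall>n\<ge>n0. norm ((1 / real (Suc n)) *\<^sub>R v) < d" if "d > 0" for v :: 'a and d
  proof -
    have "(\<lambda>n. inverse (real (Suc n)) *\<^sub>R v) \<longlonglongrightarrow> 0 *\<^sub>R v"
      by (intro tendsto_intros LIMSEQ_inverse_real_of_nat)
    then have "eventually (\<lambda>n. dist (inverse (real (Suc n)) *\<^sub>R v) 0 < d) sequentially"
      using that by (simp add: tendsto_iff)
    then show ?thesis by (simp add: eventually_sequentially divide_inverse)
  qed
  have "Cauchy (q v)" for v
  proof (rule metric_CauchyI)
    fix e :: real assume e: "0 < e"
    obtain e' where ev: "e' > 0" "e' * norm v < e" using small_factor[OF e norm_ge_zero] by blast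
    obtain d where d: "d > 0" "\<And>h a. norm h < d \<Longrightarrow> norm (a *\<^sub>R h) < d \<Longrightarrow>
      norm (G (a *\<^sub>R h) - a *\<^sub>R G h) \<le> e' * (\<bar>a\<bar> * norm h)" using hom[OF ev(1)] by metis
    obtain n0 where n0: "\<And>n. n \<ge> n0 \<Longrightarrow> norm ((1 / real (Suc n)) *\<^sub>R v) < d" using small[OF d(1)] by metis
    have "dist (q v m) (q v n) < e" if mn: "m \<ge> n0" "n \<ge> n0" for m n
    proof -
      \<comment> \<open>The ratio of the two step sizes: scaling by it carries the n-th increment
        vector to the m-th.\<close>
      define a where "a = real (Suc n) / real (Suc m)"
      have a: "a *\<^sub>R ((1 / real (Suc n)) *\<^sub>R v) = (1 / real (Suc m)) *\<^sub>R v" by (simp add: a_def)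
      have "norm (G (a *\<^sub>R ((1 / real (Suc n)) *\<^sub>R v)) - a *\<^sub>R G ((1 / real (Suc n)) *\<^sub>R v)) \<le>
          e' * (\<bar>a\<bar> * norm ((1 / real (Suc n)) *\<^sub>R v))"
        using n0 mn by (intro d(2)) (simp_all only: a)
      also have "\<dots> = e' * norm v / real (Suc m)" by (simp add: a_def)
      finally have *: "norm (G ((1 / real (Suc m)) *\<^sub>R v) - a *\<^sub>R G ((1 / real (Suc n)) *\<^sub>R v)) \<le> e' * norm v / real (Suc m)"
        by (simp only: a)
      have "q v m - q v n = real (Suc m) *\<^sub>R (G ((1 / real (Suc m)) *\<^sub>R v) - a *\<^sub>R G ((1 / real (Suc n)) *\<^sub>R v))"
        by (simp add: q_def a_def scaleR_diff_right)
      then have "norm (q v m - q v n) = real (Suc m) * norm (G ((1 / real (Suc m)) *\<^sub>R v) - a *\<^sub>R G ((1 / real (Suc n)) *\<^sub>R v))"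
        by simp
      also have "\<dots> \<le> real (Suc m) * (e' * norm v / real (Suc m))"
        using * by (intro mult_left_mono) auto
      also have "\<dots> < e" using ev by simp
      finally show ?thesis by (simp add: dist_norm)
    qed
    then show "\<exists>M. \<forall>m\<ge>M. \<forall>n\<ge>M. dist (q v m) (q v n) < e" by blast
  qed
  then have "convergent (q v)" for v by (simp add: Cauchy_convergent_iff)
  then obtain L where L: "\<And>v. q v \<longlonglongrightarrow> L v" unfolding convergent_def by metis
  have lincomb: "L (a *\<^sub>R v + b *\<^sub>R w) = a *\<^sub>R L v + b *\<^sub>R L w" for a b v w
  proof -
    have "(\<lambda>n. q (a *\<^sub>R v + b *\<^sub>R w) n - a *\<^sub>R q v n - b *\<^sub>R q w n) \<longlonglongrightarrow> 0"
    proof (rule tendstoI)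
      fix e :: real assume e: "0 < e"
      define s where "s = \<bar>a\<bar> * norm v + \<bar>b\<bar> * norm w"
      have s: "0 \<le> s" by (simp add: s_def)
      obtain e' where ev: "e' > 0" "e' * s < e" using small_factor[OF e s] by blast
      obtain d where d: "d > 0" "\<And>h k a b. norm h < d \<Longrightarrow> norm k < d \<Longrightarrow> norm (a *\<^sub>R h) < d \<Longrightarrow> norm (b *\<^sub>R k) < d \<Longrightarrow>
        norm (G (a *\<^sub>R h + b *\<^sub>R k) - a *\<^sub>R G h - b *\<^sub>R G k) \<le> e' * (\<bar>a\<bar> * norm h + \<bar>b\<bar> * norm k)"
        using lin'[OF ev(1)] by metis
      obtain n1 n2 n3 n4 where n: "\<And>n. n \<ge> n1 \<Longrightarrow> norm ((1 / real (Suc n)) *\<^sub>R v) < d"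
        "\<And>n. n \<ge> n2 \<Longrightarrow> norm ((1 / real (Suc n)) *\<^sub>R w) < d"
        "\<And>n. n \<ge> n3 \<Longrightarrow> norm ((1 / real (Suc n)) *\<^sub>R (a *\<^sub>R v)) < d"
        "\<And>n. n \<ge> n4 \<Longrightarrow> norm ((1 / real (Suc n)) *\<^sub>R (b *\<^sub>R w)) < d"
        using small[OF d(1)] by metis
      have "dist (q (a *\<^sub>R v + b *\<^sub>R w) n - a *\<^sub>R q v n - b *\<^sub>R q w n) 0 < e"
        if nn: "n \<ge> max (max n1 n2) (max n3 n4)" for n
      proof -
        define i where "i = 1 / real (Suc n)"
        have i: "0 < i" "real (Suc n) * i = 1" by (simp_all add: i_def)
        have "norm (G (a *\<^sub>R (i *\<^sub>R v) + b *\<^sub>R (i *\<^sub>R w)) - a *\<^sub>R G (i *\<^sub>R v) - b *\<^sub>R G (i *\<^sub>R w)) \<le>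
          e' * (\<bar>a\<bar> * norm (i *\<^sub>R v) + \<bar>b\<bar> * norm (i *\<^sub>R w))"
          using n nn by (intro d(2)) (simp_all add: i_def scaleR_left_commute mult.commute)
        also have "\<dots> = i * (e' * s)" using i by (simp add: s_def algebra_simps)
        finally have *: "norm (G (a *\<^sub>R (i *\<^sub>R v) + b *\<^sub>R (i *\<^sub>R w)) - a *\<^sub>R G (i *\<^sub>R v) - b *\<^sub>R G (i *\<^sub>R w)) \<le> i * (e' * s)" .
        have "q (a *\<^sub>R v + b *\<^sub>R w) n - a *\<^sub>R q v n - b *\<^sub>R q w n =
            real (Suc n) *\<^sub>R (G (a *\<^sub>R (i *\<^sub>R v) + b *\<^sub>R (i *\<^sub>R w)) - a *\<^sub>R G (i *\<^sub>R v) - b *\<^sub>R G (i *\<^sub>R w))"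
          unfolding q_def i_def[symmetric] by (simp only: scaleR_diff_right scaleR_add_right scaleR_left_commute)
        then have "norm (q (a *\<^sub>R v + b *\<^sub>R w) n - a *\<^sub>R q v n - b *\<^sub>R q w n) \<le> real (Suc n) * (i * (e' * s))"
          using * by (simp only: norm_scaleR abs_of_nat) (rule mult_left_mono, auto)
        also have "\<dots> = e' * s" using i by (simp only: mult.assoc[symmetric])
        finally show ?thesis using ev by simp
      qed
      then show "eventually (\<lambda>n. dist (q (a *\<^sub>R v + b *\<^sub>R w) n - a *\<^sub>R q v n - b *\<^sub>R q w n) 0 < e) sequentially"
        unfolding eventually_sequentially by blast
    qed
    moreover have "(\<lambda>n. q (a *\<^sub>R v + b *\<^sub>R w) n - a *\<^sub>R q v n - b *\<^sub>R q w n) \<longlonglongrightarrow>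
        L (a *\<^sub>R v + b *\<^sub>R w) - a *\<^sub>R L v - b *\<^sub>R L w" by (intro tendsto_intros L)
    ultimately have "L (a *\<^sub>R v + b *\<^sub>R w) - a *\<^sub>R L v - b *\<^sub>R L w = 0" by (rule LIMSEQ_unique[symmetric])
    then show ?thesis by (simp add: diff_eq_eq add.commute)
  qed
  have "linear L" using lincomb[of 1 _ 1] lincomb[of _ _ 0] by (intro linearI) auto
  have "(f has_derivative L) (at x)"
    unfolding has_derivative_at_alt
  proof (intro conjI allI impI)
    show "bounded_linear L" using \<open>linear L\<close> by (rule linear_conv_bounded_linear[THEN iffD1])
    fix e :: real assume e: "0 < e"
    obtain d where d: "d > 0" "\<And>h a. norm h < d \<Longrightarrow> norm (a *\<^sub>R h) < d \<Longrightarrow>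
      norm (G (a *\<^sub>R h) - a *\<^sub>R G h) \<le> e * (\<bar>a\<bar> * norm h)" using hom[OF e] by metis
    have "norm (G v - L v) \<le> e * norm v" if v: "norm v < d" for v
    proof (rule LIMSEQ_le_const2)
      show "(\<lambda>n. norm (G v - q v n)) \<longlonglongrightarrow> norm (G v - L v)" by (intro tendsto_intros L)
      have "norm (G v - q v n) \<le> e * norm v" for n
      proof -
        define i where "i = 1 / real (Suc n)"
        have i: "0 < i" "i \<le> 1" "real (Suc n) * i = 1" by (simp_all add: i_def)
        have "norm (i *\<^sub>R v) \<le> norm v" using i by (simp add: mult_left_le_one_le)
        then have *: "norm (G (i *\<^sub>R v) - i *\<^sub>R G v) \<le> e * (i * norm v)"
          using d(2)[OF v, of i] v i by simp
        have "q v n - G v = real (Suc n) *\<^sub>R (G (i *\<^sub>R v) - i *\<^sub>R G v)"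
          using i by (simp only: q_def i_def[symmetric] scaleR_diff_right scaleR_scaleR) simp
        then have "norm (q v n - G v) \<le> real (Suc n) * (e * (i * norm v))"
          using * by (simp only: norm_scaleR abs_of_nat) (rule mult_left_mono, auto)
        also have "\<dots> = (real (Suc n) * i) * (e * norm v)" by (simp only: ac_simps)
        finally show ?thesis using i by (simp add: norm_minus_commute)
      qed
      then show "\<exists>N. \<forall>n\<ge>N. norm (G v - q v n) \<le> e * norm v" by blast
    qed
    then have "norm (f y - f x - L (y - x)) \<le> e * norm (y - x)" if "norm (y - x) < d" for y
      using that G_def by (metis add.commute diff_add_cancel)
    then show "\<exists>d>0. \<forall>y. norm (y - x) < d \<longrightarrow> norm (f y - f x - L (y - x)) \<le> e * norm (y - x)"
      using d(1) by blast
  qed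
  then show ?thesis by (auto simp: differentiable_def)
qed

context one_sided_lipschitz
begin

text \<open>The defect of linearity \<open>w\<close> of the increments of the flow solves the
  equation linearised along the trajectory from x, up to first-order remainders of F. The increments
  are at most K times the initial displacement, so these remainders are small relative to it, and
  Gronwall bounds the defect.\<close>

lemma driven_solution_differentiable:
  assumes T: "0 \<le> T" and X: "\<And>x. driven_solution F \<beta> T x (X x)"
    and DFlin: "\<And>y. bounded_linear (DF y)"
    and DFbound: "\<And>R. \<exists>B. \<forall>y. norm y \<le> R \<longrightarrow> onorm (DF y) \<le> B"
    and DFunif: "\<And>R e. 0 < e \<Longrightarrow> \<exists>d>0. \<forall>y z. norm y \<le> R \<longrightarrow> norm z \<le> d \<longrightarrow>
      norm (F (y + z) - F y - DF y z) \<le> e * norm z"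
  shows "(\<lambda>x. X x T) differentiable at x"
proof (rule differentiable_from_asymptotic_linearity)
  fix e :: real assume e: "0 < e"
  have "bounded (X x ` {0..T})"
    using X[of x] by (intro compact_imp_bounded compact_continuous_image) (auto simp: driven_solution_def)
  then obtain R where R: "\<And>t. t \<in> {0..T} \<Longrightarrow> norm (X x t) \<le> R" unfolding bounded_iff by (metis image_eqI)
  obtain B where B: "\<And>y. norm y \<le> R \<Longrightarrow> onorm (DF y) \<le> B" using DFbound by metis
  have B0: "0 \<le> B" using T by (intro order_trans[OF onorm_pos_le[OF DFlin] B[OF R[of 0]]]) simp
  define K where "K = exp ((C + 1) * T)"
  have K: "K > 0" by (simp add: K_def)
  \<comment> \<open>Chosen so that \<rho> = 2 e1 K s, multiplied by the Gronwall factor, is exactly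
    e s.\<close>
  define e1 where "e1 = e / (2 * K * exp ((B + 1) * T))"
  have e1: "e1 > 0" using e K by (simp add: e1_def)
  obtain d where d: "d > 0" "\<And>y z. norm y \<le> R \<Longrightarrow> norm z \<le> d \<Longrightarrow>
      norm (F (y + z) - F y - DF y z) \<le> e1 * norm z" using DFunif[OF e1] by metis
  define G where "G h t = X (x + h) t - X x t" for h t
  have GL: "norm (G h t) \<le> K * norm h" if t: "t \<in> {0..T}" for h t
  proof -
    have "norm (G h t) \<le> exp ((C + 1) * t) * norm ((x + h) - x)" unfolding G_def
      using t by (intro driven_solution_lipschitz[OF _ driven_solution_subinterval[OF X t]
        driven_solution_subinterval[OF X t]]) simp
    also have "\<dots> \<le> K * norm h"
      using t C_nonneg by (auto simp: K_def intro!: mult_right_mono mult_left_mono)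
    finally show ?thesis .
  qed
  \<comment> \<open>The factor 2 in d / (2 K) makes room for a h + b k, whose norm can reach the sum
    of two small norms.\<close>
  have "norm (G (a *\<^sub>R h + b *\<^sub>R k) T - a *\<^sub>R G h T - b *\<^sub>R G k T) \<le> e * (\<bar>a\<bar> * norm h + \<bar>b\<bar> * norm k)"
    if small: "norm h < d / (2 * K)" "norm k < d / (2 * K)" "norm (a *\<^sub>R h) < d / (2 * K)" "norm (b *\<^sub>R k) < d / (2 * K)"
    for h k and a b :: real
  proof -
    define l where "l = a *\<^sub>R h + b *\<^sub>R k"
    define s where "s = \<bar>a\<bar> * norm h + \<bar>b\<bar> * norm k"
    have s: "0 \<le> s" by (simp add: s_def)
    have l: "norm l \<le> s" using norm_triangle_ineq[of "a *\<^sub>R h" "b *\<^sub>R k"] by (simp add: l_def s_def)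
    have Kd: "K * norm u \<le> d" if "norm u < 2 * (d / (2 * K))" for u :: 'a
      using that K by (simp add: field_simps)
    have "0 < d / (2 * K)" using d K by simp
    then have le: "K * norm h \<le> d" "K * norm k \<le> d" "K * norm l \<le> d"
      using small l by (auto intro!: Kd simp: s_def)
    define w where "w t = G l t - a *\<^sub>R G h t - b *\<^sub>R G k t" for t
    define f where "f t = (F (X (x + l) t) - F (X x t)) - a *\<^sub>R (F (X (x + h) t) - F (X x t))
      - b *\<^sub>R (F (X (x + k) t) - F (X x t))" for t
    define \<rho> where "\<rho> = 2 * e1 * K * s"
    have \<rho>: "0 \<le> \<rho>" using e1 K s by (simp add: \<rho>_def)
    have w0: "w 0 = 0"
      using driven_solution_initial[OF X T] by (simp add: w_def G_def l_def algebra_simps)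
    have "norm (w T) \<le> exp ((B + 1) * T) * (norm (w 0) + \<rho>)"
    proof (rule gronwall_inner[OF T B0, where f=f])
      fix t assume t: "t \<in> {0..T}"
      have I: "((\<lambda>s. F (X y s)) has_integral (X y t - y - \<beta> t)) {0..t}" for y
        using X t by (auto simp: driven_solution_def)
      have "(f has_integral (((X (x + l) t - (x + l) - \<beta> t) - (X x t - x - \<beta> t))
          - a *\<^sub>R ((X (x + h) t - (x + h) - \<beta> t) - (X x t - x - \<beta> t))
          - b *\<^sub>R ((X (x + k) t - (x + k) - \<beta> t) - (X x t - x - \<beta> t)))) {0..t}"
        unfolding f_def by (intro has_integral_diff has_integral_cmul I)
      also have "((X (x + l) t - (x + l) - \<beta> t) - (X x t - x - \<beta> t))
          - a *\<^sub>R ((X (x + h) t - (x + h) - \<beta> t) - (X x t - x - \<beta> t))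
          - b *\<^sub>R ((X (x + k) t - (x + k) - \<beta> t) - (X x t - x - \<beta> t)) = w t - w 0"
        unfolding w0 by (simp add: w_def G_def l_def algebra_simps)
      finally show "(f has_integral (w t - w 0)) {0..t}" .
      define rem where "rem z = F (X x t + z) - F (X x t) - DF (X x t) z" for z
      have rem: "norm (rem (G u t)) \<le> e1 * (K * norm u)" if "K * norm u \<le> d" for u
      proof -
        have "norm (rem (G u t)) \<le> e1 * norm (G u t)"
          unfolding rem_def using GL[OF t, of u] that by (intro d(2) R t) auto
        also have "\<dots> \<le> e1 * (K * norm u)" using e1 GL[OF t, of u] by (intro mult_left_mono) auto
        finally show ?thesis .
      qed
      interpret DF: bounded_linear "DF (X x t)" by (rule DFlin)
      have fw: "f t = DF (X x t) (w t) + (rem (G l t) - a *\<^sub>R rem (G h t) - b *\<^sub>R rem (G k t))"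
      proof -
        have "F (X (x + u) t) - F (X x t) = DF (X x t) (G u t) + rem (G u t)" for u
          by (simp add: rem_def G_def)
        then show ?thesis
          unfolding f_def w_def DF.diff DF.scaleR by (simp add: algebra_simps)
      qed
      have "norm (rem (G l t) - a *\<^sub>R rem (G h t) - b *\<^sub>R rem (G k t)) \<le>
          norm (rem (G l t)) + \<bar>a\<bar> * norm (rem (G h t)) + \<bar>b\<bar> * norm (rem (G k t))"
        by (rule order_trans[OF norm_triangle_ineq4] order_trans[OF add_right_mono[OF norm_triangle_ineq4]])+ simp
      also have "\<dots> \<le> e1 * (K * norm l) + \<bar>a\<bar> * (e1 * (K * norm h)) + \<bar>b\<bar> * (e1 * (K * norm k))"
        by (intro add_mono mult_left_mono rem le) auto
      also have "\<dots> \<le> e1 * (K * s) + \<bar>a\<bar> * (e1 * (K * norm h)) + \<bar>b\<bar> * (e1 * (K * norm k))"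
        using e1 K l by (intro add_mono mult_left_mono) auto
      also have "\<dots> = \<rho>" by (simp add: \<rho>_def s_def algebra_simps)
      finally have r: "norm (rem (G l t) - a *\<^sub>R rem (G h t) - b *\<^sub>R rem (G k t)) \<le> \<rho>" .
      have "f t \<bullet> w t = DF (X x t) (w t) \<bullet> w t + (rem (G l t) - a *\<^sub>R rem (G h t) - b *\<^sub>R rem (G k t)) \<bullet> w t"
        unfolding fw by (rule inner_add_left)
      also have "\<dots> \<le> norm (DF (X x t) (w t)) * norm (w t) +
          norm (rem (G l t) - a *\<^sub>R rem (G h t) - b *\<^sub>R rem (G k t)) * norm (w t)"
        by (intro add_mono norm_cauchy_schwarz)
      also have "\<dots> \<le> (B * norm (w t)) * norm (w t) + \<rho> * norm (w t)"
      proof (intro add_mono mult_right_mono r)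
        have "norm (DF (X x t) (w t)) \<le> onorm (DF (X x t)) * norm (w t)" by (rule onorm[OF DFlin])
        also have "\<dots> \<le> B * norm (w t)" by (intro mult_right_mono B R t) auto
        finally show "norm (DF (X x t) (w t)) \<le> B * norm (w t)" .
      qed auto
      finally show "f t \<bullet> w t \<le> B * (norm (w t))\<^sup>2 + \<rho> * norm (w t)" by (simp add: power2_eq_square mult.assoc)
    next
      have "continuous_on {0..T} (X y)" for y using X[of y] by (auto simp: driven_solution_def)
      then show "continuous_on {0..T} f" unfolding f_def by (intro continuous_intros continuous_F_comp)
    qed (fact \<rho>)
    also have "\<dots> = e * s" using K by (simp add: \<rho>_def e1_def w0)
    finally show ?thesis by (simp add: w_def l_def s_def)
  qed
  moreover have "0 < d / (2 * K)" using d K by simp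
  ultimately show "\<exists>d>0. \<forall>h k. \<forall>a b::real.
    norm h < d \<longrightarrow> norm k < d \<longrightarrow> norm (a *\<^sub>R h) < d \<longrightarrow> norm (b *\<^sub>R k) < d \<longrightarrow>
    norm ((X (x + (a *\<^sub>R h + b *\<^sub>R k)) T - X x T) - a *\<^sub>R (X (x + h) T - X x T) - b *\<^sub>R (X (x + k) T - X x T))
      \<le> e * (\<bar>a\<bar> * norm h + \<bar>b\<bar> * norm k)"
    unfolding G_def by blast
qed

end


section \<open>Measurability of functionals continuous in a path\<close>

text \<open>
  Paths with the same modulus of continuity at mesh \<open>1 / m\<close> and nearby grid values are uniformly
  close; the resulting countably many sets play the role of a base of neighbourhoods.
\<close>

lemma borel_measurable_path_functional:
  fixes \<beta> :: "real \<Rightarrow> 'w \<Rightarrow> 'b::euclidean_space" and f :: "'w \<Rightarrow> 'c::metric_space"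
  assumes T: "0 \<le> T"
    and meas: "\<And>t. t \<in> {0..T} \<Longrightarrow> \<beta> t \<in> borel_measurable M"
    and cont: "\<And>w. w \<in> space M \<Longrightarrow> continuous_on {0..T} (\<lambda>t. \<beta> t w)"
    and f: "\<And>w e. w \<in> space M \<Longrightarrow> 0 < e \<Longrightarrow> \<exists>d>0. \<forall>w'\<in>space M.
      (\<forall>t\<in>{0..T}. norm (\<beta> t w' - \<beta> t w) \<le> d) \<longrightarrow> dist (f w') (f w) < e"
  shows "f \<in> borel_measurable M"
proof -
  obtain E :: "'b set" where E: "countable E" "\<And>X. open X \<Longrightarrow> X \<noteq> {} \<Longrightarrow> \<exists>d\<in>E. d \<in> X"
    using countable_dense_exists by metis
  then have "E \<noteq> {}" using E(2)[of UNIV] by auto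
  define g where "g = from_nat_into E"
  have g: "\<exists>k. dist x (g k) < r" if "r > 0" for x r
  proof -
    obtain d where "d \<in> E" "d \<in> ball x r" using E(2)[of "ball x r"] \<open>r > 0\<close> by auto
    moreover have "d \<in> range g" using \<open>d \<in> E\<close> E(1) \<open>E \<noteq> {}\<close> by (simp add: g_def)
    ultimately show ?thesis by auto
  qed
  \<comment> \<open>Truncation at T keeps every grid point inside the interval although the number
    of grid points is rounded up.\<close>
  define p where "p m i = min T (real i / real (Suc m))" for m i :: nat
  define N :: "nat \<Rightarrow> nat" where "N m = nat \<lceil>T * real (Suc m)\<rceil>" for m
  have p: "p m i \<in> {0..T}" for m i using T by (auto simp: p_def)
  \<comment> \<open>The oscillation is tested at rational times only, which makes each set a
    countable intersection of measurable ones; continuity of the paths extends the bound to all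
    times.\<close>
  define Q where "Q = (\<lambda>(m::nat, k::nat, c::nat list). {w \<in> space M.
    (\<forall>i\<le>N m. dist (\<beta> (p m i) w) (g (c ! i)) < 1 / Suc k) \<and>
    (\<forall>s\<in>\<rat>\<inter>{0..T}. \<forall>i\<le>N m. \<bar>s - p m i\<bar> \<le> 1 / Suc m \<longrightarrow> dist (\<beta> s w) (\<beta> (p m i) w) \<le> 1 / Suc k)})"
  have Qm: "Q i \<in> sets M" for i
  proof -
    obtain m k c where i: "i = (m, k, c)" by (cases i)
    have [measurable]: "\<beta> (p m i) \<in> borel_measurable M" for i using meas p by blast
    have [measurable]: "\<beta> s \<in> borel_measurable M" if "s \<in> \<rat>\<inter>{0..T}" for s using meas that by blast
    have 1: "{w\<in>space M. dist (\<beta> (p m i) w) (g (c ! i)) < 1 / Suc k} \<in> sets M" for i by measurable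
    have 2: "{w\<in>space M. \<bar>s - p m i\<bar> \<le> 1 / Suc m \<longrightarrow> dist (\<beta> s w) (\<beta> (p m i) w) \<le> 1 / Suc k} \<in> sets M"
      if "s \<in> \<rat>\<inter>{0..T}" for s i using that by measurable
    show ?thesis unfolding i Q_def prod.case
      by (intro sets.sets_Collect_conj sets.sets_Collect_countable_All' sets.sets_Collect_countable_All
        sets.sets_Collect_imp sets.sets_Collect_const 1 2) (auto simp: countable_rat)
  qed
  have Qclose: "norm (\<beta> t w' - \<beta> t w) \<le> 4 / Suc k"
    if w: "w \<in> Q (m, k, c)" "w' \<in> Q (m, k, c)" and t: "t \<in> {0..T}" for w w' t m k c
  proof -
    define i where "i = nat \<lfloor>t * real (Suc m)\<rfloor>"
    have tp: "0 \<le> t * real (Suc m)" "t * real (Suc m) \<le> T * real (Suc m)"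
      using t by (auto intro!: mult_right_mono)
    have i1: "real i \<le> t * real (Suc m)" "t * real (Suc m) < real i + 1"
      using tp(1) by (auto simp: i_def)
    have iN: "i \<le> N m" unfolding i_def N_def using tp by (intro nat_mono) linarith
    have pi: "p m i = real i / real (Suc m)" "p m i \<le> t" "t < p m i + 1 / Suc m"
    proof -
      have "real i / real (Suc m) \<le> t" using i1(1) by (subst pos_divide_le_eq) auto
      then show "p m i = real i / real (Suc m)" "p m i \<le> t" using t by (auto simp: p_def)
      moreover have "t < (real i + 1) / real (Suc m)" using i1(2) by (subst pos_less_divide_eq) auto
      ultimately show "t < p m i + 1 / Suc m" by (simp add: add_divide_distrib)
    qed
    have osc: "dist (\<beta> t u) (\<beta> (p m i) u) \<le> 1 / Suc k" if u: "u \<in> Q (m, k, c)" for u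
    proof (cases "t = p m i")
      case True
      then show ?thesis by simp
    next
      case False
      then have t0: "p m i < t" using pi by simp
      have us: "u \<in> space M" using u by (simp add: Q_def)
      have "\<exists>q\<in>\<rat>. max (p m i) (t - inverse (real (Suc n))) < q \<and> q < t" for n
        using t0 by (intro Rats_dense_in_real) auto
      then obtain r where r: "\<And>n. r n \<in> \<rat>" "\<And>n. max (p m i) (t - inverse (real (Suc n))) < r n" "\<And>n. r n < t" by metis
      have rt: "r \<longlonglongrightarrow> t"
      proof (rule tendsto_sandwich[OF always_eventually always_eventually])
        show "(\<lambda>n. t - inverse (real (Suc n))) \<longlonglongrightarrow> t"
          using tendsto_diff[OF tendsto_const LIMSEQ_inverse_real_of_nat, of t] by simp
        show "(\<lambda>_. t) \<longlonglongrightarrow> t" by simp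
      qed (use r in \<open>auto intro: less_imp_le\<close>)
      have rT: "r n \<in> {0..T}" for n using r(2)[of n] r(3)[of n] p[of m i] t by auto
      have "(\<lambda>n. \<beta> (r n) u) \<longlonglongrightarrow> \<beta> t u"
        by (rule continuous_on_tendsto_compose[OF cont[OF us] rt t]) (use rT in auto)
      then have "(\<lambda>n. dist (\<beta> (r n) u) (\<beta> (p m i) u)) \<longlonglongrightarrow> dist (\<beta> t u) (\<beta> (p m i) u)"
        by (intro tendsto_intros)
      moreover have "dist (\<beta> (r n) u) (\<beta> (p m i) u) \<le> 1 / Suc k" for n
      proof -
        have "\<bar>r n - p m i\<bar> \<le> 1 / Suc m" using r(2)[of n] r(3)[of n] pi by auto
        then show ?thesis using u iN r(1)[of n] rT[of n] unfolding Q_def by blast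
      qed
      ultimately show ?thesis by (intro LIMSEQ_le_const2[of _ "dist (\<beta> t u) (\<beta> (p m i) u)"]) auto
    qed
    have near: "dist (\<beta> (p m i) u) (g (c ! i)) \<le> 1 / Suc k" if u: "u \<in> Q (m, k, c)" for u
      using u iN by (auto simp: Q_def intro: less_imp_le)
    have "norm (\<beta> t w' - \<beta> t w) = dist (\<beta> t w') (\<beta> t w)" by (simp add: dist_norm)
    also have "\<dots> \<le> dist (\<beta> t w') (\<beta> (p m i) w') + dist (\<beta> (p m i) w') (g (c ! i)) +
        (dist (\<beta> (p m i) w) (g (c ! i)) + dist (\<beta> t w) (\<beta> (p m i) w))"
      by metric
    also have "\<dots> \<le> 1 / Suc k + 1 / Suc k + (1 / Suc k + 1 / Suc k)"
      by (intro add_mono osc near w)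
    finally show ?thesis by simp
  qed
  have Qcover: "\<exists>m c. w \<in> Q (m, k, c)" if w: "w \<in> space M" for w k
  proof -
    have "uniformly_continuous_on {0..T} (\<lambda>t. \<beta> t w)"
      by (rule compact_uniformly_continuous[OF cont[OF w]]) simp
    then obtain d where d: "d > 0" "\<And>s t. s \<in> {0..T} \<Longrightarrow> t \<in> {0..T} \<Longrightarrow> dist s t < d \<Longrightarrow>
        dist (\<beta> s w) (\<beta> t w) < 1 / Suc k"
      unfolding uniformly_continuous_on_def by (metis of_nat_0_less_iff zero_less_Suc zero_less_divide_1_iff)
    obtain m :: nat where m: "inverse (real (Suc m)) < d" using reals_Archimedean d(1) by blast
    define c where "c = map (\<lambda>i. SOME j. dist (\<beta> (p m i) w) (g j) < 1 / Suc k) [0..<Suc (N m)]"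
    have "dist (\<beta> (p m i) w) (g (c ! i)) < 1 / Suc k" if "i \<le> N m" for i
    proof -
      have "c ! i = (SOME j. dist (\<beta> (p m i) w) (g j) < 1 / Suc k)"
        using that by (simp add: c_def del: upt_Suc)
      then show ?thesis using someI_ex[OF g[of "1 / Suc k" "\<beta> (p m i) w"]] by simp
    qed
    moreover have "dist (\<beta> s w) (\<beta> (p m i) w) \<le> 1 / Suc k"
      if "s \<in> {0..T}" "\<bar>s - p m i\<bar> \<le> 1 / Suc m" for s i
      using d(2)[OF that(1) p, of m i] that(2) m
      by (simp add: dist_real_def divide_inverse less_imp_le)
    ultimately show ?thesis using w by (intro exI[of _ m] exI[of _ c]) (auto simp: Q_def)
  qed
  show ?thesis
  proof (rule borel_measurableI)
    fix S :: "'c set" assume S: "open S"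
    define I where "I = {i. Q i \<subseteq> f -` S \<inter> space M}"
    have "f -` S \<inter> space M = (\<Union>i\<in>I. Q i)"
    proof
      show "f -` S \<inter> space M \<subseteq> (\<Union>i\<in>I. Q i)"
      proof
        fix w assume "w \<in> f -` S \<inter> space M"
        then have w: "f w \<in> S" "w \<in> space M" by auto
        obtain e where e: "e > 0" "\<And>y. dist y (f w) < e \<Longrightarrow> y \<in> S" using S w(1) unfolding open_dist by blast
        obtain d where d: "d > 0" "\<And>w'. w' \<in> space M \<Longrightarrow> (\<forall>t\<in>{0..T}. norm (\<beta> t w' - \<beta> t w) \<le> d) \<Longrightarrow>
          dist (f w') (f w) < e" using f[OF w(2) e(1)] by blast
        obtain k :: nat where k: "inverse (real (Suc k)) < d / 4" using reals_Archimedean[of "d/4"] d(1) by auto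
        obtain m c where mc: "w \<in> Q (m, k, c)" using Qcover[OF w(2)] by blast
        have "Q (m, k, c) \<subseteq> f -` S \<inter> space M"
        proof
          fix w' assume w': "w' \<in> Q (m, k, c)"
          then have w's: "w' \<in> space M" by (simp add: Q_def)
          have "4 / real (Suc k) = 4 * inverse (real (Suc k))" by (simp only: divide_inverse)
          then have "norm (\<beta> t w' - \<beta> t w) \<le> d" if "t \<in> {0..T}" for t
            using Qclose[OF mc w' that] k by linarith
          then have "dist (f w') (f w) < e" by (intro d(2) w's ballI)
          then show "w' \<in> f -` S \<inter> space M" using e(2) w's by simp
        qed
        then show "w \<in> (\<Union>i\<in>I. Q i)" using mc by (auto simp: I_def)
      qed
    qed (auto simp: I_def)
    also have "\<dots> \<in> sets M" using Qm by (intro sets.countable_UN') auto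
    finally show "f -` S \<inter> space M \<in> sets M" .
  qed
qed

section \<open>Stationary random flows\<close>

primrec garsia_max :: "('a \<Rightarrow> real) \<Rightarrow> ('a \<Rightarrow> 'a) \<Rightarrow> nat \<Rightarrow> 'a \<Rightarrow> real" where
  "garsia_max f T 0 x = 0"
| "garsia_max f T (Suc n) x = max 0 (f x + garsia_max f T n (T x))"

lemma garsia_max_nonneg: "0 \<le> garsia_max f T n x"
  by (cases n) auto

lemma garsia_max_mono: "garsia_max f T n x \<le> garsia_max f T (Suc n) x"
  by (induction n arbitrary: x) (simp, metis add_left_mono garsia_max.simps(2) max.mono order_refl)

lemma birkhoff_sum_le_garsia_max: "(\<Sum>k<n. f ((T ^^ k) x)) \<le> garsia_max f T n x"
proof (induction n arbitrary: x)
  case (Suc n)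
  have "(\<Sum>k<Suc n. f ((T ^^ k) x)) = f x + (\<Sum>k<n. f ((T ^^ k) (T x)))"
    by (subst sum.lessThan_Suc_shift) (simp add: funpow_swap1)
  also have "\<dots> \<le> garsia_max f T (Suc n) x" using Suc.IH[of "T x"] by simp
  finally show ?case .
qed simp

text \<open>Garsia's argument: \<open>garsia_max f T n\<close> is the largest of the Birkhoff sums
  of length 0 to n. Where \<open>m (Suc n)\<close> is positive it exceeds \<open>m n\<close>
  composed with T by exactly f; elsewhere the difference is at most 0. By invariance the two means
  differ by a nonnegative amount, so the integral of f over \<open>A (Suc n)\<close> is nonnegative.
  If almost every orbit had a positive Birkhoff sum, these sets would exhaust the space and the mean
  of f would be nonnegative.\<close>

lemma (in prob_space) birkhoff_sums_nonpos_positive_measure: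
  fixes f :: "'a \<Rightarrow> real"
  assumes T[measurable]: "T \<in> measurable M M" and inv: "distr M M T = M"
    and f: "integrable M f" and neg: "(\<integral>x. f x \<partial>M) < 0"
  shows "0 < emeasure M {x\<in>space M. \<forall>n. (\<Sum>k<n. f ((T ^^ k) x)) \<le> 0}"
proof (rule ccontr)
  have [measurable]: "f \<in> borel_measurable M" using f by simp
  have [measurable]: "(T ^^ k) \<in> measurable M M" for k by (rule measurable_compose_n[OF T])
  define m where "m = garsia_max f T"
  have int: "integrable M (m n)" for n
  proof (induction n)
    case 0 then show ?case by (simp add: m_def)
  next
    case (Suc n)
    have "integrable (distr M M T) (m n)" using Suc inv by simp
    then have "integrable M (\<lambda>x. m n (T x))"
      by (subst (asm) integrable_distr_eq) (use Suc in auto)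
    then show ?case using f by (simp add: m_def)
  qed
  have [measurable]: "m n \<in> borel_measurable M" for n using int by (rule borel_measurable_integrable)
  have intT: "integrable M (\<lambda>x. m n (T x))" "(\<integral>x. m n (T x) \<partial>M) = (\<integral>x. m n x \<partial>M)" for n
  proof -
    show "integrable M (\<lambda>x. m n (T x))"
      using int[of n] inv integrable_distr_eq[of T M M "m n"] by simp
    show "(\<integral>x. m n (T x) \<partial>M) = (\<integral>x. m n x \<partial>M)"
      using integral_distr[of T M M "m n"] inv by simp
  qed
  define A where "A n = {x\<in>space M. 0 < m n x}" for n
  have [measurable]: "A n \<in> sets M" for n unfolding A_def by measurable
  have pos: "0 \<le> (\<integral>x. indicator (A (Suc n)) x * f x \<partial>M)" for n
  proof -
    have "0 \<le> (\<integral>x. m (Suc n) x \<partial>M) - (\<integral>x. m n (T x) \<partial>M)"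
      unfolding intT(2) using integral_mono[OF int int, of n "Suc n"] garsia_max_mono[of f T n]
      by (simp add: m_def del: garsia_max.simps)
    also have "\<dots> = (\<integral>x. m (Suc n) x - m n (T x) \<partial>M)" using int intT by simp
    also have "\<dots> \<le> (\<integral>x. indicator (A (Suc n)) x * f x \<partial>M)"
    proof (rule integral_mono)
      show "integrable M (\<lambda>x. indicator (A (Suc n)) x * f x)"
        using integrable_mult_indicator[of "A (Suc n)" M f] f by simp
      fix x assume "x \<in> space M"
      then show "m (Suc n) x - m n (T x) \<le> indicator (A (Suc n)) x * f x"
        using garsia_max_nonneg[of f T n "T x"] by (auto simp: A_def m_def indicator_def max_def)
    qed (use int intT in auto)
    finally show ?thesis .
  qed
  assume "\<not> 0 < emeasure M {x\<in>space M. \<forall>n. (\<Sum>k<n. f ((T ^^ k) x)) \<le> 0}"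
  then have "emeasure M {x\<in>space M. \<forall>n. (\<Sum>k<n. f ((T ^^ k) x)) \<le> 0} = 0" by simp
  then have "AE x in M. \<not> (\<forall>n. (\<Sum>k<n. f ((T ^^ k) x)) \<le> 0)"
    by (subst AE_iff_null) (auto simp: null_sets_def)
  with AE_space have ae: "AE x in M. (\<lambda>n. indicator (A (Suc n)) x * f x) \<longlonglongrightarrow> f x"
  proof (eventually_elim)
    case (elim x)
    from elim(2) obtain k where k: "0 < m k x"
      using birkhoff_sum_le_garsia_max[where f=f and T=T and x=x] by (metis m_def not_le less_le_trans)
    have "incseq (\<lambda>n. m n x)" unfolding m_def by (intro incseq_SucI garsia_max_mono)
    then have "0 < m n x" if "n \<ge> k" for n using k that by (meson incseqD less_le_trans)
    then have "eventually (\<lambda>n. indicator (A (Suc n)) x * f x = f x) sequentially"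
      using elim(1) by (auto simp: eventually_sequentially A_def intro!: exI[of _ k])
    then show ?case by (rule tendsto_eventually)
  qed
  have "(\<lambda>n. \<integral>x. indicator (A (Suc n)) x * f x \<partial>M) \<longlonglongrightarrow> (\<integral>x. f x \<partial>M)"
    by (rule integral_dominated_convergence[where w="\<lambda>x. norm (f x)"])
      (use f ae in \<open>auto simp: indicator_def\<close>)
  then have "0 \<le> (\<integral>x. f x \<partial>M)" by (rule LIMSEQ_le_const) (use pos in auto)
  with neg show False by simp
qed


text \<open>The argument of \<open>g\<close> and \<open>U\<close> is a past together with a future:
  \<open>g\<close> returns the past as it looks after time t, \<open>U\<close> moves the state. The
  axioms concern single steps, since long times are reached by iterating steps of a fixed length,
  each with an independent future.\<close>

locale random_flow = prob_space P for P :: "'w measure" +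
  fixes g :: "real \<Rightarrow> 'w \<times> 'w \<Rightarrow> 'w"
    and U :: "real \<Rightarrow> 'w \<times> 'w \<Rightarrow> 'x::euclidean_space \<Rightarrow> 'x"
    and K :: "'w \<Rightarrow> 'x measure"
  assumes g_measurable: "0 \<le> t \<Longrightarrow> g t \<in> measurable (P \<Otimes>\<^sub>M P) P"
    and U_measurable: "0 \<le> t \<Longrightarrow> (\<lambda>(x, \<omega>). U t \<omega> x) \<in> borel_measurable (borel \<Otimes>\<^sub>M (P \<Otimes>\<^sub>M P))"
    and K_measurable: "K \<in> measurable P (prob_algebra borel)"
    and g_invariant: "0 \<le> t \<Longrightarrow> distr (P \<Otimes>\<^sub>M P) P (g t) = P"
    and K_equivariant: "0 \<le> t \<Longrightarrow> \<omega> \<in> space (P \<Otimes>\<^sub>M P) \<Longrightarrow>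
      distr (K (fst \<omega>)) borel (U t \<omega>) = K (g t \<omega>)"
begin

sublocale PP: pair_prob_space P P ..

lemma kernel_space:
  assumes "\<rho> \<in> measurable P (prob_algebra borel)" "\<omega> \<in> space P"
  shows "prob_space (\<rho> \<omega>)" "sets (\<rho> \<omega>) = sets borel" "space (\<rho> \<omega>) = UNIV"
  using measurable_space[OF assms] sets_eq_imp_space_eq[of "\<rho> \<omega>" borel]
  by (auto simp: space_prob_algebra)

lemma U_measurable1:
  assumes "0 \<le> t" "\<omega> \<in> space (P \<Otimes>\<^sub>M P)"
  shows "U t \<omega> \<in> borel_measurable borel"
proof -
  have "(\<lambda>x. (\<lambda>(x, \<omega>). U t \<omega> x) (x, \<omega>)) \<in> borel_measurable borel"
    using assms(2) by (intro measurable_compose[OF _ U_measurable[OF assms(1)]]) auto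
  then show ?thesis by simp
qed

section \<open>Measures with a prescribed kernel over the noise\<close>

definition mixture :: "('w \<Rightarrow> 'x measure) \<Rightarrow> ('x \<times> 'w) measure" where
  "mixture \<rho> = P \<bind> (\<lambda>\<omega>. distr (\<rho> \<omega>) (borel \<Otimes>\<^sub>M P) (\<lambda>x. (x, \<omega>)))"

lemma mixture_kernel:
  assumes [measurable]: "\<rho> \<in> measurable P (prob_algebra borel)"
  shows "(\<lambda>\<omega>. distr (\<rho> \<omega>) (borel \<Otimes>\<^sub>M P) (\<lambda>x. (x, \<omega>))) \<in> measurable P (prob_algebra (borel \<Otimes>\<^sub>M P))"
  by measurable

lemma sets_mixture [measurable_cong]:
  assumes "\<rho> \<in> measurable P (prob_algebra borel)"
  shows "sets (mixture \<rho>) = sets (borel \<Otimes>\<^sub>M P)"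
  unfolding mixture_def using not_empty by (intro sets_bind) auto

lemma prob_space_mixture:
  assumes "\<rho> \<in> measurable P (prob_algebra borel)"
  shows "prob_space (mixture \<rho>)"
  unfolding mixture_def
  by (rule prob_space_bind'[OF _ mixture_kernel[OF assms]]) (simp add: space_prob_algebra prob_space_axioms)

lemma nn_integral_kernel_measurable:
  assumes \<rho>: "\<rho> \<in> measurable P (prob_algebra borel)" and f: "f \<in> borel_measurable (borel \<Otimes>\<^sub>M P)"
  shows "(\<lambda>\<omega>. \<integral>\<^sup>+x. f (x, \<omega>) \<partial>\<rho> \<omega>) \<in> borel_measurable P"
proof (rule nn_integral_measurable_subprob_algebra2[OF _ measurable_prob_algebraD[OF \<rho>]])
  note f[measurable]
  show "(\<lambda>(\<omega>, x). f (x, \<omega>)) \<in> borel_measurable (P \<Otimes>\<^sub>M borel)" by measurable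
qed

lemma nn_integral_mixture:
  assumes \<rho>: "\<rho> \<in> measurable P (prob_algebra borel)" and f: "f \<in> borel_measurable (borel \<Otimes>\<^sub>M P)"
  shows "(\<integral>\<^sup>+z. f z \<partial>mixture \<rho>) = (\<integral>\<^sup>+\<omega>. \<integral>\<^sup>+x. f (x, \<omega>) \<partial>\<rho> \<omega> \<partial>P)"
proof -
  have "(\<integral>\<^sup>+z. f z \<partial>mixture \<rho>) =
      (\<integral>\<^sup>+\<omega>. \<integral>\<^sup>+z. f z \<partial>distr (\<rho> \<omega>) (borel \<Otimes>\<^sub>M P) (\<lambda>x. (x, \<omega>)) \<partial>P)"
    unfolding mixture_def
    by (rule nn_integral_bind[OF f measurable_prob_algebraD[OF mixture_kernel[OF \<rho>]]])
  also have "\<dots> = (\<integral>\<^sup>+\<omega>. \<integral>\<^sup>+x. f (x, \<omega>) \<partial>\<rho> \<omega> \<partial>P)"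
  proof (rule nn_integral_cong)
    fix \<omega> assume \<omega>: "\<omega> \<in> space P"
    note kernel_space(2)[OF \<rho> \<omega>, measurable_cong]
    show "(\<integral>\<^sup>+z. f z \<partial>distr (\<rho> \<omega>) (borel \<Otimes>\<^sub>M P) (\<lambda>x. (x, \<omega>))) = (\<integral>\<^sup>+x. f (x, \<omega>) \<partial>\<rho> \<omega>)"
      using \<omega> f by (subst nn_integral_distr) auto
  qed
  finally show ?thesis .
qed

lemma emeasure_mixture:
  assumes \<rho>: "\<rho> \<in> measurable P (prob_algebra borel)" and A: "A \<in> sets (borel \<Otimes>\<^sub>M P)"
  shows "emeasure (mixture \<rho>) A = (\<integral>\<^sup>+\<omega>. emeasure (\<rho> \<omega>) {x. (x, \<omega>) \<in> A} \<partial>P)"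
proof -
  have "emeasure (mixture \<rho>) A = (\<integral>\<^sup>+z. indicator A z \<partial>mixture \<rho>)"
    using A by (simp add: sets_mixture[OF \<rho>])
  also have "\<dots> = (\<integral>\<^sup>+\<omega>. \<integral>\<^sup>+x. indicator A (x, \<omega>) \<partial>\<rho> \<omega> \<partial>P)"
    using A by (intro nn_integral_mixture[OF \<rho>]) simp
  also have "\<dots> = (\<integral>\<^sup>+\<omega>. emeasure (\<rho> \<omega>) {x. (x, \<omega>) \<in> A} \<partial>P)"
  proof (rule nn_integral_cong)
    fix \<omega> assume \<omega>: "\<omega> \<in> space P"
    have "{x. (x, \<omega>) \<in> A} \<in> sets (\<rho> \<omega>)"
      using sets_Pair2[OF A, of \<omega>] kernel_space(2)[OF \<rho> \<omega>] by (simp add: vimage_def)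
    then have "emeasure (\<rho> \<omega>) {x. (x, \<omega>) \<in> A} = (\<integral>\<^sup>+x. indicator {x. (x, \<omega>) \<in> A} x \<partial>\<rho> \<omega>)" by simp
    also have "\<dots> = (\<integral>\<^sup>+x. indicator A (x, \<omega>) \<partial>\<rho> \<omega>)" by (intro nn_integral_cong) (simp add: indicator_def)
    finally show "(\<integral>\<^sup>+x. indicator A (x, \<omega>) \<partial>\<rho> \<omega>) = emeasure (\<rho> \<omega>) {x. (x, \<omega>) \<in> A}" by simp
  qed
  finally show ?thesis .
qed

lemma nn_integral_g:
  assumes t: "0 \<le> t" and f: "f \<in> borel_measurable P"
  shows "(\<integral>\<^sup>+\<omega>. f (g t \<omega>) \<partial>(P \<Otimes>\<^sub>M P)) = (\<integral>\<^sup>+\<omega>. f \<omega> \<partial>P)"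
  using nn_integral_distr[OF g_measurable[OF t], of f] f g_invariant[OF t] by simp

text \<open>Equivariance turns the pushed fibre measure into the fibre over the new past; invariance
  of P under \<open>g t\<close> then replaces the new past by the old one.\<close>

lemma nn_integral_mixture_push:
  assumes t: "0 \<le> t" and \<rho>: "\<rho> \<in> measurable P (prob_algebra borel)"
    and eq: "AE \<omega> in P \<Otimes>\<^sub>M P. distr (\<rho> (fst \<omega>)) borel (U t \<omega>) = \<rho> (g t \<omega>)"
    and f: "f \<in> borel_measurable (borel \<Otimes>\<^sub>M P)"
  shows "(\<integral>\<^sup>+\<omega>. \<integral>\<^sup>+x. f (U t \<omega> x, g t \<omega>) \<partial>\<rho> (fst \<omega>) \<partial>(P \<Otimes>\<^sub>M P)) = (\<integral>\<^sup>+z. f z \<partial>mixture \<rho>)"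
proof -
  have "(\<integral>\<^sup>+\<omega>. \<integral>\<^sup>+x. f (U t \<omega> x, g t \<omega>) \<partial>\<rho> (fst \<omega>) \<partial>(P \<Otimes>\<^sub>M P)) =
      (\<integral>\<^sup>+\<omega>. \<integral>\<^sup>+y. f (y, g t \<omega>) \<partial>\<rho> (g t \<omega>) \<partial>(P \<Otimes>\<^sub>M P))"
  proof (rule nn_integral_cong_AE)
    show "AE \<omega> in P \<Otimes>\<^sub>M P. (\<integral>\<^sup>+x. f (U t \<omega> x, g t \<omega>) \<partial>\<rho> (fst \<omega>)) = (\<integral>\<^sup>+y. f (y, g t \<omega>) \<partial>\<rho> (g t \<omega>))"
      using eq AE_space
    proof eventually_elim
      case (elim \<omega>)
      have "fst \<omega> \<in> space P" using elim(2) by (auto simp: space_pair_measure)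
      note kernel_space(2)[OF \<rho> this, measurable_cong]
      have g: "g t \<omega> \<in> space P" using measurable_space[OF g_measurable[OF t] elim(2)] .
      have [measurable]: "U t \<omega> \<in> borel_measurable borel" by (rule U_measurable1[OF t elim(2)])
      have [measurable]: "(\<lambda>y. f (y, g t \<omega>)) \<in> borel_measurable borel"
        using f g by measurable
      show ?case unfolding elim(1)[symmetric] by (subst nn_integral_distr) simp_all
    qed
  qed
  also have "\<dots> = (\<integral>\<^sup>+\<omega>. \<integral>\<^sup>+y. f (y, \<omega>) \<partial>\<rho> \<omega> \<partial>P)"
    by (rule nn_integral_g[OF t nn_integral_kernel_measurable[OF \<rho> f]])
  also have "\<dots> = (\<integral>\<^sup>+z. f z \<partial>mixture \<rho>)" by (rule nn_integral_mixture[OF \<rho> f, symmetric])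
  finally show ?thesis .
qed

text \<open>Invariance under the one-step transition kernel, with Fubini exchanging the state and
  the new noise. Equivariance enters almost everywhere because the normalized atomic part satisfies
  it only in that sense.\<close>

lemma nn_integral_mixture_step:
  assumes t: "0 \<le> t" and \<rho>: "\<rho> \<in> measurable P (prob_algebra borel)"
    and eq: "AE \<omega> in P \<Otimes>\<^sub>M P. distr (\<rho> (fst \<omega>)) borel (U t \<omega>) = \<rho> (g t \<omega>)"
    and f: "f \<in> borel_measurable (borel \<Otimes>\<^sub>M P)"
  shows "(\<integral>\<^sup>+z. \<integral>\<^sup>+w. f (U t (snd z, w) (fst z), g t (snd z, w)) \<partial>P \<partial>mixture \<rho>) = (\<integral>\<^sup>+z. f z \<partial>mixture \<rho>)"
proof -
  note [measurable] = f g_measurable[OF t] U_measurable[OF t]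
  have m[measurable]: "(\<lambda>(z, w). f (U t (snd z, w) (fst z), g t (snd z, w))) \<in> borel_measurable ((borel \<Otimes>\<^sub>M P) \<Otimes>\<^sub>M P)"
  proof -
    have "(\<lambda>(z, w). U t (snd z, w) (fst z)) \<in> borel_measurable ((borel \<Otimes>\<^sub>M P) \<Otimes>\<^sub>M P)"
      using measurable_compose[of "\<lambda>(z, w). (fst z, (snd z, w))", OF _ U_measurable[OF t]] by (simp add: case_prod_beta)
    then show ?thesis by measurable
  qed
  have "(\<integral>\<^sup>+z. \<integral>\<^sup>+w. f (U t (snd z, w) (fst z), g t (snd z, w)) \<partial>P \<partial>mixture \<rho>) =
      (\<integral>\<^sup>+\<omega>. \<integral>\<^sup>+x. \<integral>\<^sup>+w. f (U t (\<omega>, w) x, g t (\<omega>, w)) \<partial>P \<partial>\<rho> \<omega> \<partial>P)"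
    by (subst nn_integral_mixture[OF \<rho>]) simp_all
  also have "\<dots> = (\<integral>\<^sup>+\<omega>. \<integral>\<^sup>+w. \<integral>\<^sup>+x. f (U t (\<omega>, w) x, g t (\<omega>, w)) \<partial>\<rho> \<omega> \<partial>P \<partial>P)"
  proof (rule nn_integral_cong)
    fix \<omega> assume \<omega>: "\<omega> \<in> space P"
    note kernel_space(2)[OF \<rho> \<omega>, measurable_cong]
    interpret \<rho>: prob_space "\<rho> \<omega>" by (rule kernel_space(1)[OF \<rho> \<omega>])
    interpret pair_sigma_finite "\<rho> \<omega>" P ..
    have "(\<lambda>(x, w). f (U t (\<omega>, w) x, g t (\<omega>, w))) \<in> borel_measurable (\<rho> \<omega> \<Otimes>\<^sub>M P)"
      using measurable_compose[of "\<lambda>(x, w). ((x, \<omega>), w)", OF _ m, of "\<rho> \<omega> \<Otimes>\<^sub>M P"] \<omega> by (simp add: case_prod_beta)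
    then show "(\<integral>\<^sup>+x. \<integral>\<^sup>+w. f (U t (\<omega>, w) x, g t (\<omega>, w)) \<partial>P \<partial>\<rho> \<omega>) =
        (\<integral>\<^sup>+w. \<integral>\<^sup>+x. f (U t (\<omega>, w) x, g t (\<omega>, w)) \<partial>\<rho> \<omega> \<partial>P)"
      by (rule Fubini'[symmetric])
  qed
  also have "\<dots> = (\<integral>\<^sup>+\<omega>. \<integral>\<^sup>+x. f (U t \<omega> x, g t \<omega>) \<partial>\<rho> (fst \<omega>) \<partial>(P \<Otimes>\<^sub>M P))"
  proof -
    have "(\<lambda>\<omega>. \<integral>\<^sup>+x. f (U t \<omega> x, g t \<omega>) \<partial>\<rho> (fst \<omega>)) \<in> borel_measurable (P \<Otimes>\<^sub>M P)"
    proof (rule nn_integral_measurable_subprob_algebra2)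
      show "(\<lambda>(\<omega>, x). f (U t \<omega> x, g t \<omega>)) \<in> borel_measurable ((P \<Otimes>\<^sub>M P) \<Otimes>\<^sub>M borel)"
        using measurable_compose[of "\<lambda>(\<omega>, x). (x, \<omega>)", OF _ U_measurable[OF t], of "(P \<Otimes>\<^sub>M P) \<Otimes>\<^sub>M borel"]
        by (simp add: case_prod_beta)
      show "(\<lambda>\<omega>. \<rho> (fst \<omega>)) \<in> measurable (P \<Otimes>\<^sub>M P) (subprob_algebra borel)"
        using measurable_prob_algebraD[OF \<rho>] by measurable
    qed
    from nn_integral_fst[OF this] show ?thesis by simp
  qed
  also have "\<dots> = (\<integral>\<^sup>+z. f z \<partial>mixture \<rho>)" by (rule nn_integral_mixture_push[OF assms])
  finally show ?thesis .
qed

text \<open>The Markov chain of states and pasts as a skew product: an i.i.d. stream of futures is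
  carried along and its head is consumed. This makes the chain a deterministic measure-preserving
  map, to which the maximal inequality applies.\<close>

definition step :: "real \<Rightarrow> ('x \<times> 'w) \<times> 'w stream \<Rightarrow> ('x \<times> 'w) \<times> 'w stream" where
  "step t = (\<lambda>(z, s). ((U t (snd z, shd s) (fst z), g t (snd z, shd s)), stl s))"

definition path_measure :: "(('x \<times> 'w) \<times> 'w stream) measure" where
  "path_measure = mixture K \<Otimes>\<^sub>M stream_space P"

lemma sets_path_measure [measurable_cong]:
  "sets path_measure = sets ((borel \<Otimes>\<^sub>M P) \<Otimes>\<^sub>M stream_space P)"
  unfolding path_measure_def by (intro sets_pair_measure_cong sets_mixture K_measurable refl)

lemma step_measurable [measurable]:
  assumes t: "0 \<le> t"
  shows "step t \<in> measurable path_measure path_measure"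
proof -
  note [measurable] = g_measurable[OF t]
  have "(\<lambda>(z, s). U t (snd z, shd s) (fst z)) \<in> borel_measurable ((borel \<Otimes>\<^sub>M P) \<Otimes>\<^sub>M stream_space P)"
    using measurable_compose[of "\<lambda>(z, s). (fst z, (snd z, shd s))", OF _ U_measurable[OF t]]
    by (simp add: case_prod_beta)
  then have "step t \<in> measurable ((borel \<Otimes>\<^sub>M P) \<Otimes>\<^sub>M stream_space P) ((borel \<Otimes>\<^sub>M P) \<Otimes>\<^sub>M stream_space P)"
    unfolding step_def by measurable
  then show ?thesis by (simp cong: measurable_cong_sets add: sets_path_measure)
qed

sublocale SP: prob_space "stream_space P" by (rule prob_space_stream_space)

sublocale KM: prob_space "mixture K" by (rule prob_space_mixture[OF K_measurable])

sublocale PM: prob_space path_measure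
proof -
  interpret pair_prob_space "mixture K" "stream_space P" ..
  show "prob_space path_measure" unfolding path_measure_def by (rule prob_space_axioms)
qed

lemma K_equivariant_AE:
  "0 \<le> t \<Longrightarrow> AE \<omega> in P \<Otimes>\<^sub>M P. distr (K (fst \<omega>)) borel (U t \<omega>) = K (g t \<omega>)"
  using K_equivariant by (auto intro!: AE_I2)

text \<open>Under the stream measure the head is independent of the tail, and the tail has the law
  of the stream. Integrating out the tail first leaves a function \<open>h\<close> of state and
  past, for which the claim is the one-step invariance of the mixture.\<close>

lemma step_invariant:
  assumes t: "0 \<le> t"
  shows "distr path_measure path_measure (step t) = path_measure"
proof (rule measure_eqI)
  fix A assume "A \<in> sets (distr path_measure path_measure (step t))"
  then have A: "A \<in> sets path_measure" by simp
  then have [measurable]: "A \<in> sets ((borel \<Otimes>\<^sub>M P) \<Otimes>\<^sub>M stream_space P)" by (simp add: sets_path_measure)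
  note [measurable_cong] = sets_mixture[OF K_measurable]
  have [measurable]: "step t \<in> measurable ((borel \<Otimes>\<^sub>M P) \<Otimes>\<^sub>M stream_space P) ((borel \<Otimes>\<^sub>M P) \<Otimes>\<^sub>M stream_space P)"
    using step_measurable[OF t] by (simp cong: measurable_cong_sets add: sets_path_measure)
  have m: "(\<lambda>u. indicator A (step t u) :: ennreal) \<in> borel_measurable (mixture K \<Otimes>\<^sub>M stream_space P)"
    by measurable
  define h where "h z = (\<integral>\<^sup>+s. indicator A (z, s) \<partial>stream_space P)" for z
  have h[measurable]: "h \<in> borel_measurable (borel \<Otimes>\<^sub>M P)" unfolding h_def by measurable
  have "emeasure (distr path_measure path_measure (step t)) A = (\<integral>\<^sup>+u. indicator A (step t u) \<partial>path_measure)"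
    using A nn_integral_distr[OF step_measurable[OF t], of "indicator A"] by simp
  also have "\<dots> = (\<integral>\<^sup>+z. \<integral>\<^sup>+s. indicator A (step t (z, s)) \<partial>stream_space P \<partial>mixture K)"
    using SP.nn_integral_fst[OF m] by (simp add: path_measure_def)
  also have "\<dots> = (\<integral>\<^sup>+z. \<integral>\<^sup>+w. h (U t (snd z, w) (fst z), g t (snd z, w)) \<partial>P \<partial>mixture K)"
  proof (rule nn_integral_cong)
    fix z assume z: "z \<in> space (mixture K)"
    have "(\<lambda>s. indicator A (step t (z, s)) :: ennreal) \<in> borel_measurable (stream_space P)"
      using measurable_compose_Pair1[OF z m] by simp
    then show "(\<integral>\<^sup>+s. indicator A (step t (z, s)) \<partial>stream_space P) =
        (\<integral>\<^sup>+w. h (U t (snd z, w) (fst z), g t (snd z, w)) \<partial>P)"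
      by (subst nn_integral_stream_space) (simp_all add: h_def step_def)
  qed
  also have "\<dots> = (\<integral>\<^sup>+z. h z \<partial>mixture K)"
    by (rule nn_integral_mixture_step[OF t K_measurable K_equivariant_AE[OF t] h])
  also have "\<dots> = emeasure path_measure A"
    using A by (simp add: h_def path_measure_def SP.emeasure_pair_measure)
  finally show "emeasure (distr path_measure path_measure (step t)) A = emeasure path_measure A" .
qed simp

lemma step_funpow_invariant:
  assumes t: "0 \<le> t"
  shows "distr path_measure path_measure (step t ^^ k) = path_measure"
proof (induction k)
  case 0
  show ?case by (simp add: id_def)
next
  case (Suc k)
  note [measurable] = step_measurable[OF t]
  have "distr path_measure path_measure (step t ^^ Suc k) =
      distr (distr path_measure path_measure (step t ^^ k)) path_measure (step t)"
    by (subst distr_distr) simp_all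
  then show ?case by (simp only: Suc step_invariant[OF t])
qed

end

section \<open>Atoms from contraction\<close>

text \<open>The points violating this are covered by balls of half the radius around points of a
  countable dense set. Each ball used lies in a null ball of radius r, so the cover is null.\<close>

lemma AE_emeasure_cball_pos:
  fixes \<kappa> :: "'x::euclidean_space measure"
  assumes \<kappa>: "sets \<kappa> = sets borel" and r: "0 < r"
  shows "AE x in \<kappa>. 0 < emeasure \<kappa> (cball x r)"
proof -
  obtain D :: "'x set" where D: "countable D" "\<And>X. open X \<Longrightarrow> X \<noteq> {} \<Longrightarrow> \<exists>d\<in>D. d \<in> X"
    using countable_dense_exists by metis
  define D0 where "D0 = {d\<in>D. emeasure \<kappa> (ball d (r/2)) = 0}"
  have "countable D0" using D(1) unfolding D0_def by simp
  moreover have "ball d (r/2) \<in> null_sets \<kappa>" if "d \<in> D0" for d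
    using that \<kappa> by (simp add: D0_def null_sets_def)
  ultimately have "(\<Union>d\<in>D0. ball d (r/2)) \<in> null_sets \<kappa>" by (rule null_sets_UN')
  then show ?thesis
  proof (rule AE_I', intro subsetI)
    fix x assume "x \<in> {x \<in> space \<kappa>. \<not> 0 < emeasure \<kappa> (cball x r)}"
    then have x: "emeasure \<kappa> (cball x r) = 0" by simp
    obtain d where d: "d \<in> D" "d \<in> ball x (r/2)" using D(2)[of "ball x (r/2)"] r by auto
    have "ball d (r/2) \<subseteq> cball x r"
    proof
      fix y assume "y \<in> ball d (r/2)"
      then have "dist x y < r" using d(2) dist_triangle_half_r[of d x r y] by (simp add: dist_commute)
      then show "y \<in> cball x r" by simp
    qed
    then have "emeasure \<kappa> (ball d (r/2)) \<le> emeasure \<kappa> (cball x r)" using \<kappa> by (intro emeasure_mono) auto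
    then have "d \<in> D0" using d x by (simp add: D0_def)
    moreover have "x \<in> ball d (r/2)" using d by (simp add: dist_commute)
    ultimately show "x \<in> (\<Union>d\<in>D0. ball d (r/2))" by blast
  qed
qed

context random_flow
begin

text \<open>At radius 0 the closed ball is a single point, so \<open>ball_mass 0\<close> is the mass
  of the atom at that point.\<close>

definition ball_mass :: "real \<Rightarrow> 'x \<times> 'w \<Rightarrow> ennreal" where
  "ball_mass r z = emeasure (K (snd z)) (cball (fst z) r)"

lemma ball_mass_measurable [measurable]: "ball_mass r \<in> borel_measurable (borel \<Otimes>\<^sub>M P)"
proof -
  have "{p \<in> space ((borel \<Otimes>\<^sub>M P) \<Otimes>\<^sub>M borel). dist (fst (fst p)) (snd p) \<le> r} \<in> sets ((borel \<Otimes>\<^sub>M P) \<Otimes>\<^sub>M (borel :: 'x measure))"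
    by measurable
  also have "{p \<in> space ((borel \<Otimes>\<^sub>M P) \<Otimes>\<^sub>M borel). dist (fst (fst p)) (snd p) \<le> r} =
      (SIGMA z:space (borel \<Otimes>\<^sub>M P). cball (fst z) r)"
    by (auto simp: space_pair_measure)
  finally show ?thesis unfolding ball_mass_def
    by (rule emeasure_measurable_subprob_algebra2)
      (use measurable_prob_algebraD[OF K_measurable] in measurable)
qed

lemma AE_mixtureI:
  assumes \<rho>: "\<rho> \<in> measurable P (prob_algebra borel)"
    and Q: "{z \<in> space (borel \<Otimes>\<^sub>M P). Q z} \<in> sets (borel \<Otimes>\<^sub>M P)"
    and ae: "\<And>\<omega>. \<omega> \<in> space P \<Longrightarrow> AE x in \<rho> \<omega>. Q (x, \<omega>)"
  shows "AE z in mixture \<rho>. Q z"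
proof -
  define N where "N = {z \<in> space (borel \<Otimes>\<^sub>M P). \<not> Q z}"
  have N: "N \<in> sets (borel \<Otimes>\<^sub>M P)" unfolding N_def using Q by (rule sets.sets_Collect_neg)
  have "emeasure (\<rho> \<omega>) {x. (x, \<omega>) \<in> N} = 0" if \<omega>: "\<omega> \<in> space P" for \<omega>
  proof -
    have "{x. (x, \<omega>) \<in> N} \<in> sets (\<rho> \<omega>)"
      using sets_Pair2[OF N, of \<omega>] kernel_space(2)[OF \<rho> \<omega>] by (simp add: vimage_def)
    moreover have "{x. (x, \<omega>) \<in> N} = {x \<in> space (\<rho> \<omega>). \<not> Q (x, \<omega>)}"
      using \<omega> kernel_space(3)[OF \<rho> \<omega>] by (auto simp: N_def space_pair_measure)
    ultimately show ?thesis using ae[OF \<omega>] by (simp add: AE_iff_measurable[OF _ refl])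
  qed
  then have "emeasure (mixture \<rho>) N = 0"
    unfolding emeasure_mixture[OF \<rho> N] by (simp add: nn_integral_0_iff_AE cong: nn_integral_cong)
  moreover have "{z \<in> space (mixture \<rho>). \<not> Q z} = N"
    using sets_eq_imp_space_eq[OF sets_mixture[OF \<rho>]] by (simp add: N_def)
  ultimately show ?thesis using N sets_mixture[OF \<rho>] by (intro AE_I[of _ _ N]) auto
qed

section \<open>Contraction along trajectories\<close>

primrec noise :: "real \<Rightarrow> nat \<Rightarrow> 'w \<Rightarrow> 'w stream \<Rightarrow> 'w" where
  "noise t 0 \<omega> s = \<omega>"
| "noise t (Suc k) \<omega> s = g t (noise t k \<omega> s, s !! k)"

primrec orbit :: "real \<Rightarrow> nat \<Rightarrow> 'w \<Rightarrow> 'w stream \<Rightarrow> 'x \<Rightarrow> 'x" where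
  "orbit t 0 \<omega> s x = x"
| "orbit t (Suc k) \<omega> s x = U t (noise t k \<omega> s, s !! k) (orbit t k \<omega> s x)"

lemma step_funpow: "(step t ^^ k) ((x, \<omega>), s) = ((orbit t k \<omega> s x, noise t k \<omega> s), sdrop k s)"
  by (induction k) (simp_all add: step_def)

lemma noise_space:
  assumes "0 \<le> t" "\<omega> \<in> space P" "s \<in> space (stream_space P)"
  shows "noise t k \<omega> s \<in> space P" "(noise t k \<omega> s, s !! k) \<in> space (P \<Otimes>\<^sub>M P)"
proof -
  have s: "s !! k \<in> space P" for k using assms(3) by (simp add: space_stream_space streams_iff_snth)
  show *: "noise t k \<omega> s \<in> space P"
  proof (induction k)
    case (Suc k)
    then have "(noise t k \<omega> s, s !! k) \<in> space (P \<Otimes>\<^sub>M P)" using s by (simp add: space_pair_measure)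
    then show ?case using measurable_space[OF g_measurable[OF assms(1)]] by simp
  qed (use assms in simp)
  show "(noise t k \<omega> s, s !! k) \<in> space (P \<Otimes>\<^sub>M P)" using * s by (simp add: space_pair_measure)
qed

lemma orbit_kernel:
  assumes "0 \<le> t" "\<omega> \<in> space P" "s \<in> space (stream_space P)"
  shows "orbit t k \<omega> s \<in> borel_measurable borel" "distr (K \<omega>) borel (orbit t k \<omega> s) = K (noise t k \<omega> s)"
proof (induction k)
  case 0
  note kernel_space(2)[OF K_measurable assms(2)]
  { case 1 show ?case by (simp add: id_def[symmetric] cong: measurable_cong) }
  { case 2 show ?case using kernel_space(2)[OF K_measurable assms(2)] by (simp add: distr_id2) }
next
  case (Suc k)
  have m: "U t (noise t k \<omega> s, s !! k) \<in> borel_measurable borel"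
    using noise_space[OF assms] by (intro U_measurable1[OF assms(1)])
  note mK = kernel_space(2)[OF K_measurable assms(2), measurable_cong]
  { case 1 show ?case using measurable_compose[OF Suc(1) m] by simp }
  { case 2
    have "orbit t (Suc k) \<omega> s = U t (noise t k \<omega> s, s !! k) \<circ> orbit t k \<omega> s" by (simp add: fun_eq_iff)
    then have "distr (K \<omega>) borel (orbit t (Suc k) \<omega> s) =
        distr (distr (K \<omega>) borel (orbit t k \<omega> s)) borel (U t (noise t k \<omega> s, s !! k))"
      using m Suc(1) by (subst distr_distr) auto
    also have "\<dots> = K (noise t (Suc k) \<omega> s)"
      using K_equivariant[OF assms(1) noise_space(2)[OF assms, of k]] by (simp add: Suc(2))
    finally show ?case . }
qed

text \<open>The logarithmic factors are read along the reference orbit of x alone. As long as their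
  partial sums are nonpositive, the displacement never outgrows its initial norm, stays inside
  radius r, and the one-step bound can be used again. The margin a in every summand becomes the
  exponential rate.\<close>

lemma orbit_contraction:
  assumes t: "0 \<le> t" "\<omega> \<in> space P" "s \<in> space (stream_space P)"
    and bound: "\<And>x \<omega> w h. \<omega> \<in> space P \<Longrightarrow> w \<in> space P \<Longrightarrow> norm h < r \<Longrightarrow>
      norm (U t (\<omega>, w) (x + h) - U t (\<omega>, w) x) \<le> exp (f ((x, \<omega>), w)) * norm h"
    and a: "0 \<le> a"
    and sums: "\<And>n. (\<Sum>k<n. f (fst ((step t ^^ k) ((x, \<omega>), s)), shd (snd ((step t ^^ k) ((x, \<omega>), s)))) + a) \<le> 0"
    and h: "norm h < r"
  shows "norm (orbit t k \<omega> s (x + h) - orbit t k \<omega> s x) \<le> exp (- a * real k) * norm h"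
proof -
  define S where "S n = (\<Sum>k<n. f ((orbit t k \<omega> s x, noise t k \<omega> s), s !! k))" for n
  have S: "S n \<le> - a * real n" for n
    using sums[of n] by (simp add: step_funpow sum.distrib S_def algebra_simps)
  have "norm (orbit t k \<omega> s (x + h) - orbit t k \<omega> s x) \<le> exp (S k) * norm h"
  proof (induction k)
    case (Suc k)
    define h' where "h' = orbit t k \<omega> s (x + h) - orbit t k \<omega> s x"
    have "norm h' \<le> exp (S k) * norm h" using Suc by (simp add: h'_def)
    also have "\<dots> \<le> 1 * norm h"
      using order_trans[OF S, of k 0] a by (intro mult_right_mono) auto
    finally have "norm h' < r" using h by simp
    then have "norm (U t (noise t k \<omega> s, s !! k) (orbit t k \<omega> s x + h') - U t (noise t k \<omega> s, s !! k) (orbit t k \<omega> s x))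
        \<le> exp (f ((orbit t k \<omega> s x, noise t k \<omega> s), s !! k)) * norm h'"
      using noise_space[OF t, of k] by (intro bound) (auto simp: space_pair_measure)
    also have "\<dots> \<le> exp (f ((orbit t k \<omega> s x, noise t k \<omega> s), s !! k)) * (exp (S k) * norm h)"
      using Suc by (intro mult_left_mono) (simp_all add: h'_def)
    also have "\<dots> = exp (S (Suc k)) * norm h" by (simp add: S_def exp_add)
    finally show ?case by (simp add: h'_def)
  qed (simp add: S_def)
  also have "\<dots> \<le> exp (- a * real k) * norm h" using S by (intro mult_right_mono) auto
  finally show ?thesis .
qed

lemma distr_path_measure_first:
  "distr path_measure (mixture K \<Otimes>\<^sub>M P) (\<lambda>u. (fst u, shd (snd u))) = mixture K \<Otimes>\<^sub>M P"
proof (rule measure_eqI)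
  fix A assume "A \<in> sets (distr path_measure (mixture K \<Otimes>\<^sub>M P) (\<lambda>u. (fst u, shd (snd u))))"
  then have [measurable]: "A \<in> sets (mixture K \<Otimes>\<^sub>M P)" by simp
  have m: "(\<lambda>u. (fst u, shd (snd u))) \<in> measurable (mixture K \<Otimes>\<^sub>M stream_space P) (mixture K \<Otimes>\<^sub>M P)"
    by measurable
  have mA: "(\<lambda>u. indicator A (fst u, shd (snd u)) :: ennreal) \<in> borel_measurable (mixture K \<Otimes>\<^sub>M stream_space P)"
    by measurable
  have "emeasure (distr path_measure (mixture K \<Otimes>\<^sub>M P) (\<lambda>u. (fst u, shd (snd u)))) A =
      (\<integral>\<^sup>+u. indicator A (fst u, shd (snd u)) \<partial>path_measure)"
    using nn_integral_distr[OF m, of "indicator A"] by (simp add: path_measure_def)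
  also have "\<dots> = (\<integral>\<^sup>+z. \<integral>\<^sup>+s. indicator A (z, shd s) \<partial>stream_space P \<partial>mixture K)"
    using SP.nn_integral_fst[OF mA] by (simp add: path_measure_def)
  also have "\<dots> = (\<integral>\<^sup>+z. \<integral>\<^sup>+w. indicator A (z, w) \<partial>P \<partial>mixture K)"
  proof (rule nn_integral_cong)
    fix z assume "z \<in> space (mixture K)"
    then have "(\<lambda>s. indicator A (z, shd s) :: ennreal) \<in> borel_measurable (stream_space P)"
      using measurable_compose_Pair1[OF _ mA] by simp
    then show "(\<integral>\<^sup>+s. indicator A (z, shd s) \<partial>stream_space P) = (\<integral>\<^sup>+w. indicator A (z, w) \<partial>P)"
      by (subst nn_integral_stream_space) (simp_all add: SP.emeasure_space_1)
  qed
  also have "\<dots> = emeasure (mixture K \<Otimes>\<^sub>M P) A" by (simp add: emeasure_pair_measure)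
  finally show "emeasure (distr path_measure (mixture K \<Otimes>\<^sub>M P) (\<lambda>u. (fst u, shd (snd u)))) A =
    emeasure (mixture K \<Otimes>\<^sub>M P) A" .
qed simp

text \<open>
  Along a trajectory whose Birkhoff sums stay negative, a ball of fixed radius is carried into balls of
  radius tending to 0 without loss of mass. By stationarity, atoms of a fixed mass therefore
  already exist with positive probability.
\<close>

lemma positive_atom_probability:
  assumes t: "0 \<le> t" and r: "0 < r"
    and f[measurable]: "f \<in> borel_measurable ((borel \<Otimes>\<^sub>M P) \<Otimes>\<^sub>M P)"
    and f_bounded: "\<And>z. z \<in> space ((borel \<Otimes>\<^sub>M P) \<Otimes>\<^sub>M P) \<Longrightarrow> \<bar>f z\<bar> \<le> B"
    and neg: "(\<integral>z. f z \<partial>(mixture K \<Otimes>\<^sub>M P)) < 0"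
    and bound: "\<And>x \<omega> w h. \<omega> \<in> space P \<Longrightarrow> w \<in> space P \<Longrightarrow> norm h < r \<Longrightarrow>
      norm (U t (\<omega>, w) (x + h) - U t (\<omega>, w) x) \<le> exp (f ((x, \<omega>), w)) * norm h"
  shows "\<exists>\<delta>>0. 0 < emeasure (mixture K) {z \<in> space (mixture K). ennreal \<delta> \<le> ball_mass 0 z}"
proof -
  note cong[measurable_cong] = sets_mixture[OF K_measurable]
  note [measurable] = step_measurable[OF t]
  have space_mix: "space (mixture K) = UNIV \<times> space P"
    using sets_eq_imp_space_eq[OF sets_mixture[OF K_measurable]] by (simp add: space_pair_measure)
  have space_path: "space path_measure = (UNIV \<times> space P) \<times> space (stream_space P)"
    by (simp add: path_measure_def space_pair_measure space_mix)
  \<comment> \<open>Half of the negative mean: the shifted function F keeps a negative mean while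
    the margin a is positive.\<close>
  define a where "a = - (\<integral>z. f z \<partial>(mixture K \<Otimes>\<^sub>M P)) / 2"
  have a: "0 < a" using neg by (simp add: a_def)
  define F where "F u = f (fst u, shd (snd u)) + a" for u
  have Fm[measurable]: "F \<in> borel_measurable path_measure" unfolding F_def by measurable
  interpret M: pair_prob_space "mixture K" P ..
  have fi: "integrable (mixture K \<Otimes>\<^sub>M P) f"
    using f_bounded by (intro M.integrable_const_bound[of _ B] AE_I2) (auto simp: space_pair_measure space_mix)
  have mf: "(\<lambda>u. (fst u, shd (snd u))) \<in> measurable path_measure (mixture K \<Otimes>\<^sub>M P)"
    unfolding path_measure_def by measurable
  have Fi: "integrable path_measure (\<lambda>u. f (fst u, shd (snd u)))"
    using fi integrable_distr_eq[OF mf, of f] by (simp add: distr_path_measure_first)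
  have "(\<integral>u. f (fst u, shd (snd u)) \<partial>path_measure) = (\<integral>z. f z \<partial>(mixture K \<Otimes>\<^sub>M P))"
    using integral_distr[OF mf, of f] by (simp add: distr_path_measure_first)
  then have "(\<integral>u. F u \<partial>path_measure) < 0"
    using Fi neg by (simp add: F_def PM.prob_space a_def)
  moreover have "integrable path_measure F" unfolding F_def using Fi by simp
  moreover define E where "E = {u\<in>space path_measure. \<forall>n. (\<Sum>k<n. F ((step t ^^ k) u)) \<le> 0}"
  ultimately have pos: "0 < emeasure path_measure E" unfolding E_def
    by (intro PM.birkhoff_sums_nonpos_positive_measure step_measurable[OF t] step_invariant[OF t])
  have stepk[measurable]: "(step t ^^ k) \<in> measurable path_measure path_measure" for k
    by (rule measurable_compose_n) measurable
  have E[measurable]: "E \<in> sets path_measure" unfolding E_def by measurable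
  have fst_m[measurable]: "fst \<in> measurable path_measure (borel \<Otimes>\<^sub>M P)" by measurable
  \<comment> \<open>Radius r / 2 puts the closed ball inside the open radius r on which the one-step
    bound holds.\<close>
  have "AE z in mixture K. 0 < ball_mass (r/2) z"
  proof (rule AE_mixtureI[OF K_measurable])
    show "{z \<in> space (borel \<Otimes>\<^sub>M P). 0 < ball_mass (r/2) z} \<in> sets (borel \<Otimes>\<^sub>M P)" by measurable
    show "AE x in K \<omega>. 0 < ball_mass (r/2) (x, \<omega>)" if "\<omega> \<in> space P" for \<omega>
      using AE_emeasure_cball_pos[OF kernel_space(2)[OF K_measurable that], of "r/2"] r by (simp add: ball_mass_def)
  qed
  then have aepos: "AE u in path_measure. 0 < ball_mass (r/2) (fst u)"
  proof -
    interpret pair_prob_space "mixture K" "stream_space P" ..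
    assume "AE z in mixture K. 0 < ball_mass (r/2) z"
    then show ?thesis unfolding path_measure_def by (intro AE_pair_measure) auto
  qed
  \<comment> \<open>The mass of the initial ball is positive but not bounded below on E. The levels
    1 / (i + 1) exhaust E up to a null set, so one of them keeps positive measure and supplies
    \<delta>.\<close>
  define G where "G i = {u \<in> E. ennreal (1 / Suc i) \<le> ball_mass (r/2) (fst u)}" for i :: nat
  have Gm[measurable]: "G i \<in> sets path_measure" for i
  proof -
    have "G i = E \<inter> {u \<in> space path_measure. ennreal (1 / Suc i) \<le> ball_mass (r/2) (fst u)}"
      using sets.sets_into_space[OF E] unfolding G_def by blast
    also have "\<dots> \<in> sets path_measure" by measurable
    finally show ?thesis .
  qed
  have "\<exists>i. 0 < emeasure path_measure (G i)"
  proof (rule ccontr)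
    assume "\<nexists>i. 0 < emeasure path_measure (G i)"
    then have "(\<Union>i. G i) \<in> null_sets path_measure" by (intro null_sets_UN) (auto simp: null_sets_def)
    then have "AE u in path_measure. u \<notin> (\<Union>i. G i)" by (rule AE_not_in)
    with aepos have "AE u in path_measure. u \<notin> E"
    proof eventually_elim
      case (elim u)
      show ?case
      proof
        assume u: "u \<in> E"
        obtain i :: nat where i: "ennreal (1 / Suc i) \<le> ball_mass (r/2) (fst u)"
        proof (cases "ball_mass (r/2) (fst u)")
          case (real b)
          then have "0 < b" using elim by simp
          then obtain i :: nat where "inverse (real (Suc i)) < b" using reals_Archimedean by blast
          then have "1 / real (Suc i) \<le> b" by (simp add: inverse_eq_divide)
          then show ?thesis using that[of i] real(2) ennreal_leI by metis
        next
          case top then show ?thesis using that[of 0] by simp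
        qed
        then have "u \<in> G i" using u by (simp add: G_def)
        then show False using elim by blast
      qed
    qed
    then have "emeasure path_measure E = 0" using E by (subst (asm) AE_iff_measurable[of E]) (auto simp: E_def)
    then show False using pos by simp
  qed
  then obtain i where i: "0 < emeasure path_measure (G i)" by blast
  define \<delta> where "\<delta> = 1 / real (Suc i)"
  define A where "A e = {z \<in> space (mixture K). ennreal \<delta> \<le> ball_mass e z}" for e
  have Am[measurable]: "A e \<in> sets (mixture K)" for e unfolding A_def by measurable
  \<comment> \<open>The number k of steps depends on e, but the bound does not: \<open>G i\<close>
    lies in the preimage of the event for radius e under k steps, and stationarity removes
    k.\<close>
  have lower: "emeasure path_measure (G i) \<le> emeasure (mixture K) (A e)" if e: "0 < e" for e
  proof -
    have "(\<lambda>k. exp (- a) ^ k) \<longlonglongrightarrow> 0" using a by (intro LIMSEQ_realpow_zero) auto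
    then have "eventually (\<lambda>k. exp (- a) ^ k < e / r) sequentially" using e r by (intro order_tendstoD) auto
    then obtain k where "exp (- a) ^ k < e / r" by (auto simp: eventually_sequentially)
    then have k: "exp (- a * real k) * r < e" using r by (simp add: pos_less_divide_eq exp_of_nat_mult[symmetric] mult.commute[of a])
    have sub: "G i \<subseteq> (step t ^^ k) -` (A e \<times> space (stream_space P)) \<inter> space path_measure"
    proof
      fix u assume u: "u \<in> G i"
      obtain x \<omega> s where us: "u = ((x, \<omega>), s)" by (metis surj_pair)
      have uE: "u \<in> E" "ennreal \<delta> \<le> ball_mass (r/2) (x, \<omega>)" using u by (auto simp: G_def \<delta>_def us)
      then have sp: "\<omega> \<in> space P" "s \<in> space (stream_space P)" by (auto simp: us space_path E_def)
      let ?\<omega> = "noise t k \<omega> s" and ?X = "orbit t k \<omega> s"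
      have near: "?X -` cball (?X x) e \<supseteq> cball x (r/2)"
      proof
        fix y assume "y \<in> cball x (r/2)"
        then have y: "norm (y - x) < r" using r by (simp add: dist_norm norm_minus_commute)
        have "norm (?X (x + (y - x)) - ?X x) \<le> exp (- a * real k) * norm (y - x)"
          using uE(1) y a by (intro orbit_contraction[OF t sp bound]) (auto simp: us F_def E_def)
        also have "\<dots> \<le> exp (- a * real k) * r" using y by (intro mult_left_mono) auto
        finally show "y \<in> ?X -` cball (?X x) e" using k by (simp add: dist_norm norm_minus_commute)
      qed
      have "ball_mass (r/2) (x, \<omega>) \<le> emeasure (K \<omega>) (?X -` cball (?X x) e \<inter> space (K \<omega>))"
        unfolding ball_mass_def fst_conv snd_conv using near kernel_space(2,3)[OF K_measurable sp(1)]
          measurable_sets[OF orbit_kernel(1)[OF t sp, of k], of "cball (?X x) e"]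
        by (intro emeasure_mono) auto
      also have "\<dots> = emeasure (distr (K \<omega>) borel ?X) (cball (?X x) e)"
        using kernel_space(2)[OF K_measurable sp(1)] orbit_kernel(1)[OF t sp, of k]
        by (subst emeasure_distr) (auto cong: measurable_cong_sets)
      also have "\<dots> = ball_mass e (?X x, ?\<omega>)" by (simp add: orbit_kernel(2)[OF t sp] ball_mass_def)
      finally have "ennreal \<delta> \<le> ball_mass e (?X x, ?\<omega>)" using uE(2) by order
      moreover have "sdrop k s \<in> space (stream_space P)"
        using sp(2) by (auto simp: space_stream_space streams_iff_snth sdrop_snth)
      ultimately show "u \<in> (step t ^^ k) -` (A e \<times> space (stream_space P)) \<inter> space path_measure"
        using noise_space(1)[OF t sp] sp by (simp add: us step_funpow A_def space_mix space_path)
    qed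
    have AS: "A e \<times> space (stream_space P) \<in> sets path_measure" unfolding path_measure_def by measurable
    have "emeasure path_measure (G i) \<le> emeasure path_measure ((step t ^^ k) -` (A e \<times> space (stream_space P)) \<inter> space path_measure)"
      by (intro emeasure_mono sub measurable_sets[OF stepk AS])
    also have "\<dots> = emeasure (distr path_measure path_measure (step t ^^ k)) (A e \<times> space (stream_space P))"
      by (rule emeasure_distr[OF stepk AS, symmetric])
    also have "\<dots> = emeasure path_measure (A e \<times> space (stream_space P))" by (simp add: step_funpow_invariant[OF t])
    also have "\<dots> = emeasure (mixture K) (A e)"
      unfolding path_measure_def by (subst SP.emeasure_pair_measure_Times) (simp_all add: SP.emeasure_space_1)
    finally show ?thesis .
  qed
  have radius: "1 / real (Suc (Suc n)) \<le> 1 / real (Suc n)" for n by (intro divide_left_mono) auto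
  have dec: "decseq (\<lambda>n. A (1 / real (Suc n)))"
  proof (rule decseq_SucI, rule subsetI)
    fix n z assume "z \<in> A (1 / real (Suc (Suc n)))"
    then have z: "z \<in> space (mixture K)" "ennreal \<delta> \<le> ball_mass (1 / real (Suc (Suc n))) z"
      by (simp_all only: A_def mem_Collect_eq)
    then have "snd z \<in> space P" by (auto simp: space_mix)
    have "ball_mass (1 / real (Suc (Suc n))) z \<le> ball_mass (1 / real (Suc n)) z"
      unfolding ball_mass_def kernel_space(2)[OF K_measurable \<open>snd z \<in> space P\<close>]
      by (intro emeasure_mono subset_cball radius)
        (simp add: kernel_space(2)[OF K_measurable \<open>snd z \<in> space P\<close>])
    with z show "z \<in> A (1 / real (Suc n))"
      unfolding A_def mem_Collect_eq by (blast intro: order_trans)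
  qed
  \<comment> \<open>Continuity from above of the fibre measure: mass at least \<delta> on all
    shrinking closed balls is mass at least \<delta> at their centre.\<close>
  have "(\<Inter>n. A (1 / real (Suc n))) \<subseteq> A 0"
  proof
    fix z assume z: "z \<in> (\<Inter>n. A (1 / real (Suc n)))"
    then have "z \<in> A (1 / real (Suc 0))" by (rule INT_D) simp
    then have zs: "z \<in> space (mixture K)" unfolding A_def by blast
    then have \<omega>: "snd z \<in> space P" by (auto simp: space_mix)
    define C where "C n = cball (fst z) (1 / real (Suc n))" for n
    have "range C \<subseteq> sets (K (snd z))"
      unfolding kernel_space(2)[OF K_measurable \<omega>] by (simp add: C_def image_subset_iff)
    moreover have "decseq C" unfolding C_def by (intro decseq_SucI subset_cball radius)
    moreover have "emeasure (K (snd z)) (C n) \<noteq> \<infinity>" for n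
      using finite_measure.emeasure_finite[OF prob_space.finite_measure[OF kernel_space(1)[OF K_measurable \<omega>]]]
      unfolding infinity_ennreal_def .
    ultimately have "(\<lambda>n. emeasure (K (snd z)) (C n)) \<longlonglongrightarrow> emeasure (K (snd z)) (\<Inter>n. C n)"
      by (rule Lim_emeasure_decseq)
    moreover have "(\<Inter>n. C n) = cball (fst z) 0"
    proof (intro equalityI subsetI)
      fix y assume y: "y \<in> (\<Inter>n. C n)"
      have "dist (fst z) y \<le> 0"
      proof (rule ccontr)
        assume "\<not> dist (fst z) y \<le> 0"
        then obtain n :: nat where "inverse (real (Suc n)) < dist (fst z) y" using reals_Archimedean by (metis not_le)
        moreover have "dist (fst z) y \<le> 1 / real (Suc n)" using INT_D[OF y, of n] by (simp add: C_def del: of_nat_Suc)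
        ultimately show False by (simp add: inverse_eq_divide del: of_nat_Suc)
      qed
      then show "y \<in> cball (fst z) 0" by simp
    qed (auto simp: C_def)
    ultimately have "(\<lambda>n. emeasure (K (snd z)) (C n)) \<longlonglongrightarrow> emeasure (K (snd z)) (cball (fst z) 0)"
      by simp
    moreover have "ennreal \<delta> \<le> emeasure (K (snd z)) (C n)" for n
    proof -
      have "z \<in> A (1 / real (Suc n))" using z by blast
      then show ?thesis unfolding A_def ball_mass_def C_def by blast
    qed
    ultimately have "ennreal \<delta> \<le> emeasure (K (snd z)) (cball (fst z) 0)"
      by (metis LIMSEQ_le_const)
    then show "z \<in> A 0" using zs by (simp add: A_def ball_mass_def)
  qed
  then have "emeasure (mixture K) (\<Inter>n. A (1 / real (Suc n))) \<le> emeasure (mixture K) (A 0)"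
    by (intro emeasure_mono) auto
  moreover have "emeasure path_measure (G i) \<le> emeasure (mixture K) (\<Inter>n. A (1 / real (Suc n)))"
  proof -
    have "(\<lambda>n. emeasure (mixture K) (A (1 / real (Suc n)))) \<longlonglongrightarrow>
        emeasure (mixture K) (\<Inter>n. A (1 / real (Suc n)))"
      using Am by (intro Lim_emeasure_decseq[OF _ dec]) (simp_all add: image_subset_iff)
    moreover have "emeasure path_measure (G i) \<le> emeasure (mixture K) (A (1 / real (Suc n)))" for n
      by (rule lower) simp
    ultimately show ?thesis by (metis LIMSEQ_le_const)
  qed
  ultimately have "0 < emeasure (mixture K) (A 0)" using i by order
  then show ?thesis by (intro exI[of _ \<delta>]) (simp add: A_def \<delta>_def)
qed

end

text \<open>Continuity of measure is used twice: first in the time after which the condition holds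
  at every n, then in j at one such n. The bound n \<ge> 1 excludes a step of length zero.\<close>

lemma eventually_good_set:
  assumes A: "\<And>n j::nat. A n j \<in> sets M" and M: "prob_space M"
    and mono: "\<And>n. incseq (A n)"
    and ev: "AE z in M. \<forall>\<^sub>F n in sequentially. \<exists>j. z \<in> A n j" and p: "p < (1::real)"
  shows "\<exists>n\<ge>1. \<exists>j. p < measure M (A n j)"
proof -
  interpret M: prob_space M by (rule M)
  define B where "B m = {z \<in> space M. \<forall>n\<ge>m. \<exists>j. z \<in> A n j}" for m
  note A[measurable]
  have [measurable]: "B m \<in> sets M" for m unfolding B_def by measurable
  have "incseq B" by (auto simp: B_def incseq_def)
  then have "(\<lambda>m. measure M (B m)) \<longlonglongrightarrow> measure M (\<Union>m. B m)"
    by (intro M.finite_Lim_measure_incseq) auto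
  moreover have "measure M (\<Union>m. B m) = 1"
    using ev by (subst M.prob_eq_1) (auto simp: B_def eventually_sequentially elim: AE_mp)
  ultimately have "eventually (\<lambda>m. p < measure M (B m)) sequentially" using p by (simp add: order_tendstoD(1))
  then obtain m where m: "m \<ge> 1" "p < measure M (B m)"
    using eventually_conj[OF _ eventually_ge_at_top[of 1]] eventually_happens'[OF sequentially_bot] by (metis (mono_tags, lifting))
  have "measure M (B m) \<le> measure M (\<Union>j. A m j)"
    using A by (intro M.finite_measure_mono) (auto simp: B_def)
  then have "p < measure M (\<Union>j. A m j)" using m(2) by simp
  moreover have "(\<lambda>j. measure M (A m j)) \<longlonglongrightarrow> measure M (\<Union>j. A m j)"
    using A mono by (intro M.finite_Lim_measure_incseq) auto
  ultimately have "eventually (\<lambda>j. p < measure M (A m j)) sequentially"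
    by (metis order_tendstoD(1))
  then show ?thesis using m(1) by (auto simp: eventually_sequentially)
qed

section \<open>From the exponent to a negative mean\<close>

context random_flow
begin

text \<open>The radius d may depend on the point, the noise and n. This is all that
  differentiability at a point gives; a uniform radius is extracted afterwards at the cost of a set
  of small probability.\<close>

definition contracts_at_rate :: "real \<Rightarrow> bool" where
  "contracts_at_rate c \<longleftrightarrow> (AE z in mixture K \<Otimes>\<^sub>M P. \<forall>\<^sub>F n in sequentially.
    \<exists>a\<le>exp (- c * real n). \<exists>d>0. \<forall>h. norm h < d \<longrightarrow>
      norm (U (real n) (snd (fst z), snd z) (fst (fst z) + h)
        - U (real n) (snd (fst z), snd z) (fst (fst z))) \<le> a * norm h)"

text \<open>The derivative is replaced by the Lipschitz quotient over radius 1 / (j + 1). Its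
  logarithm f is at most C n everywhere and equals -c n on the good set \<open>A n j\<close>, so the
  mean is at most n times \<open>C - (C + c) * prob\<close>. This is negative once the good set is
  large enough, which holds for suitable n and j.\<close>

lemma positive_atom_probability_of_negative_exponent:
  fixes C c :: real
  assumes C: "0 \<le> C" and c: "0 < c"
    and lip: "\<And>n \<omega> x y. \<omega> \<in> space (P \<Otimes>\<^sub>M P) \<Longrightarrow>
      norm (U (real n) \<omega> y - U (real n) \<omega> x) \<le> exp (C * real n) * norm (y - x)"
    and exponent: "contracts_at_rate c"
  shows "\<exists>\<delta>>0. 0 < emeasure (mixture K) {z \<in> space (mixture K). ennreal \<delta> \<le> ball_mass 0 z}"
proof -
  note [measurable_cong] = sets_mixture[OF K_measurable]
  have space_mix: "space (mixture K) = UNIV \<times> space P"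
    using sets_eq_imp_space_eq[OF sets_mixture[OF K_measurable]] by (simp add: space_pair_measure)
  let ?M = "(borel \<Otimes>\<^sub>M P) \<Otimes>\<^sub>M P :: (('x \<times> 'w) \<times> 'w) measure"
  interpret M: pair_prob_space "mixture K" P ..
  have sets_M: "sets (mixture K \<Otimes>\<^sub>M P) = sets ?M"
    by (intro sets_pair_measure_cong sets_mixture K_measurable refl)
  have space_M: "space (mixture K \<Otimes>\<^sub>M P) = (UNIV \<times> space P) \<times> space P" by (simp add: space_pair_measure space_mix)
  obtain D :: "'x set" where D: "countable D" "\<And>X. open X \<Longrightarrow> X \<noteq> {} \<Longrightarrow> \<exists>d\<in>D. d \<in> X"
    using countable_dense_exists by metis
  \<comment> \<open>A countable set of displacements keeps the supremum of the quotients measurable;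
    0 is removed because the quotient is meaningless there.\<close>
  define Dj where "Dj j = {h\<in>D. 0 < norm h \<and> norm h < 1 / real (Suc j)}" for j :: nat
  have Dj_countable: "countable (Dj j)" for j using D(1) by (simp add: Dj_def)
  have Dj_ne: "Dj j \<noteq> {}" for j
  proof -
    obtain v :: 'x where v: "norm v = 1 / (2 * real (Suc j))" using vector_choose_size[of "1 / (2 * real (Suc j))"] by auto
    have "v \<in> ball 0 (1 / real (Suc j)) - {0}"
    proof -
      have "norm v < 1 / real (Suc j)" "0 < norm v" unfolding v by (auto simp: frac_less2)
      then show ?thesis by auto
    qed
    then obtain d where "d \<in> D" "d \<in> ball 0 (1 / real (Suc j)) - {0}"
      using D(2)[of "ball 0 (1 / real (Suc j)) - {0}"] by (metis empty_iff open_ball open_delete)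
    then show ?thesis by (auto simp: Dj_def)
  qed
  define q where "q n h z = norm (U (real n) (snd (fst z), snd z) (fst (fst z) + h)
        - U (real n) (snd (fst z), snd z) (fst (fst z))) / norm h" for n h and z :: "('x \<times> 'w) \<times> 'w"
  have Um: "(\<lambda>z. U (real n) (snd (fst z), snd z) (fst (fst z) + h)) \<in> borel_measurable ?M" for n h
    using measurable_compose[of "\<lambda>z. (fst (fst z) + h, (snd (fst z), snd z))" ?M, OF _ U_measurable[of "real n"]]
    by simp
  have qm[measurable]: "q n h \<in> borel_measurable ?M" for n h
    unfolding q_def using Um[of n h] Um[of n 0] by simp
  have q_le: "q n h z \<le> exp (C * real n)" if "z \<in> space ?M" for n h z
  proof (cases "h = 0")
    case False
    have "(snd (fst z), snd z) \<in> space (P \<Otimes>\<^sub>M P)" using that by (auto simp: space_pair_measure)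
    from lip[OF this, of n "fst (fst z) + h" "fst (fst z)"] show ?thesis
      using False by (simp add: q_def pos_divide_le_eq)
  qed (simp add: q_def)
  have q_nonneg: "0 \<le> q n h z" for n h z by (simp add: q_def)
  define s where "s n j z = (SUP h\<in>Dj j. q n h z)" for n j z
  have bdd: "bdd_above ((\<lambda>h. q n h z) ` Dj j)" if "z \<in> space ?M" for n j z
    using q_le[OF that] by (intro bdd_aboveI2)
  have sm[measurable]: "s n j \<in> borel_measurable ?M" for n j
    unfolding s_def using bdd by (intro borel_measurable_cSUP Dj_countable qm)
  have s_le: "s n j z \<le> exp (C * real n)" if "z \<in> space ?M" for n j z
    unfolding s_def using q_le[OF that] by (intro cSUP_least Dj_ne)
  have q_s: "q n h z \<le> s n j z" if "z \<in> space ?M" "h \<in> Dj j" for n h j z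
    unfolding s_def using bdd[OF that(1)] that(2) by (intro cSUP_upper)
  \<comment> \<open>The truncation at exp (-c n) keeps the logarithm bounded below where the flow is
    locally constant or contracts faster.\<close>
  define f where "f n j z = ln (max (exp (- c * real n)) (s n j z))" for n j z
  have fm[measurable]: "f n j \<in> borel_measurable ?M" for n j unfolding f_def by measurable
  have f_exp: "exp (f n j z) = max (exp (- c * real n)) (s n j z)" for n j z
    unfolding f_def by (intro exp_ln) (simp add: less_max_iff_disj)
  have f_upper: "f n j z \<le> C * real n" if "z \<in> space ?M" for n j z
  proof -
    have "0 \<le> c * real n" "0 \<le> C * real n" using c C by simp_all
    then have "exp (- c * real n) \<le> exp (C * real n)" by simp
    then have "exp (f n j z) \<le> exp (C * real n)" unfolding f_exp using s_le[OF that] by simp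
    then show ?thesis by simp
  qed
  have f_lower: "- c * real n \<le> f n j z" for n j z
  proof -
    have "exp (- c * real n) \<le> exp (f n j z)" unfolding f_exp by simp
    then show ?thesis by simp
  qed
  have f_abs: "\<bar>f n j z\<bar> \<le> (C + c) * real n" if "z \<in> space ?M" for n j z
  proof -
    have "0 \<le> c * real n" "0 \<le> C * real n" using c C by simp_all
    then show ?thesis using f_upper[OF that, of n j] f_lower[of n j z]
      unfolding distrib_right by linarith
  qed
  define A where "A n j = {z \<in> space (mixture K \<Otimes>\<^sub>M P). s n j z \<le> exp (- c * real n)}" for n j
  have [measurable]: "A n j \<in> sets (mixture K \<Otimes>\<^sub>M P)" for n j
    unfolding A_def by measurable
  have f_good: "f n j z = - c * real n" if "z \<in> A n j" for n j z
  proof -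
    have "max (exp (- c * real n)) (s n j z) = exp (- c * real n)"
      using that by (intro max_absorb1) (simp add: A_def)
    then show ?thesis by (simp only: f_def ln_exp)
  qed
  have space_M': "space (mixture K \<Otimes>\<^sub>M P) = space ?M" by (rule sets_eq_imp_space_eq[OF sets_M])
  have radius: "1 / real (Suc (Suc n)) \<le> 1 / real (Suc n)" for n by (intro divide_left_mono) auto
  have inc: "incseq (A n)" for n
  proof (rule incseq_SucI, rule subsetI)
    fix j z assume z: "z \<in> A n j"
    then have zs: "z \<in> space ?M" by (simp add: A_def space_M')
    have "Dj (Suc j) \<subseteq> Dj j" using radius[of j] unfolding Dj_def by (auto intro: less_le_trans)
    then have "s n (Suc j) z \<le> s n j z"
      unfolding s_def using bdd[OF zs] by (intro cSUP_subset_mono Dj_ne) auto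
    then show "z \<in> A n (Suc j)" using z by (auto simp: A_def)
  qed
  have "AE z in mixture K \<Otimes>\<^sub>M P. \<forall>\<^sub>F n in sequentially. \<exists>j. z \<in> A n j"
    using exponent[unfolded contracts_at_rate_def] AE_space
  proof eventually_elim
    case (elim z)
    from elim(1) show ?case
    proof eventually_elim
      case (elim n)
      then obtain a d where ad: "a \<le> exp (- c * real n)" "d > 0" "\<And>h. norm h < d \<Longrightarrow>
        norm (U (real n) (snd (fst z), snd z) (fst (fst z) + h) - U (real n) (snd (fst z), snd z) (fst (fst z))) \<le> a * norm h"
        by blast
      obtain j :: nat where j: "inverse (real (Suc j)) < d" using reals_Archimedean ad(2) by blast
      have "s n j z \<le> exp (- c * real n)"
        unfolding s_def
      proof (rule cSUP_least[OF Dj_ne])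
        fix h assume "h \<in> Dj j"
        then have h: "0 < norm h" "norm h < d" using j by (auto simp: Dj_def inverse_eq_divide)
        have "q n h z \<le> a" using ad(3)[OF h(2)] h(1) by (simp add: q_def pos_divide_le_eq)
        then show "q n h z \<le> exp (- c * real n)" using ad(1) by simp
      qed
      then show "\<exists>j. z \<in> A n j" using \<open>z \<in> space (mixture K \<Otimes>\<^sub>M P)\<close> by (auto simp: A_def)
    qed
  qed
  \<comment> \<open>The threshold C / (C + c) is the probability at which
    \<open>C - (C + c) * prob\<close> changes sign.\<close>
  then obtain n j where nj: "n \<ge> 1" "C / (C + c) < M.prob (A n j)"
    using eventually_good_set[of A "mixture K \<Otimes>\<^sub>M P" "C / (C + c)"] inc C c M.prob_space_axioms by auto
  have fi: "integrable (mixture K \<Otimes>\<^sub>M P) (f n j)"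
  proof (rule M.integrable_const_bound[of _ "(C + c) * real n"])
    show "AE z in mixture K \<Otimes>\<^sub>M P. norm (f n j z) \<le> (C + c) * real n"
    proof (rule AE_I2)
      fix z assume "z \<in> space (mixture K \<Otimes>\<^sub>M P)"
      then show "norm (f n j z) \<le> (C + c) * real n" using f_abs[of z n j] by (simp add: space_M')
    qed
  qed measurable
  have "(\<integral>z. f n j z \<partial>(mixture K \<Otimes>\<^sub>M P)) \<le>
      (\<integral>z. C * real n - (C + c) * real n * indicator (A n j) z \<partial>(mixture K \<Otimes>\<^sub>M P))"
  proof (rule integral_mono[OF fi])
    fix z assume "z \<in> space (mixture K \<Otimes>\<^sub>M P)"
    then show "f n j z \<le> C * real n - (C + c) * real n * indicator (A n j) z"
      using f_upper[of z n j] f_good[of z n j] by (cases "z \<in> A n j") (auto simp: space_M' algebra_simps)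
  qed (intro Bochner_Integration.integrable_diff integrable_mult_right integrable_real_indicator integrable_const,
      simp_all add: less_top[symmetric])
  also have "\<dots> = real n * (C - (C + c) * M.prob (A n j))"
  proof -
    define a b where "a = C * real n" and "b = (C + c) * real n"
    have "integrable (mixture K \<Otimes>\<^sub>M P) (indicator (A n j) :: _ \<Rightarrow> real)"
      by (intro integrable_real_indicator) (simp_all add: less_top[symmetric])
    then have "(\<integral>z. a - b * indicator (A n j) z \<partial>(mixture K \<Otimes>\<^sub>M P)) = a - b * M.prob (A n j)"
      by (simp add: M.prob_space)
    then show ?thesis by (simp add: a_def b_def algebra_simps)
  qed
  also have "\<dots> < 0"
  proof -
    have "C < (C + c) * M.prob (A n j)" using nj(2) C c by (simp add: pos_divide_less_eq mult.commute)
    then show ?thesis using nj(1) by (simp add: mult_pos_neg)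
  qed
  finally have neg: "(\<integral>z. f n j z \<partial>(mixture K \<Otimes>\<^sub>M P)) < 0" .
  show ?thesis
  proof (rule positive_atom_probability[where f="f n j" and t="real n" and r="1 / real (Suc j)" and B="(C + c) * real n"])
    show "\<bar>f n j z\<bar> \<le> (C + c) * real n" if "z \<in> space ?M" for z using f_abs[OF that] .
  next
    fix x h :: 'x and \<omega> w assume \<omega>: "\<omega> \<in> space P" "w \<in> space P" and h: "norm h < 1 / real (Suc j)"
    define z where "z = ((x, \<omega>), w)"
    have z: "z \<in> space ?M" "(\<omega>, w) \<in> space (P \<Otimes>\<^sub>M P)" using \<omega> by (auto simp: z_def space_pair_measure)
    show "norm (U (real n) (\<omega>, w) (x + h) - U (real n) (\<omega>, w) x) \<le> exp (f n j ((x, \<omega>), w)) * norm h"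
    proof (cases "h = 0")
      case False
      \<comment> \<open>The supremum runs over a dense set of displacements only. A general h is
        approximated by some d in it; \<open>L\<close> collects the two losses, the global Lipschitz
        constant for moving the argument and exp f for the change of norm.\<close>
      show ?thesis
      proof (rule field_le_epsilon)
        fix e :: real assume e: "0 < e"
        define L where "L = exp (C * real n) + exp (f n j z)"
        have L: "L > 0" by (simp add: L_def add_pos_pos)
        have "open (ball h (e / L) \<inter> (ball 0 (1 / real (Suc j)) - {0}))" by (intro open_Int open_ball open_delete)
        moreover have "h \<in> ball h (e / L) \<inter> (ball 0 (1 / real (Suc j)) - {0})" using e L False h by simp
        then have "ball h (e / L) \<inter> (ball 0 (1 / real (Suc j)) - {0}) \<noteq> {}" by blast
        ultimately obtain d where d: "d \<in> D" "d \<in> ball h (e / L)" "norm d < 1 / real (Suc j)" "d \<noteq> 0"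
          using D(2)[of "ball h (e / L) \<inter> (ball 0 (1 / real (Suc j)) - {0})"] by (auto simp del: of_nat_Suc)
        have dD: "d \<in> Dj j" using d by (auto simp: Dj_def)
        have hd: "norm (h - d) \<le> e / L" using d(2) by (simp add: dist_norm)
        have "q n d z \<le> exp (f n j z)" using q_s[OF z(1) dD, of n] by (simp add: f_exp)
        then have 1: "norm (U (real n) (\<omega>, w) (x + d) - U (real n) (\<omega>, w) x) \<le> exp (f n j z) * norm d"
          using d(4) by (simp add: q_def z_def pos_divide_le_eq)
        have 2: "norm (U (real n) (\<omega>, w) (x + h) - U (real n) (\<omega>, w) (x + d)) \<le> exp (C * real n) * norm (h - d)"
          using lip[OF z(2), of n "x + h" "x + d"] by simp
        have "norm d \<le> norm h + norm (h - d)" using norm_triangle_ineq4[of h "h - d"] by simp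
        then have 3: "exp (f n j z) * norm d \<le> exp (f n j z) * (norm h + norm (h - d))" by (intro mult_left_mono) auto
        have "norm (U (real n) (\<omega>, w) (x + h) - U (real n) (\<omega>, w) x) \<le>
            norm (U (real n) (\<omega>, w) (x + h) - U (real n) (\<omega>, w) (x + d)) + norm (U (real n) (\<omega>, w) (x + d) - U (real n) (\<omega>, w) x)"
          using norm_triangle_ineq[of "U (real n) (\<omega>, w) (x + h) - U (real n) (\<omega>, w) (x + d)" "U (real n) (\<omega>, w) (x + d) - U (real n) (\<omega>, w) x"] by simp
        also have "\<dots> \<le> exp (f n j z) * norm h + L * norm (h - d)"
          using 1 2 3 by (simp add: L_def algebra_simps)
        also have "\<dots> \<le> exp (f n j z) * norm h + L * (e / L)"
          using hd L by (intro add_left_mono mult_left_mono) auto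
        also have "\<dots> = exp (f n j ((x, \<omega>), w)) * norm h + e" using L by (simp add: z_def)
        finally show "norm (U (real n) (\<omega>, w) (x + h) - U (real n) (\<omega>, w) x) \<le> exp (f n j ((x, \<omega>), w)) * norm h + e" .
      qed
    qed simp
  qed (use neg in auto)
qed

end

section \<open>Ergodicity and the mass of the atoms\<close>

context random_flow
begin

definition atoms :: "real \<Rightarrow> 'w \<Rightarrow> 'x set" where
  "atoms c \<omega> = {x. ennreal c \<le> emeasure (K \<omega>) {x}}"

definition atomic_mass :: "real \<Rightarrow> 'w \<Rightarrow> ennreal" where
  "atomic_mass c \<omega> = emeasure (K \<omega>) (atoms c \<omega>)"

lemma atoms_graph_measurable [measurable]:
  "{z \<in> space (borel \<Otimes>\<^sub>M P). fst z \<in> atoms c (snd z)} \<in> sets (borel \<Otimes>\<^sub>M P)"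
proof -
  have "{z \<in> space (borel \<Otimes>\<^sub>M P). ennreal c \<le> ball_mass 0 z} \<in> sets (borel \<Otimes>\<^sub>M P)" by measurable
  then show ?thesis by (simp add: atoms_def ball_mass_def)
qed

lemma atoms_measurable [measurable]:
  assumes "\<omega> \<in> space P"
  shows "atoms c \<omega> \<in> sets borel"
proof -
  have "(\<lambda>x. (x, \<omega>)) -` {z \<in> space (borel \<Otimes>\<^sub>M P). fst z \<in> atoms c (snd z)} \<in> sets borel"
    by (rule sets_Pair2) measurable
  also have "(\<lambda>x. (x, \<omega>)) -` {z \<in> space (borel \<Otimes>\<^sub>M P). fst z \<in> atoms c (snd z)} = atoms c \<omega>"
    using assms by (auto simp: space_pair_measure)
  finally show ?thesis .
qed

lemma emeasure_section_measurable:
  assumes B: "B \<in> sets borel"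
  shows "(\<lambda>\<omega>. emeasure (K \<omega>) (atoms c \<omega> \<inter> B)) \<in> borel_measurable P"
proof (rule emeasure_measurable_subprob_algebra2[OF _ measurable_prob_algebraD[OF K_measurable]])
  have "{z \<in> space (P \<Otimes>\<^sub>M borel). (snd z, fst z) \<in> {z \<in> space (borel \<Otimes>\<^sub>M P). fst z \<in> atoms c (snd z)} \<and> snd z \<in> B}
      \<in> sets (P \<Otimes>\<^sub>M borel)"
    using B by measurable
  also have "{z \<in> space (P \<Otimes>\<^sub>M borel). (snd z, fst z) \<in> {z \<in> space (borel \<Otimes>\<^sub>M P). fst z \<in> atoms c (snd z)} \<and> snd z \<in> B}
      = (SIGMA \<omega>:space P. atoms c \<omega> \<inter> B)"
    by (auto simp: space_pair_measure)
  finally show "(SIGMA \<omega>:space P. atoms c \<omega> \<inter> B) \<in> sets (P \<Otimes>\<^sub>M borel)" .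
qed

lemma atomic_mass_measurable [measurable]: "atomic_mass c \<in> borel_measurable P"
  using emeasure_section_measurable[of UNIV c] by (simp add: atomic_mass_def[abs_def])

lemma atomic_mass_le_1: "\<omega> \<in> space P \<Longrightarrow> atomic_mass c \<omega> \<le> 1"
  unfolding atomic_mass_def
  by (rule subprob_space.subprob_emeasure_le_1[OF prob_space_imp_subprob_space[OF kernel_space(1)[OF K_measurable]]])

text \<open>The flow can merge points but cannot split the mass of one, since the preimage of the
  image of x contains x.\<close>

lemma U_atoms:
  assumes t: "0 \<le> t" and \<omega>: "\<omega> \<in> space (P \<Otimes>\<^sub>M P)" and x: "x \<in> atoms c (fst \<omega>)"
  shows "U t \<omega> x \<in> atoms c (g t \<omega>)"
proof -
  have f: "fst \<omega> \<in> space P" using \<omega> by (auto simp: space_pair_measure)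
  note sK = kernel_space[OF K_measurable f]
  note m = U_measurable1[OF t \<omega>]
  have "emeasure (K (fst \<omega>)) {x} \<le> emeasure (K (fst \<omega>)) (U t \<omega> -` {U t \<omega> x} \<inter> space (K (fst \<omega>)))"
    using measurable_sets[OF m, of "{U t \<omega> x}"] sK by (intro emeasure_mono) auto
  also have "\<dots> = emeasure (distr (K (fst \<omega>)) borel (U t \<omega>)) {U t \<omega> x}"
    using m sK(2) by (subst emeasure_distr) (auto cong: measurable_cong_sets)
  also have "\<dots> = emeasure (K (g t \<omega>)) {U t \<omega> x}" by (simp add: K_equivariant[OF t \<omega>])
  finally show ?thesis using x by (auto simp: atoms_def)
qed

text \<open>The version localized to B, used below for B and its complement at once to turn both
  inequalities into equalities.\<close>

lemma atoms_push_le: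
  assumes t: "0 \<le> t" and \<omega>: "\<omega> \<in> space (P \<Otimes>\<^sub>M P)" and B: "B \<in> sets borel"
  shows "emeasure (K (fst \<omega>)) (atoms c (fst \<omega>) \<inter> U t \<omega> -` B) \<le> emeasure (K (g t \<omega>)) (atoms c (g t \<omega>) \<inter> B)"
proof -
  have f: "fst \<omega> \<in> space P" using \<omega> by (auto simp: space_pair_measure)
  have g: "g t \<omega> \<in> space P" by (rule measurable_space[OF g_measurable[OF t] \<omega>])
  note sK = kernel_space[OF K_measurable f]
  note m = U_measurable1[OF t \<omega>]
  have AB: "atoms c (g t \<omega>) \<inter> B \<in> sets borel" using atoms_measurable[OF g] B by blast
  have "emeasure (K (fst \<omega>)) (atoms c (fst \<omega>) \<inter> U t \<omega> -` B) \<le>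
      emeasure (K (fst \<omega>)) (U t \<omega> -` (atoms c (g t \<omega>) \<inter> B) \<inter> space (K (fst \<omega>)))"
    using measurable_sets[OF m AB] sK U_atoms[OF t \<omega>] by (intro emeasure_mono) auto
  also have "\<dots> = emeasure (distr (K (fst \<omega>)) borel (U t \<omega>)) (atoms c (g t \<omega>) \<inter> B)"
    using m sK(2) AB by (subst emeasure_distr) (auto cong: measurable_cong_sets)
  also have "\<dots> = emeasure (K (g t \<omega>)) (atoms c (g t \<omega>) \<inter> B)" by (simp add: K_equivariant[OF t \<omega>])
  finally show ?thesis .
qed

text \<open>Invariance of P under \<open>g t\<close> gives both sides the same integral, so the
  pointwise inequality between them is an equality almost everywhere.\<close>

lemma atomic_mass_invariant:
  assumes t: "0 \<le> t"
  shows "AE \<omega> in P \<Otimes>\<^sub>M P. atomic_mass c (g t \<omega>) = atomic_mass c (fst \<omega>)"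
proof -
  note [measurable] = g_measurable[OF t]
  define a where "a \<omega> = enn2real (atomic_mass c \<omega>)" for \<omega>
  have [measurable]: "a \<in> borel_measurable P" unfolding a_def by measurable
  have a1: "a \<omega> \<le> 1" "ennreal (a \<omega>) = atomic_mass c \<omega>" if "\<omega> \<in> space P" for \<omega>
  proof -
    have "atomic_mass c \<omega> < \<infinity>" using atomic_mass_le_1[OF that, of c] by (auto simp: less_top[symmetric] top_unique)
    then show "ennreal (a \<omega>) = atomic_mass c \<omega>" by (simp add: a_def)
    then show "a \<omega> \<le> 1" using atomic_mass_le_1[OF that, of c] by (metis ennreal_le_1)
  qed
  have a0: "0 \<le> a \<omega>" for \<omega> by (simp add: a_def)
  have gs: "g t \<omega> \<in> space P" "fst \<omega> \<in> space P" if "\<omega> \<in> space (P \<Otimes>\<^sub>M P)" for \<omega>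
    using measurable_space[OF g_measurable[OF t] that] that by (auto simp: space_pair_measure)
  have "AE \<omega> in P \<Otimes>\<^sub>M P. a (fst \<omega>) = a (g t \<omega>)"
  proof (rule integral_ineq_eq_0_then_AE)
    show "AE \<omega> in P \<Otimes>\<^sub>M P. a (fst \<omega>) \<le> a (g t \<omega>)"
    proof (rule AE_I2)
      fix \<omega> assume \<omega>: "\<omega> \<in> space (P \<Otimes>\<^sub>M P)"
      have "atomic_mass c (fst \<omega>) \<le> atomic_mass c (g t \<omega>)"
        using atoms_push_le[OF t \<omega>, of UNIV c] by (simp add: atomic_mass_def)
      then show "a (fst \<omega>) \<le> a (g t \<omega>)"
        using a1(2) gs[OF \<omega>] a0 by (metis ennreal_le_iff)
    qed
    show "integrable (P \<Otimes>\<^sub>M P) (\<lambda>\<omega>. a (fst \<omega>))"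
      by (rule PP.integrable_const_bound[of _ 1]) (auto intro!: AE_I2 simp: a0 a1 gs)
    show "integrable (P \<Otimes>\<^sub>M P) (\<lambda>\<omega>. a (g t \<omega>))"
      by (rule PP.integrable_const_bound[of _ 1]) (auto intro!: AE_I2 simp: a0 a1 gs)
    have "(\<integral>\<omega>. a (g t \<omega>) \<partial>(P \<Otimes>\<^sub>M P)) = (\<integral>\<omega>. a \<omega> \<partial>P)"
      using integral_distr[OF g_measurable[OF t], of a] by (simp add: g_invariant[OF t])
    moreover have "(\<integral>\<omega>. a (fst \<omega>) \<partial>(P \<Otimes>\<^sub>M P)) = (\<integral>\<omega>. a \<omega> \<partial>P)"
    proof -
      have "integrable P a" by (rule integrable_const_bound[of _ 1]) (auto intro!: AE_I2 simp: a0 a1)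
      then have "integrable (P \<Otimes>\<^sub>M P) (\<lambda>\<omega>. a (fst \<omega>))" using \<open>integrable (P \<Otimes>\<^sub>M P) (\<lambda>\<omega>. a (fst \<omega>))\<close> by simp
      from PP.integral_fst'[OF this] show ?thesis by (simp add: prob_space)
    qed
    ultimately show "(\<integral>\<omega>. a (fst \<omega>) \<partial>(P \<Otimes>\<^sub>M P)) = (\<integral>\<omega>. a (g t \<omega>) \<partial>(P \<Otimes>\<^sub>M P))" by simp
  qed
  then show ?thesis using AE_space
  proof eventually_elim
    case (elim \<omega>)
    then show ?case using a1(2)[OF gs(1)[OF elim(2)]] a1(2)[OF gs(2)[OF elim(2)]] by simp
  qed
qed

text \<open>Where there is no mass to normalize, the kernel K itself is the default. This keeps the
  kernel a probability measure everywhere and preserves equivariance.\<close>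

definition atomic_part :: "real \<Rightarrow> 'w \<Rightarrow> 'x measure" where
  "atomic_part c \<omega> = (if atomic_mass c \<omega> = 0 then K \<omega> else uniform_measure (K \<omega>) (atoms c \<omega>))"

lemma atomic_part_measurable: "atomic_part c \<in> measurable P (prob_algebra borel)"
proof (rule measurable_prob_algebraI)
  show ps: "prob_space (atomic_part c \<omega>)" if \<omega>: "\<omega> \<in> space P" for \<omega>
  proof (cases "atomic_mass c \<omega> = 0")
    case True then show ?thesis using kernel_space(1)[OF K_measurable \<omega>] by (simp add: atomic_part_def)
  next
    case False
    have "atomic_mass c \<omega> \<noteq> \<infinity>" using atomic_mass_le_1[OF \<omega>, of c] by (auto simp: top_unique)
    then show ?thesis using False
      by (auto simp: atomic_part_def atomic_mass_def intro!: prob_space_uniform_measure)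
  qed
  show "atomic_part c \<in> measurable P (subprob_algebra borel)"
  proof (rule measurable_subprob_algebra)
    show "subprob_space (atomic_part c \<omega>)" if "\<omega> \<in> space P" for \<omega>
      using ps[OF that] by (rule prob_space_imp_subprob_space)
    show "sets (atomic_part c \<omega>) = sets borel" if "\<omega> \<in> space P" for \<omega>
      using kernel_space(2)[OF K_measurable that] by (simp add: atomic_part_def)
    fix B :: "'x set" assume B: "B \<in> sets borel"
    note [measurable] = emeasure_section_measurable[OF B]
      measurable_compose[OF measurable_prob_algebraD[OF K_measurable] measurable_emeasure_subprob_algebra[OF B]]
    have "(\<lambda>\<omega>. if atomic_mass c \<omega> = 0 then emeasure (K \<omega>) B
        else emeasure (K \<omega>) (atoms c \<omega> \<inter> B) / atomic_mass c \<omega>) \<in> borel_measurable P"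
      by measurable
    also have "?this \<longleftrightarrow> (\<lambda>\<omega>. emeasure (atomic_part c \<omega>) B) \<in> borel_measurable P"
      using B kernel_space(2)[OF K_measurable]
      by (intro measurable_cong) (auto simp: atomic_part_def atomic_mass_def)
    finally show "(\<lambda>\<omega>. emeasure (atomic_part c \<omega>) B) \<in> borel_measurable P" .
  qed
qed

text \<open>Pushing the restricted measure forward loses nothing: the inequality holds for B and for
  its complement, and the two totals agree because the atomic mass is invariant. As the masses are
  finite, both inequalities are equalities, and dividing by the common mass preserves them.\<close>

lemma atomic_part_equivariant:
  assumes t: "0 \<le> t"
  shows "AE \<omega> in P \<Otimes>\<^sub>M P. distr (atomic_part c (fst \<omega>)) borel (U t \<omega>) = atomic_part c (g t \<omega>)"
  using atomic_mass_invariant[OF t, of c] AE_space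
proof eventually_elim
  case (elim \<omega>)
  note \<omega> = elim(2)
  have f: "fst \<omega> \<in> space P" using \<omega> by (auto simp: space_pair_measure)
  have gw: "g t \<omega> \<in> space P" by (rule measurable_space[OF g_measurable[OF t] \<omega>])
  note sK = kernel_space(2,3)[OF K_measurable f] kernel_space(2,3)[OF K_measurable gw]
  note m = U_measurable1[OF t \<omega>]
  show ?case
  proof (cases "atomic_mass c (fst \<omega>) = 0")
    case True
    then show ?thesis using elim(1) by (simp add: atomic_part_def K_equivariant[OF t \<omega>])
  next
    case False
    let ?l = "\<lambda>B. emeasure (K (fst \<omega>)) (atoms c (fst \<omega>) \<inter> U t \<omega> -` B)"
    let ?r = "\<lambda>B. emeasure (K (g t \<omega>)) (atoms c (g t \<omega>) \<inter> B)"
    have eq: "?l B = ?r B" if B: "B \<in> sets borel" for B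
    proof -
      have mB: "U t \<omega> -` B \<in> sets borel" "U t \<omega> -` (- B) \<in> sets borel"
        using measurable_sets[OF m B] measurable_sets[OF m borel_comp[OF B]] by simp_all
      have "?l B + ?l (- B) = emeasure (K (fst \<omega>)) (atoms c (fst \<omega>))"
        using atoms_measurable[OF f, of c] mB sK
        by (subst plus_emeasure) (auto intro!: arg_cong[of _ _ "emeasure (K (fst \<omega>))"])
      also have "\<dots> = emeasure (K (g t \<omega>)) (atoms c (g t \<omega>))" using elim(1) by (simp add: atomic_mass_def)
      also have "\<dots> = ?r B + ?r (- B)"
        using atoms_measurable[OF gw, of c] B sK
        by (subst plus_emeasure) (auto intro!: arg_cong[of _ _ "emeasure (K (g t \<omega>))"])
      finally have sum: "?l B + ?l (- B) = ?r B + ?r (- B)" .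
      have le: "?l B \<le> ?r B" "?l (- B) \<le> ?r (- B)" using B by (auto intro!: atoms_push_le[OF t \<omega>])
      have fin: "?l (- B) \<noteq> \<infinity>"
        using finite_measure.emeasure_finite[OF prob_space.finite_measure[OF kernel_space(1)[OF K_measurable f]]]
        by simp
      have "?r B + ?l (- B) \<le> ?r B + ?r (- B)" using le(2) by (intro add_left_mono)
      then have "?r B + ?l (- B) \<le> ?l B + ?l (- B)" unfolding sum .
      then have "?r B \<le> ?l B" using fin by (simp add: ennreal_add_left_cancel_le add.commute[of _ "?l (- B)"])
      then show ?thesis using le(1) by (rule antisym[rotated])
    qed
    show ?thesis
    proof (rule measure_eqI)
      show "sets (distr (atomic_part c (fst \<omega>)) borel (U t \<omega>)) = sets (atomic_part c (g t \<omega>))"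
        using sK by (simp add: atomic_part_def)
      fix B assume "B \<in> sets (distr (atomic_part c (fst \<omega>)) borel (U t \<omega>))"
      then have B: "B \<in> sets borel" by simp
      have mB: "U t \<omega> -` B \<in> sets borel" using measurable_sets[OF m B] by simp
      have "emeasure (distr (atomic_part c (fst \<omega>)) borel (U t \<omega>)) B =
          emeasure (uniform_measure (K (fst \<omega>)) (atoms c (fst \<omega>))) (U t \<omega> -` B)"
        using m sK B False by (subst emeasure_distr) (auto simp: atomic_part_def cong: measurable_cong_sets)
      also have "\<dots> = ?l B / atomic_mass c (fst \<omega>)"
        using mB sK atoms_measurable[OF f, of c] by (simp add: atomic_mass_def)
      also have "\<dots> = ?r B / atomic_mass c (g t \<omega>)" using eq[OF B] elim(1) by simp
      also have "\<dots> = emeasure (atomic_part c (g t \<omega>)) B"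
        using B sK atoms_measurable[OF gw, of c] False elim(1) by (simp add: atomic_part_def atomic_mass_def)
      finally show "emeasure (distr (atomic_part c (fst \<omega>)) borel (U t \<omega>)) B = emeasure (atomic_part c (g t \<omega>)) B" .
    qed
  qed
qed

end

text \<open>The two inputs beyond stationarity. Both are phrased almost everywhere, because they are
  applied to the atomic part and to level sets of the atomic mass, whose invariance is known only in
  that sense.\<close>

locale ergodic_random_flow = random_flow P g U K
  for P :: "'w measure" and g and U :: "real \<Rightarrow> 'w \<times> 'w \<Rightarrow> 'x::euclidean_space \<Rightarrow> 'x" and K +
  assumes unique: "\<rho> \<in> measurable P (prob_algebra borel) \<Longrightarrow>
      (\<And>t. 0 \<le> t \<Longrightarrow> AE \<omega> in P \<Otimes>\<^sub>M P. distr (\<rho> (fst \<omega>)) borel (U t \<omega>) = \<rho> (g t \<omega>)) \<Longrightarrow>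
      mixture \<rho> = mixture K"
    and zero_one: "E \<in> sets P \<Longrightarrow> (\<And>t. 0 \<le> t \<Longrightarrow> AE \<omega> in P \<Otimes>\<^sub>M P. g t \<omega> \<in> E \<longleftrightarrow> fst \<omega> \<in> E) \<Longrightarrow>
      emeasure P E = 0 \<or> emeasure P E = 1"
begin

text \<open>
  The normalized restriction of the disintegration to its atoms of mass at least \<open>c\<close> is again
  equivariant, so uniqueness identifies it with the disintegration itself.
\<close>

lemma atomic_mass_dichotomy:
  "(AE \<omega> in P. atomic_mass c \<omega> = 1) \<or> (AE \<omega> in P. atomic_mass c \<omega> = 0)"
proof -
  note am = atomic_part_measurable[of c]
  have eq: "mixture (atomic_part c) = mixture K"
    by (rule unique[OF am atomic_part_equivariant])
  \<comment> \<open>By construction \<Gamma> has full measure for the atomic part, hence also for K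
    as the two mixtures coincide. Read fibrewise, this says that \<open>b\<close> below has mean 1;
    as b is at most 1, it equals 1 almost everywhere, which leaves 0 and 1 as values of the atomic
    mass.\<close>
  define \<Gamma> where "\<Gamma> = {z \<in> space (borel \<Otimes>\<^sub>M P). atomic_mass c (snd z) = 0 \<or> fst z \<in> atoms c (snd z)}"
  have \<Gamma>: "\<Gamma> \<in> sets (borel \<Otimes>\<^sub>M P)"
  proof -
    have "\<Gamma> = {z \<in> space (borel \<Otimes>\<^sub>M P). atomic_mass c (snd z) = 0} \<union>
        {z \<in> space (borel \<Otimes>\<^sub>M P). fst z \<in> atoms c (snd z)}" by (auto simp: \<Gamma>_def)
    also have "\<dots> \<in> sets (borel \<Otimes>\<^sub>M P)" by measurable
    finally show ?thesis .
  qed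
  have sec: "{x. (x, \<omega>) \<in> \<Gamma>} = (if atomic_mass c \<omega> = 0 then UNIV else atoms c \<omega>)" if "\<omega> \<in> space P" for \<omega>
    using that by (auto simp: \<Gamma>_def space_pair_measure)
  have "emeasure (mixture (atomic_part c)) \<Gamma> = (\<integral>\<^sup>+\<omega>. 1 \<partial>P)"
    unfolding emeasure_mixture[OF am \<Gamma>]
  proof (rule nn_integral_cong)
    fix \<omega> assume \<omega>: "\<omega> \<in> space P"
    note ps = kernel_space[OF am \<omega>]
    note K = kernel_space[OF K_measurable \<omega>]
    show "emeasure (atomic_part c \<omega>) {x. (x, \<omega>) \<in> \<Gamma>} = 1"
    proof (cases "atomic_mass c \<omega> = 0")
      case True then show ?thesis using prob_space.emeasure_space_1[OF ps(1)] ps(3) by (simp add: sec[OF \<omega>])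
    next
      case False
      have "atomic_mass c \<omega> \<noteq> \<infinity>" using atomic_mass_le_1[OF \<omega>, of c] by (auto simp: top_unique)
      then show ?thesis using False atoms_measurable[OF \<omega>, of c] K(2)
        by (simp add: sec[OF \<omega>] atomic_part_def atomic_mass_def ennreal_divide_self less_top)
    qed
  qed
  then have "(\<integral>\<^sup>+\<omega>. emeasure (K \<omega>) {x. (x, \<omega>) \<in> \<Gamma>} \<partial>P) = 1"
    using emeasure_mixture[OF K_measurable \<Gamma>] eq by (simp add: emeasure_space_1)
  moreover have "(\<integral>\<^sup>+\<omega>. emeasure (K \<omega>) {x. (x, \<omega>) \<in> \<Gamma>} \<partial>P) =
      (\<integral>\<^sup>+\<omega>. (if atomic_mass c \<omega> = 0 then 1 else atomic_mass c \<omega>) \<partial>P)"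
  proof (rule nn_integral_cong)
    fix \<omega> assume \<omega>: "\<omega> \<in> space P"
    note K = kernel_space[OF K_measurable \<omega>]
    show "emeasure (K \<omega>) {x. (x, \<omega>) \<in> \<Gamma>} = (if atomic_mass c \<omega> = 0 then 1 else atomic_mass c \<omega>)"
      using prob_space.emeasure_space_1[OF K(1)] K(3) by (simp add: sec[OF \<omega>] atomic_mass_def)
  qed
  moreover define b where "b \<omega> = (if atomic_mass c \<omega> = 0 then 1 else atomic_mass c \<omega>)" for \<omega>
  ultimately have int: "(\<integral>\<^sup>+\<omega>. b \<omega> \<partial>P) = 1" by simp
  have [measurable]: "b \<in> borel_measurable P" unfolding b_def by measurable
  have b1: "b \<omega> \<le> 1" if "\<omega> \<in> space P" for \<omega> using atomic_mass_le_1[OF that, of c] by (simp add: b_def)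
  have "(\<integral>\<^sup>+\<omega>. 1 - b \<omega> \<partial>P) = (\<integral>\<^sup>+\<omega>. 1 \<partial>P) - (\<integral>\<^sup>+\<omega>. b \<omega> \<partial>P)"
    using int b1 by (intro nn_integral_diff) (auto intro!: AE_I2)
  also have "\<dots> = 0" by (simp add: int emeasure_space_1)
  finally have "AE \<omega> in P. 1 - b \<omega> = 0" by (subst (asm) nn_integral_0_iff_AE) simp_all
  then have zo: "AE \<omega> in P. atomic_mass c \<omega> = 0 \<or> atomic_mass c \<omega> = 1"
    using AE_space
  proof eventually_elim
    case (elim \<omega>)
    have "1 \<le> b \<omega>" using elim(1) by (simp add: diff_eq_0_iff_ennreal)
    then have "b \<omega> = 1" using b1[OF elim(2)] by (rule antisym[rotated])
    then show ?case by (auto simp: b_def split: if_splits)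
  qed
  define E where "E = {\<omega> \<in> space P. atomic_mass c \<omega> = 1}"
  have [measurable]: "E \<in> sets P" unfolding E_def by measurable
  have "emeasure P E = 0 \<or> emeasure P E = 1"
  proof (rule zero_one)
    fix t :: real assume t: "0 \<le> t"
    show "AE \<omega> in P \<Otimes>\<^sub>M P. g t \<omega> \<in> E \<longleftrightarrow> fst \<omega> \<in> E"
      using atomic_mass_invariant[OF t, of c] AE_space
    proof eventually_elim
      case (elim \<omega>)
      then show ?case using measurable_space[OF g_measurable[OF t] elim(2)]
        by (auto simp: E_def space_pair_measure)
    qed
  qed simp
  then show ?thesis
  proof
    assume "emeasure P E = 0"
    then have "AE \<omega> in P. \<omega> \<notin> E" by (intro AE_not_in) (auto simp: null_sets_def)
    with zo AE_space have "AE \<omega> in P. atomic_mass c \<omega> = 0" by eventually_elim (auto simp: E_def)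
    then show ?thesis ..
  next
    assume "emeasure P E = 1"
    then have "AE \<omega> in P. \<omega> \<in> E" by (intro AE_I_eq_1) (auto simp: E_def)
    then have "AE \<omega> in P. atomic_mass c \<omega> = 1" by eventually_elim (auto simp: E_def)
    then show ?thesis ..
  qed
qed

end

lemma (in prob_space) AE_imp_bex:
  assumes "AE x in M. Q x"
  shows "\<exists>x\<in>space M. Q x"
proof (rule ccontr)
  assume "\<not> (\<exists>x\<in>space M. Q x)"
  then have "AE x in M. \<not> Q x" by (intro AE_I2) blast
  with assms have "AE x in M. False" by eventually_elim simp
  then show False by simp
qed

section \<open>Measurable enumeration of equal atoms\<close>

definition uniform_on_points :: "nat \<Rightarrow> 'x::euclidean_space set \<Rightarrow> 'x measure \<Rightarrow> bool" where
  "uniform_on_points p S \<kappa> \<longleftrightarrow> finite S \<and> card S = p \<and> (\<forall>x\<in>S. emeasure \<kappa> {x} = ennreal (1 / real p))"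

context
  fixes \<kappa> :: "'x::euclidean_space measure" and p :: nat and S :: "'x set"
  assumes \<kappa>: "prob_space \<kappa>" "sets \<kappa> = sets borel" and p: "p \<ge> 1" and S: "uniform_on_points p S \<kappa>"
begin

interpretation prob_space \<kappa> by (rule \<kappa>(1))

lemma uniform_on_points_subset_mass:
  assumes "T \<subseteq> S"
  shows "measure \<kappa> T = real (card T) / real p"
proof -
  have T: "finite T" using S assms finite_subset by (auto simp: uniform_on_points_def)
  have pt: "measure \<kappa> {x} = 1 / real p" if "x \<in> T" for x
    using S assms that by (auto simp: uniform_on_points_def measure_def)
  have "measure \<kappa> T = (\<Sum>x\<in>T. measure \<kappa> {x})"
    using T \<kappa>(2) by (intro finite_measure_eq_sum_singleton) auto
  then show ?thesis using pt by simp
qed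

lemma uniform_on_points_AE: "AE x in \<kappa>. x \<in> S"
proof -
  have "measure \<kappa> S = 1"
    using uniform_on_points_subset_mass[of S] S p by (simp add: uniform_on_points_def)
  moreover have "S \<in> sets \<kappa>" using S \<kappa>(2) by (auto simp: uniform_on_points_def intro: borel_closed finite_imp_closed)
  ultimately show ?thesis by (subst (asm) prob_eq_1) auto
qed

lemma uniform_on_points_mass:
  assumes A: "A \<in> sets borel"
  shows "measure \<kappa> A = real (card (S \<inter> A)) / real p"
proof -
  have "S \<in> sets \<kappa>" using S \<kappa>(2) by (auto simp: uniform_on_points_def intro: borel_closed finite_imp_closed)
  then have "measure \<kappa> A = measure \<kappa> (S \<inter> A)"
    using uniform_on_points_AE A \<kappa>(2) by (intro finite_measure_eq_AE) auto
  then show ?thesis using uniform_on_points_subset_mass[of "S \<inter> A"] by simp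
qed

text \<open>A formula for an atom that is measurable in the measure: if V isolates one atom y, the
  first moment over V is y / p.\<close>

lemma uniform_on_points_barycentre:
  assumes V: "V \<in> sets borel" and y: "S \<inter> V = {y}"
  shows "real p *\<^sub>R (\<integral>x. indicator V x *\<^sub>R x \<partial>\<kappa>) = y"
proof -
  note [measurable_cong] = \<kappa>(2)
  have "(\<integral>x. indicator V x *\<^sub>R x \<partial>\<kappa>) = (\<integral>x. indicator {y} x *\<^sub>R y \<partial>\<kappa>)"
  proof (rule integral_cong_AE)
    show "AE x in \<kappa>. indicat_real V x *\<^sub>R x = indicat_real {y} x *\<^sub>R y"
      using uniform_on_points_AE
    proof eventually_elim
      case (elim x)
      then show ?case using y by (cases "x = y") (auto simp: indicator_def)
    qed
    show "(\<lambda>x. indicat_real V x *\<^sub>R x) \<in> borel_measurable \<kappa>" using V by measurable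
  qed measurable
  also have "\<dots> = (\<integral>x. indicat_real {y} x \<partial>\<kappa>) *\<^sub>R y"
    by (intro integral_scaleR_left integrable_real_indicator)
      (simp_all add: \<kappa>(2) less_top[symmetric])
  also have "(\<integral>x. indicat_real {y} x \<partial>\<kappa>) = measure \<kappa> {y}"
    using sets_eq_imp_space_eq[OF \<kappa>(2)] by simp
  also have "measure \<kappa> {y} = 1 / real p" using uniform_on_points_subset_mass[of "{y}"] y by auto
  finally show ?thesis using p by simp
qed

end

text \<open>Centres in a given dense set and a common radius of the form 1 / (n + 1): with a
  countable dense set, only countably many separating configurations occur.\<close>

lemma separating_balls:
  fixes S :: "'x::euclidean_space set"
  assumes S: "finite S" and D: "\<And>X. open X \<Longrightarrow> X \<noteq> {} \<Longrightarrow> \<exists>d\<in>D. d \<in> X"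
  obtains n :: nat and d :: "'x \<Rightarrow> 'x" where "\<And>x. x \<in> S \<Longrightarrow> d x \<in> D"
    "\<And>x. x \<in> S \<Longrightarrow> x \<in> ball (d x) (1 / real (Suc n))"
    "\<And>x y. x \<in> S \<Longrightarrow> y \<in> S \<Longrightarrow> x \<noteq> y \<Longrightarrow> ball (d x) (1 / real (Suc n)) \<inter> ball (d y) (1 / real (Suc n)) = {}"
proof -
  \<comment> \<open>The value 1 keeps the minimum meaningful when S has fewer than two
    points.\<close>
  define E where "E = insert 1 ((\<lambda>(x, y). dist x y) ` {(x, y) \<in> S \<times> S. x \<noteq> y})"
  have E: "finite E" "E \<noteq> {}"
    using finite_subset[of "{(x, y) \<in> S \<times> S. x \<noteq> y}" "S \<times> S"] S by (auto simp: E_def)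
  define e where "e = Min E"
  have e: "0 < e" using E by (auto simp: e_def Min_gr_iff E_def)
  have sep: "e \<le> dist x y" if "x \<in> S" "y \<in> S" "x \<noteq> y" for x y
    unfolding e_def using that E(1) by (intro Min_le) (auto simp: E_def)
  \<comment> \<open>A common point of two balls would bound the distance of their atoms by four
    terms below 1 / (n + 1), hence the quarter of e.\<close>
  obtain n :: nat where n: "inverse (real (Suc n)) < e / 4" using reals_Archimedean[of "e/4"] e by auto
  have "\<exists>d\<in>D. d \<in> ball x (1 / real (Suc n))" for x by (intro D) auto
  then obtain d where d: "\<And>x. d x \<in> D" "\<And>x. d x \<in> ball x (1 / real (Suc n))" by metis
  show ?thesis
  proof (rule that[of d n])
    show "x \<in> ball (d x) (1 / real (Suc n))" for x using d(2)[of x] by (simp add: dist_commute)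
    fix x y assume xy: "x \<in> S" "y \<in> S" "x \<noteq> y"
    show "ball (d x) (1 / real (Suc n)) \<inter> ball (d y) (1 / real (Suc n)) = {}"
    proof (rule ccontr)
      assume "ball (d x) (1 / real (Suc n)) \<inter> ball (d y) (1 / real (Suc n)) \<noteq> {}"
      then obtain u where u: "dist (d x) u < inverse (real (Suc n))" "dist (d y) u < inverse (real (Suc n))"
        by (auto simp: inverse_eq_divide)
      have dd: "dist x (d x) < inverse (real (Suc n))" "dist y (d y) < inverse (real (Suc n))"
        using d(2)[of x] d(2)[of y] by (auto simp: inverse_eq_divide)
      have "dist x y \<le> dist x (d x) + dist (d x) u + (dist (d y) u + dist y (d y))" by metric
      then have "dist x y < e" using u dd n by linarith
      then show False using sep[OF xy] by simp
    qed
  qed (use d in auto)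
qed

context random_flow
begin

text \<open>The atoms form an unordered set and must be numbered measurably. A list of p disjoint
  balls, each of mass 1/p, holds one atom per ball and thereby orders them. Countably many lists
  suffice, the first suitable one depends measurably on the past, and the i-th atom is recovered as
  the barycentre of its ball.\<close>

lemma measurable_enumeration_of_atoms:
  assumes p: "p \<ge> 1" and ae: "AE \<omega> in P. \<exists>S. uniform_on_points p S (K \<omega>)"
  shows "\<exists>b :: nat \<Rightarrow> 'w \<Rightarrow> 'x. (\<forall>i\<in>{1..p}. b i \<in> borel_measurable P) \<and>
    (AE \<omega> in P. \<forall>A\<in>sets borel. emeasure (K \<omega>) A =
      ennreal (1 / real p) * (\<Sum>i=1..p. emeasure (return borel (b i \<omega>)) A))"
proof -
  obtain D :: "'x set" where D: "countable D" "\<And>X. open X \<Longrightarrow> X \<noteq> {} \<Longrightarrow> \<exists>d\<in>D. d \<in> X"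
    using countable_dense_exists by metis
  \<comment> \<open>Atoms are numbered from 1 and list entries from 0, hence the index i -
    1.\<close>
  define V where "V l i = ball (fst (l ! (i - 1))) (1 / real (Suc (snd (l ! (i - 1)))))" for l :: "('x \<times> nat) list" and i :: nat
  define L where "L = {l \<in> lists (D \<times> (UNIV :: nat set)). disjoint_family_on (V l) {1..p}}"
  have L: "countable L" unfolding L_def using D(1) by (intro countable_Collect countable_lists) auto
  define ok where "ok l \<omega> \<longleftrightarrow> (\<forall>i\<in>{1..p}. emeasure (K \<omega>) (V l i) = ennreal (1 / real p))" for l \<omega>
  have ex: "\<exists>l\<in>L. ok l \<omega>" if \<omega>: "\<omega> \<in> space P" and S: "uniform_on_points p S (K \<omega>)" for \<omega> S
  proof -
    note k = kernel_space[OF K_measurable \<omega>]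
    have fS: "finite S" "card S = p" using S by (auto simp: uniform_on_points_def)
    obtain xs where xs: "set xs = S" "distinct xs" using finite_distinct_list[OF fS(1)] by blast
    have len: "length xs = p" using xs fS distinct_card by fastforce
    obtain n d where nd: "\<And>x. x \<in> S \<Longrightarrow> d x \<in> D" "\<And>x. x \<in> S \<Longrightarrow> x \<in> ball (d x) (1 / real (Suc n))"
      "\<And>x y. x \<in> S \<Longrightarrow> y \<in> S \<Longrightarrow> x \<noteq> y \<Longrightarrow> ball (d x) (1 / real (Suc n)) \<inter> ball (d y) (1 / real (Suc n)) = {}"
      using separating_balls[OF fS(1) D(2)] by metis
    define l where "l = map (\<lambda>x. (d x, n)) xs"
    have Vl: "V l i = ball (d (xs ! (i - 1))) (1 / real (Suc n))" "xs ! (i - 1) \<in> S" if "i \<in> {1..p}" for i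
      using that xs len by (auto simp: V_def l_def nth_mem)
    have idx: "xs ! (i - 1) \<noteq> xs ! (j - 1)" if "i \<in> {1..p}" "j \<in> {1..p}" "i \<noteq> j" for i j
      using that xs(2) len by (auto simp: nth_eq_iff_index_eq)
    have "disjoint_family_on (V l) {1..p}"
      unfolding disjoint_family_on_def using Vl nd(3) idx by (metis (no_types, lifting))
    moreover have "l \<in> lists (D \<times> UNIV)" using nd(1) xs by (auto simp: l_def)
    moreover have "ok l \<omega>" unfolding ok_def
    proof
      fix i assume i: "i \<in> {1..p}"
      have "S \<inter> V l i = {xs ! (i - 1)}"
      proof -
        have "x = xs ! (i - 1)" if "x \<in> S" "x \<in> V l i" for x
          using nd(2)[OF that(1)] nd(3)[OF that(1) Vl(2)[OF i]] that(2) Vl(1)[OF i] by blast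
        then show ?thesis using nd(2)[OF Vl(2)[OF i]] Vl[OF i] by blast
      qed
      then have "measure (K \<omega>) (V l i) = 1 / real p"
        using uniform_on_points_mass[OF k(1,2) p S, of "V l i"] by (simp add: V_def)
      then show "emeasure (K \<omega>) (V l i) = ennreal (1 / real p)"
        using finite_measure.emeasure_eq_measure[OF prob_space.finite_measure[OF k(1)], of "V l i"] by simp
    qed
    ultimately show ?thesis by (auto simp: L_def)
  qed
  obtain \<omega>0 where "\<omega>0 \<in> space P" "\<exists>S. uniform_on_points p S (K \<omega>0)"
    using AE_imp_bex[OF ae] by blast
  then have "L \<noteq> {}" using ex by blast
  define e where "e = from_nat_into L"
  have e: "range e = L" unfolding e_def using \<open>L \<noteq> {}\<close> L by (rule range_from_nat_into)
  have [measurable]: "(\<lambda>\<omega>. emeasure (K \<omega>) (V l i)) \<in> borel_measurable P" for l i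
    by (rule measurable_compose[OF measurable_prob_algebraD[OF K_measurable] measurable_emeasure_subprob_algebra]) (simp add: V_def)
  have [measurable]: "Measurable.pred P (ok l)" for l unfolding ok_def by measurable
  \<comment> \<open>The first suitable list in the enumeration. The value is unspecified if no list
    is suitable, which happens at most on a null set.\<close>
  define \<tau> where "\<tau> \<omega> = (LEAST n. ok (e n) \<omega>)" for \<omega>
  have [measurable]: "\<tau> \<in> measurable P (count_space UNIV)" unfolding \<tau>_def by measurable
  define bary where "bary l i \<omega> = real p *\<^sub>R (\<integral>x. indicator (V l i) x *\<^sub>R x \<partial>K \<omega>)" for l i \<omega>
  have [measurable]: "bary l i \<in> borel_measurable P" for l i
  proof -
    have "V l i \<in> sets borel" by (simp add: V_def)
    then have "(\<lambda>x. indicator (V l i) x *\<^sub>R x) \<in> borel_measurable (borel :: 'x measure)" by measurable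
    from measurable_compose[OF measurable_prob_algebraD[OF K_measurable] integral_measurable_subprob_algebra[OF this]]
    show ?thesis unfolding bary_def by measurable
  qed
  define b where "b i \<omega> = bary (e (\<tau> \<omega>)) i \<omega>" for i \<omega>
  have bm: "b i \<in> borel_measurable P" for i
  proof -
    have "(\<lambda>\<omega>. (\<lambda>n \<omega>. bary (e n) i \<omega>) (\<tau> \<omega>) \<omega>) \<in> borel_measurable P"
      by (rule measurable_compose_countable) measurable
    then show ?thesis by (simp add: b_def[abs_def])
  qed
  have "AE \<omega> in P. \<forall>A\<in>sets borel. emeasure (K \<omega>) A =
      ennreal (1 / real p) * (\<Sum>i=1..p. emeasure (return borel (b i \<omega>)) A)"
    using ae AE_space
  proof eventually_elim
    case (elim \<omega>)
    then obtain S where S: "uniform_on_points p S (K \<omega>)" by blast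
    note \<omega> = elim(2)
    note k = kernel_space[OF K_measurable \<omega>]
    have fS: "finite S" "card S = p" using S by (auto simp: uniform_on_points_def)
    define l where "l = e (\<tau> \<omega>)"
    obtain l' where "l' \<in> L" "ok l' \<omega>" using ex[OF \<omega> S] by blast
    then have "\<exists>n. ok (e n) \<omega>" using e by (metis rangeE)
    then have okl: "ok l \<omega>" unfolding l_def \<tau>_def by (rule LeastI_ex)
    have "l \<in> L" using e by (auto simp: l_def)
    then have disj: "disjoint_family_on (V l) {1..p}" by (simp add: L_def)
    have SV: "S \<inter> V l i = {b i \<omega>}" if i: "i \<in> {1..p}" for i
    proof -
      have "measure (K \<omega>) (V l i) = 1 / real p" using okl i by (simp add: ok_def measure_def)
      then have "card (S \<inter> V l i) = 1"
        using uniform_on_points_mass[OF k(1,2) p S, of "V l i"] p by (simp add: V_def)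
      then obtain y where y: "S \<inter> V l i = {y}" by (auto simp: card_1_singleton_iff)
      then have "b i \<omega> = y"
        using uniform_on_points_barycentre[OF k(1,2) p S, of "V l i" y] by (simp add: b_def bary_def l_def V_def)
      then show ?thesis using y by simp
    qed
    have inj: "inj_on (\<lambda>i. b i \<omega>) {1..p}"
    proof (rule inj_onI)
      fix i j assume ij: "i \<in> {1..p}" "j \<in> {1..p}" "b i \<omega> = b j \<omega>"
      then have "b i \<omega> \<in> V l i \<inter> V l j" using SV by blast
      show "i = j"
      proof (rule ccontr)
        assume "i \<noteq> j"
        then have "V l i \<inter> V l j = {}" using disj ij(1,2) unfolding disjoint_family_on_def by blast
        then show False using \<open>b i \<omega> \<in> V l i \<inter> V l j\<close> by blast
      qed
    qed
    have "(\<lambda>i. b i \<omega>) ` {1..p} \<subseteq> S" using SV by blast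
    then have img: "(\<lambda>i. b i \<omega>) ` {1..p} = S"
      using fS card_image[OF inj] by (intro card_subset_eq) auto
    show ?case
    proof
      fix A :: "'x set" assume A: "A \<in> sets borel"
      have "real (card (S \<inter> A)) = (\<Sum>x\<in>S. indicator A x)" using fS(1) by (simp add: indicator_def sum.If_cases Int_def)
      also have "\<dots> = (\<Sum>i=1..p. indicator A (b i \<omega>))" unfolding img[symmetric] using inj by (simp add: sum.reindex)
      finally have c: "real (card (S \<inter> A)) = (\<Sum>i=1..p. indicator A (b i \<omega>))" .
      have "emeasure (K \<omega>) A = ennreal (1 / real p * real (card (S \<inter> A)))"
        using uniform_on_points_mass[OF k(1,2) p S A]
          finite_measure.emeasure_eq_measure[OF prob_space.finite_measure[OF k(1)], of A] by simp
      also have "\<dots> = ennreal (1 / real p) * ennreal (\<Sum>i=1..p. indicator A (b i \<omega>))"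
        unfolding c[symmetric] by (rule ennreal_mult) auto
      also have "ennreal (\<Sum>i=1..p. indicator A (b i \<omega>)) = (\<Sum>i=1..p. emeasure (return borel (b i \<omega>)) A)"
        using A by (subst sum_ennreal[symmetric])
            (auto simp: indicator_def ennreal_of_nat_eq_real_of_nat intro!: sum.cong)
      finally show "emeasure (K \<omega>) A = ennreal (1 / real p) * (\<Sum>i=1..p. emeasure (return borel (b i \<omega>)) A)" .
    qed
  qed
  then show ?thesis using bm by blast
qed

end

section \<open>Equality of the atomic masses\<close>

context ergodic_random_flow
begin

text \<open>The levels c with full atomic mass form a nonempty set that is closed downwards and
  bounded by 1. At its supremum m almost all mass sits on atoms of mass at least m, by approximation
  from below; above m the dichotomy forces atomic mass 0, so no atom exceeds m. Finitely many atoms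
  of mass m make up the total mass 1.\<close>

lemma equal_atoms:
  assumes \<delta>: "0 < \<delta>" and pos: "0 < emeasure (mixture K) {z \<in> space (mixture K). ennreal \<delta> \<le> ball_mass 0 z}"
  shows "\<exists>p\<ge>1. AE \<omega> in P. \<exists>S. uniform_on_points p S (K \<omega>)"
proof -
  have space_mix: "space (mixture K) = space (borel \<Otimes>\<^sub>M P)"
    using sets_eq_imp_space_eq[OF sets_mixture[OF K_measurable]] .
  define \<Gamma> where "\<Gamma> = {z \<in> space (mixture K). ennreal \<delta> \<le> ball_mass 0 z}"
  have \<Gamma>: "\<Gamma> \<in> sets (borel \<Otimes>\<^sub>M P)" unfolding \<Gamma>_def space_mix by measurable
  have "emeasure (mixture K) \<Gamma> = (\<integral>\<^sup>+\<omega>. atomic_mass \<delta> \<omega> \<partial>P)"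
    unfolding emeasure_mixture[OF K_measurable \<Gamma>]
    by (rule nn_integral_cong)
      (auto simp: \<Gamma>_def space_mix atomic_mass_def atoms_def ball_mass_def space_pair_measure intro!: arg_cong2[of _ _ _ _ emeasure])
  then have "\<not> (AE \<omega> in P. atomic_mass \<delta> \<omega> = 0)"
  proof -
    have "(\<integral>\<^sup>+\<omega>. atomic_mass \<delta> \<omega> \<partial>P) \<noteq> 0"
      using pos \<open>emeasure (mixture K) \<Gamma> = _\<close> by (simp add: \<Gamma>_def)
    then show ?thesis by (simp add: nn_integral_0_iff_AE)
  qed
  define J where "J = {c. 0 < c \<and> (AE \<omega> in P. atomic_mass c \<omega> = 1)}"
  have \<delta>J: "\<delta> \<in> J" using \<open>\<not> (AE \<omega> in P. atomic_mass \<delta> \<omega> = 0)\<close> atomic_mass_dichotomy[of \<delta>] \<delta> by (auto simp: J_def)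
  have J1: "c \<le> 1" if cJ: "c \<in> J" for c
  proof -
    obtain \<omega> where \<omega>: "\<omega> \<in> space P" "atomic_mass c \<omega> = 1" using AE_imp_bex[of "\<lambda>\<omega>. atomic_mass c \<omega> = 1"] cJ by (auto simp: J_def)
    then have "atoms c \<omega> \<noteq> {}" by (auto simp: atomic_mass_def)
    then obtain x where "ennreal c \<le> emeasure (K \<omega>) {x}" by (auto simp: atoms_def)
    also have "\<dots> \<le> 1"
      by (rule subprob_space.subprob_emeasure_le_1[OF prob_space_imp_subprob_space[OF kernel_space(1)[OF K_measurable \<omega>(1)]]])
    finally show ?thesis by simp
  qed
  have Jdown: "c' \<in> J" if c: "c \<in> J" "0 < c'" "c' \<le> c" for c c'
  proof -
    have "AE \<omega> in P. atomic_mass c \<omega> = 1" using c by (simp add: J_def)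
    then have "AE \<omega> in P. atomic_mass c' \<omega> = 1" using AE_space
    proof eventually_elim
      case (elim \<omega>)
      have "atoms c \<omega> \<subseteq> atoms c' \<omega>"
        unfolding atoms_def using order_trans[OF ennreal_leI[OF c(3)]] by blast
      then have "atomic_mass c \<omega> \<le> atomic_mass c' \<omega>"
        unfolding atomic_mass_def using atoms_measurable[OF elim(2)] kernel_space(2)[OF K_measurable elim(2)]
        by (intro emeasure_mono) auto
      then have "1 \<le> atomic_mass c' \<omega>" using elim(1) by simp
      then show ?case using atomic_mass_le_1[OF elim(2), of c'] by (rule antisym[rotated])
    qed
    then show ?thesis using c by (simp add: J_def)
  qed
  have J: "J \<noteq> {}" using \<delta>J by blast
  have J_bdd: "bdd_above J" by (rule bdd_aboveI[of J 1]) (rule J1)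
  define m where "m = Sup J"
  have m: "0 < m" using cSup_upper[OF \<delta>J J_bdd] \<delta> by (simp add: m_def)
  \<comment> \<open>Each level has its own null set, so only countably many levels can be combined:
    two sequences converging to m replace all levels. The double successor keeps \<open>lo 0\<close>
    positive.\<close>
  define lo where "lo n = m * (1 - inverse (real (Suc (Suc n))))" for n
  define hi where "hi n = m + inverse (real (Suc n))" for n
  have lo_less: "lo n < m" "0 < lo n" for n
  proof -
    have "inverse (real (Suc (Suc n))) < 1" "0 < inverse (real (Suc (Suc n)))" by (auto simp: inverse_less_1_iff)
    then show "lo n < m" "0 < lo n" using m by (auto simp: lo_def)
  qed
  have lo1: "AE \<omega> in P. atomic_mass (lo n) \<omega> = 1" for n
  proof -
    obtain c where "c \<in> J" "lo n < c" using lo_less(1)[of n] less_cSup_iff[OF J J_bdd] by (auto simp: m_def)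
    then have "lo n \<in> J" using Jdown[OF _ lo_less(2), of c n] by simp
    then show ?thesis by (simp add: J_def)
  qed
  have hi0: "AE \<omega> in P. atomic_mass (hi n) \<omega> = 0" for n
  proof -
    have "hi n > m" by (simp add: hi_def)
    then have "hi n \<notin> J" using cSup_upper[OF _ J_bdd, of "hi n"] by (auto simp: m_def)
    then show ?thesis using atomic_mass_dichotomy[of "hi n"] \<open>hi n > m\<close> m by (auto simp: J_def)
  qed
  have lo_lim: "lo \<longlonglongrightarrow> m"
  proof -
    have "(\<lambda>n. m * (1 - inverse (real (Suc (Suc n))))) \<longlonglongrightarrow> m * (1 - 0)"
      by (intro tendsto_intros LIMSEQ_Suc[OF LIMSEQ_inverse_real_of_nat])
    then show ?thesis by (simp add: lo_def[abs_def])
  qed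
  have lo_all: "AE \<omega> in P. \<forall>n. atomic_mass (lo n) \<omega> = 1" using lo1 by (simp add: AE_all_countable)
  have hi_all: "AE \<omega> in P. \<forall>n. atomic_mass (hi n) \<omega> = 0" using hi0 by (simp add: AE_all_countable)
  have main: "AE \<omega> in P. \<exists>S. finite S \<and> real (card S) * m = 1 \<and> (\<forall>x\<in>S. emeasure (K \<omega>) {x} = ennreal m)"
    using lo_all hi_all AE_space
  proof eventually_elim
    case (elim \<omega>)
    note \<omega> = elim(3)
    interpret \<kappa>: prob_space "K \<omega>" by (rule kernel_space(1)[OF K_measurable \<omega>])
    note k = kernel_space(2,3)[OF K_measurable \<omega>]
    have meas: "{x} \<in> sets (K \<omega>)" for x using k by simp
    have at: "x \<in> atoms c \<omega> \<longleftrightarrow> c \<le> measure (K \<omega>) {x}" if "0 \<le> c" for x c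
      using that by (simp add: atoms_def \<kappa>.emeasure_eq_measure)
    have "AE x in K \<omega>. x \<in> atoms (lo n) \<omega>" for n
      using elim(1) atoms_measurable[OF \<omega>, of "lo n"] k
      by (intro \<kappa>.AE_I_eq_1) (auto simp: atomic_mass_def)
    then have "AE x in K \<omega>. \<forall>n. x \<in> atoms (lo n) \<omega>" by (simp add: AE_all_countable)
    then have ae: "AE x in K \<omega>. x \<in> atoms m \<omega>"
    proof eventually_elim
      case (elim x)
      have "lo n \<le> measure (K \<omega>) {x}" for n using elim at[of "lo n" x] lo_less(2)[of n] by simp
      then have "m \<le> measure (K \<omega>) {x}" by (intro LIMSEQ_le_const2[OF lo_lim]) auto
      then show ?case using at[of m x] m by simp
    qed
    have exact: "measure (K \<omega>) {x} = m" if x: "x \<in> atoms m \<omega>" for x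
    proof (rule antisym)
      show "m \<le> measure (K \<omega>) {x}" using x at[of m x] m by simp
      show "measure (K \<omega>) {x} \<le> m"
      proof (rule ccontr)
        assume "\<not> measure (K \<omega>) {x} \<le> m"
        then obtain n :: nat where n: "inverse (real (Suc n)) < measure (K \<omega>) {x} - m"
          using reals_Archimedean[of "measure (K \<omega>) {x} - m"] by auto
        have "0 \<le> hi n" using m by (simp add: hi_def)
        then have "x \<in> atoms (hi n) \<omega>" using n at[of "hi n" x] by (simp add: hi_def)
        then have "emeasure (K \<omega>) {x} \<le> atomic_mass (hi n) \<omega>"
          unfolding atomic_mass_def using atoms_measurable[OF \<omega>, of "hi n"] k by (intro emeasure_mono) auto
        then have "emeasure (K \<omega>) {x} = 0" using elim(2) by simp
        then show False using x m by (simp add: atoms_def ennreal_eq_0_iff)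
      qed
    qed
    have cardm: "real (card T) * m = measure (K \<omega>) T" if "finite T" "T \<subseteq> atoms m \<omega>" for T
    proof -
      have "measure (K \<omega>) T = (\<Sum>x\<in>T. measure (K \<omega>) {x})"
        using that meas by (intro \<kappa>.finite_measure_eq_sum_singleton) auto
      also have "\<dots> = (\<Sum>x\<in>T. m)" using that exact by (intro sum.cong) auto
      finally show ?thesis by simp
    qed
    \<comment> \<open>Each atom has mass m, so a finite set of them has at most 1 / m
      elements.\<close>
    have fin: "finite (atoms m \<omega>)"
    proof (rule finite_if_finite_subsets_card_bdd[THEN conjunct1])
      fix T assume "T \<subseteq> atoms m \<omega>" "finite T"
      then have "real (card T) * m \<le> 1" using cardm[of T] by simp
      then have "real (card T) \<le> 1 / m" using m by (simp add: pos_le_divide_eq)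
      then show "card T \<le> nat \<lfloor>1 / m\<rfloor>" by (simp add: le_nat_floor)
    qed
    have "measure (K \<omega>) (atoms m \<omega>) = 1"
      using ae atoms_measurable[OF \<omega>, of m] k by (subst \<kappa>.prob_eq_1) auto
    then have "real (card (atoms m \<omega>)) * m = 1" using cardm[OF fin] by simp
    then show ?case using fin exact by (auto simp: \<kappa>.emeasure_eq_measure)
  qed
  \<comment> \<open>One past suffices to read off p: \<open>card S * m = 1\<close> holds almost
    everywhere with the same m, so the number of atoms is constant.\<close>
  from AE_imp_bex[OF main] obtain \<omega>0 where
    "\<exists>S. finite S \<and> real (card S) * m = 1 \<and> (\<forall>x\<in>S. emeasure (K \<omega>0) {x} = ennreal m)" by (rule bexE)
  then obtain S0 where
    "finite S0 \<and> real (card S0) * m = 1 \<and> (\<forall>x\<in>S0. emeasure (K \<omega>0) {x} = ennreal m)" ..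
  then have S0: "finite S0" "real (card S0) * m = 1" by (rule conjunct1, elim conjE)
  define p where "p = card S0"
  have p: "p \<ge> 1" using S0 by (cases "card S0") (auto simp: p_def)
  have mp: "m = 1 / real p" using S0(2) p by (simp add: p_def field_simps)
  have "AE \<omega> in P. \<exists>S. uniform_on_points p S (K \<omega>)"
    using main
  proof eventually_elim
    case (elim \<omega>)
    then obtain S where S: "finite S" "real (card S) * m = 1" "\<forall>x\<in>S. emeasure (K \<omega>) {x} = ennreal m" by blast
    then have "card S = p" 
    proof -
      have "real (card S) * m = real p * m" using S(2) S0(2) by (simp add: p_def)
      then show ?thesis using m by simp
    qed
    then show ?case using S mp by (auto simp: uniform_on_points_def)
  qed
  then show ?thesis using p by blast
qed

end

section \<open>Regularity of the vector field and of the gluing maps\<close>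

lemma derivative_locally_bounded:
  fixes DF :: "'a::euclidean_space \<Rightarrow> 'a \<Rightarrow> 'a"
  assumes "\<And>y. onorm (DF y) \<le> C * (1 + norm y) powr N" "0 < C" "1 \<le> N"
  shows "\<exists>B. \<forall>y. norm y \<le> R \<longrightarrow> onorm (DF y) \<le> B"
proof (intro exI allI impI)
  fix y :: 'a assume "norm y \<le> R"
  then have "C * (1 + norm y) powr N \<le> C * (1 + R) powr N"
    using assms by (intro mult_left_mono powr_mono2) auto
  then show "onorm (DF y) \<le> C * (1 + R) powr N" using assms(1)[of y] by linarith
qed

text \<open>The mean value inequality for F minus its linear part at y, on the ball around y of
  radius \<open>norm z\<close>. There the Hoelder condition bounds the derivative of this difference
  by M d^r.\<close>

lemma holder_derivative_uniformly_differentiable: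
  fixes F :: "'a::euclidean_space \<Rightarrow> 'a"
  assumes dF: "\<And>y. (F has_derivative DF y) (at y)"
    and r: "0 < r" and C: "0 < C" and p: "1 \<le> p"
    and holder: "\<And>y z. onorm (\<lambda>v. DF y v - DF z v) \<le> C * (1 + norm y + norm z) powr p * norm (y - z) powr r"
    and e: "0 < e"
  shows "\<exists>d>0. \<forall>y z. norm y \<le> R \<longrightarrow> norm z \<le> d \<longrightarrow> norm (F (y + z) - F y - DF y z) \<le> e * norm z"
proof -
  \<comment> \<open>For \<open>norm y \<le> R\<close> and u within distance 1 of y, the growth
    factor 1 + \<open>norm u\<close> + \<open>norm y\<close> is at most 2 + 2 \<bar>R\<bar>.\<close>
  define M where "M = C * (2 + 2 * \<bar>R\<bar>) powr p"
  have M: "0 < M" using C by (simp add: M_def)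
  define d where "d = min 1 ((e / M) powr (1 / r))"
  have d: "0 < d" "d \<le> 1" using e M by (auto simp: d_def)
  have dM: "M * d powr r \<le> e"
  proof -
    have "d powr r \<le> ((e / M) powr (1 / r)) powr r" using d r by (intro powr_mono2) (auto simp: d_def)
    also have "\<dots> = e / M" using r e M by (simp add: powr_powr)
    finally show ?thesis using M by (simp add: pos_le_divide_eq mult.commute)
  qed
  have "norm (F (y + z) - F y - DF y z) \<le> e * norm z" if y: "norm y \<le> R" and z: "norm z \<le> d" for y z
  proof -
    interpret Dy: bounded_linear "DF y" by (rule has_derivative_bounded_linear[OF dF])
    have "norm ((F (y + z) - DF y (y + z)) - (F y - DF y y)) \<le> e * norm ((y + z) - y)"
    proof (rule differentiable_bound[of "cball y (norm z)" "\<lambda>u. F u - DF y u" "\<lambda>u v. DF u v - DF y v"])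
      fix u assume u: "u \<in> cball y (norm z)"
      show "((\<lambda>u. F u - DF y u) has_derivative (\<lambda>v. DF u v - DF y v)) (at u within cball y (norm z))"
        by (intro has_derivative_diff has_derivative_at_withinI[OF dF]
          has_derivative_at_withinI[OF bounded_linear_imp_has_derivative[OF Dy.bounded_linear_axioms]])
      have uy: "norm (u - y) \<le> d" using u z by (simp add: dist_norm norm_minus_commute)
      have "norm u \<le> norm y + norm (u - y)" using norm_triangle_ineq[of y "u - y"] by simp
      then have nu: "1 + norm u + norm y \<le> 2 + 2 * \<bar>R\<bar>" using uy d y by linarith
      have "onorm (\<lambda>v. DF u v - DF y v) \<le> C * (1 + norm u + norm y) powr p * norm (u - y) powr r" by (rule holder)
      also have "\<dots> \<le> C * (2 + 2 * \<bar>R\<bar>) powr p * d powr r"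
        using C p r uy nu by (intro mult_mono mult_left_mono powr_mono2) auto
      also have "\<dots> \<le> e" using dM by (simp add: M_def)
      finally show "onorm (\<lambda>v. DF u v - DF y v) \<le> e" .
    qed (auto simp: dist_norm)
    then show ?thesis by (simp add: Dy.add algebra_simps)
  qed
  then show ?thesis using d by blast
qed

lemma norm_diff_le_of_onorm_less:
  fixes f :: "'a::euclidean_space \<Rightarrow> 'b::euclidean_space"
  assumes f: "f differentiable at x" and a: "onorm (frechet_derivative f (at x)) < a"
  shows "\<exists>d>0. \<forall>h. norm h < d \<longrightarrow> norm (f (x + h) - f x) \<le> a * norm h"
proof -
  let ?A = "frechet_derivative f (at x)"
  have der: "(f has_derivative ?A) (at x)" using f frechet_derivative_works by blast
  define e where "e = a - onorm ?A"
  have e: "0 < e" using a by (simp add: e_def)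
  obtain d where d: "d > 0" "\<And>y. norm (y - x) < d \<Longrightarrow> norm (f y - f x - ?A (y - x)) \<le> e * norm (y - x)"
    using der e unfolding has_derivative_at_alt by blast
  have "norm (f (x + h) - f x) \<le> a * norm h" if "norm h < d" for h
  proof -
    have "norm (f (x + h) - f x) \<le> norm (f (x + h) - f x - ?A h) + norm (?A h)"
      using norm_triangle_ineq[of "f (x + h) - f x - ?A h" "?A h"] by simp
    also have "\<dots> \<le> e * norm h + onorm ?A * norm h"
      using d(2)[of "x + h"] that onorm[OF has_derivative_bounded_linear[OF der], of h] by (intro add_mono) auto
    finally show ?thesis by (simp add: e_def algebra_simps)
  qed
  then show ?thesis using d(1) by blast
qed

text \<open>Caratheodory functions are jointly measurable: replacing x by simple functions
  converging to it leaves finitely many cases, and continuity passes to the limit.\<close>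

lemma measurable_continuous_parameter:
  fixes f :: "'a::euclidean_space \<Rightarrow> 'w \<Rightarrow> 'b::euclidean_space"
  assumes meas: "\<And>x. f x \<in> borel_measurable M"
    and cont: "\<And>w. w \<in> space M \<Longrightarrow> continuous_on UNIV (\<lambda>x. f x w)"
  shows "(\<lambda>(x, w). f x w) \<in> borel_measurable (borel \<Otimes>\<^sub>M M)"
proof -
  have "(\<lambda>x::'a. x) \<in> borel_measurable borel" by simp
  then obtain q :: "nat \<Rightarrow> 'a \<Rightarrow> 'a" where q: "\<And>i. simple_function borel (q i)" "\<And>x. (\<lambda>i. q i x) \<longlonglongrightarrow> x"
    using borel_measurable_implies_sequence_metric[of "\<lambda>x::'a. x" borel 0] by auto
  show ?thesis
  proof (rule borel_measurable_LIMSEQ_metric)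
    fix i
    have fin: "finite (range (q i))" using q(1)[of i] by (simp add: simple_function_def)
    have "(\<lambda>z. f (q i (fst z)) (snd z)) \<in> borel_measurable (borel \<Otimes>\<^sub>M M)"
    proof (rule measurable_compose_countable'[where I="range (q i)" and f="\<lambda>x z. f x (snd z)" and g="\<lambda>z. q i (fst z)"])
      show "(\<lambda>z. f x (snd z)) \<in> borel_measurable (borel \<Otimes>\<^sub>M M)" for x
        by (rule measurable_compose[OF measurable_snd meas])
      have "q i \<in> measurable borel (count_space (range (q i)))"
        using measurable_sets[OF measurable_simple_function[OF q(1)[of i]]] by (intro measurableI) auto
      then show "(\<lambda>z. q i (fst z)) \<in> measurable (borel \<Otimes>\<^sub>M M) (count_space (range (q i)))"
        by (rule measurable_compose[OF measurable_fst])
      show "countable (range (q i))" using fin by (rule countable_finite)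
    qed
    then show "(\<lambda>(x, w). f (q i x) w) \<in> borel_measurable (borel \<Otimes>\<^sub>M M)" by (simp add: case_prod_beta)
  next
    fix z :: "'a \<times> 'w" assume "z \<in> space (borel \<Otimes>\<^sub>M M)"
    then have "snd z \<in> space M" by (auto simp: space_pair_measure)
    then have "(\<lambda>i. f (q i (fst z)) (snd z)) \<longlonglongrightarrow> f (fst z) (snd z)"
      by (intro continuous_on_tendsto_compose[OF cont q(2)]) auto
    then show "(\<lambda>i. case z of (x, w) \<Rightarrow> f (q i x) w) \<longlonglongrightarrow> (case z of (x, w) \<Rightarrow> f x w)"
      by (simp add: case_prod_beta)
  qed
qed

section \<open>Identities for the gluing maps\<close>

lemma glue_inner:
  assumes "- t \<le> s" "s \<le> 0"
  shows "glue t (\<omega>m, \<omega>p) s = \<omega>p (- s - t) - \<omega>p (- t)"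
  using assms by (simp add: glue_def)

lemma glue_outer:
  assumes "s \<le> - t" "0 \<le> t" "\<omega>m 0 = 0" "\<omega>p 0 = 0"
  shows "glue t (\<omega>m, \<omega>p) s = \<omega>m (s + t) - \<omega>p (- t)"
  using assms by (auto simp: glue_def)

lemma glue_cong:
  assumes "0 \<le> s" "s \<le> t" "\<And>u. - t \<le> u \<Longrightarrow> u \<le> 0 \<Longrightarrow> \<omega>p u = \<omega>p' u"
  shows "glue s (\<omega>m, \<omega>p) = glue s (\<omega>m, \<omega>p')"
proof
  fix u
  have "\<omega>p (- s) = \<omega>p' (- s)" using assms by simp
  moreover have "\<omega>p (- u - s) = \<omega>p' (- u - s)" if "- s \<le> u" "u \<le> 0" using assms that by simp
  ultimately show "glue s (\<omega>m, \<omega>p) u = glue s (\<omega>m, \<omega>p') u" by (simp add: glue_def)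
qed

lemma shift_glue:
  assumes t: "0 \<le> t" and "\<omega>m \<in> path_space h" "\<omega>p \<in> path_space h"
  shows "shift t (glue t (\<omega>m, \<omega>p)) = \<omega>m"
proof
  fix s
  have z: "\<omega>p 0 = 0" "\<And>s. 0 \<le> s \<Longrightarrow> \<omega>m s = 0" using assms by (auto simp: path_space_def)
  show "shift t (glue t (\<omega>m, \<omega>p)) s = \<omega>m s"
  proof (cases "s < 0")
    case True
    have "glue t (\<omega>m, \<omega>p) (s - t) = \<omega>m s - \<omega>p (- t)"
      using True t z by (subst glue_outer) auto
    moreover have "glue t (\<omega>m, \<omega>p) (- t) = - \<omega>p (- t)" using t z by (subst glue_inner) auto
    ultimately show ?thesis using True by (simp add: shift_def)
  next
    case False
    then show ?thesis using z by (cases "s = 0") (auto simp: shift_def)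
  qed
qed

lemma glue_glue_inner:
  assumes t: "0 \<le> t" and "\<omega>p 0 = 0" and u: "- t \<le> u" "u \<le> 0"
  shows "glue t (\<omega>, glue t (\<omega>m, \<omega>p)) u = \<omega>p u"
  using assms by (simp add: glue_inner)

text \<open>Gluing is linear in the pair of paths, so the zero past can be reached as a difference
  from any past \<eta>.\<close>

lemma glue_zero_left:
  assumes "\<eta> 0 = 0"
  shows "glue t (\<lambda>_. 0, \<omega>) = (\<lambda>s. glue t (\<eta>, \<omega>) s - glue t (\<eta>, \<lambda>_. 0) s)"
  using assms by (auto simp: glue_def fun_eq_iff)

section \<open>The fractional equation as a random flow\<close>

locale fractional_sde =
  fixes H \<alpha> :: real
    and F :: "real ^ 'd \<Rightarrow> real ^ ('d::finite)"
    and \<sigma> :: "real ^ 'd ^ 'd"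
    and P :: "'d path measure"
    and D :: "'d path \<Rightarrow> 'd path"
    and \<Phi> :: "real \<Rightarrow> 'd path \<times> 'd path \<Rightarrow> real ^ 'd \<Rightarrow> real ^ 'd"
    and \<mu> :: "((real ^ 'd) \<times> 'd path) measure"
    and Bt :: "'d path set"
    and \<kappa> :: "'d path \<Rightarrow> (real ^ 'd) measure"
  assumes H: "0 < H" "H < 1"
    and wiener: "wiener_measure H P"
    and frac: "frac_operator H P \<alpha> D"
    and standing: "standing_conditions H F \<sigma>"
    and flow: "solution_flow H D F \<sigma> \<Phi>"
    and \<mu>: "invariant_measure P \<Phi> \<mu>"
    and \<mu>_unique: "\<And>\<nu>. invariant_measure P \<Phi> \<nu> \<Longrightarrow> \<nu> = \<mu>"
    and disintegration: "equivariant_disintegration H P \<Phi> \<mu> Bt \<kappa>"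
begin

lemma sets_P [measurable_cong]: "sets P = sets (path_borel H)"
  using wiener by (simp add: wiener_measure_def)

lemma space_P: "space P = path_space H"
  using sets_eq_imp_space_eq[OF sets_P] by simp

sublocale P: prob_space P
  using wiener by (simp add: wiener_measure_def brownian_motion_def centered_gaussian_process_def)

lemma Bt: "Bt \<in> sets P" "emeasure P Bt = 1" "Bt \<subseteq> path_space H" "Bt \<noteq> {}"
proof -
  have "Bt \<in> sets P \<and> emeasure P Bt = 1"
    using disintegration unfolding equivariant_disintegration_def by (elim conjE) (rule conjI)
  then have *: "Bt \<in> sets P" "emeasure P Bt = 1" by simp_all
  then show "Bt \<in> sets P" "emeasure P Bt = 1" "Bt \<noteq> {}" by auto
  show "Bt \<subseteq> path_space H" using sets.sets_into_space[OF *(1)] by (simp add: space_P)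
qed

lemma AE_Bt: "AE \<omega> in P. \<omega> \<in> Bt"
  using Bt by (intro P.AE_prob_1) (simp add: measure_def)

lemma zero_at: "\<omega> \<in> path_space H \<Longrightarrow> 0 \<le> t \<Longrightarrow> \<omega> t = 0"
  by (simp add: path_space_def)

definition base_path :: "'d path" where "base_path = (SOME \<omega>. \<omega> \<in> Bt)"

text \<open>The retraction onto \<open>Bt\<close> makes the flow and the kernels total.\<close>

definition retr :: "'d path \<Rightarrow> 'd path" where
  "retr \<omega> = (if \<omega> \<in> Bt then \<omega> else base_path)"

lemma retr_Bt: "retr \<omega> \<in> Bt"
  using Bt(4) some_in_eq[of Bt] by (auto simp: retr_def base_path_def)

lemma retr_path_space: "retr \<omega> \<in> path_space H"
  using retr_Bt Bt(3) by blast

lemma retr_id: "\<omega> \<in> Bt \<Longrightarrow> retr \<omega> = \<omega>"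
  by (simp add: retr_def)

lemma retr_measurable [measurable]: "retr \<in> measurable P P"
proof -
  have "base_path \<in> space P" using Bt(3,4) some_in_eq[of Bt] by (auto simp: base_path_def space_P)
  then show ?thesis unfolding retr_def using Bt(1) by measurable
qed

definition G :: "real \<Rightarrow> 'd path \<times> 'd path \<Rightarrow> 'd path" where
  "G t \<omega> = glue t (retr (fst \<omega>), snd \<omega>)"

definition V :: "real \<Rightarrow> 'd path \<times> 'd path \<Rightarrow> real ^ 'd \<Rightarrow> real ^ 'd" where
  "V t \<omega> x = \<Phi> t (retr (fst \<omega>), snd \<omega>) x"

definition K :: "'d path \<Rightarrow> (real ^ 'd) measure" where
  "K \<omega> = \<kappa> (retr \<omega>)"

lemma \<kappa>_prob_space: "\<omega> \<in> Bt \<Longrightarrow> prob_space (\<kappa> \<omega>)"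
  and sets_\<kappa>: "\<omega> \<in> Bt \<Longrightarrow> sets (\<kappa> \<omega>) = sets borel"
proof -
  have *: "\<forall>\<omega>\<in>Bt. prob_space (\<kappa> \<omega>) \<and> sets (\<kappa> \<omega>) = sets borel"
    using disintegration unfolding equivariant_disintegration_def by (elim conjE)
  show "\<omega> \<in> Bt \<Longrightarrow> prob_space (\<kappa> \<omega>)" "\<omega> \<in> Bt \<Longrightarrow> sets (\<kappa> \<omega>) = sets borel" using * by simp_all
qed

lemma \<kappa>_measurable:
  "A \<in> sets borel \<Longrightarrow> (\<lambda>\<omega>. emeasure (\<kappa> \<omega>) A) \<in> borel_measurable (restrict_space P Bt)"
  using disintegration unfolding equivariant_disintegration_def by (elim conjE) (rule bspec)

lemma \<mu>_rectangle:
  "A \<in> sets borel \<Longrightarrow> E \<in> sets P \<Longrightarrow>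
    emeasure \<mu> (A \<times> E) = (\<integral>\<^sup>+\<omega>\<in>E \<inter> Bt. emeasure (\<kappa> \<omega>) A \<partial>P)"
  using disintegration unfolding equivariant_disintegration_def by (elim conjE) (drule bspec, assumption, erule bspec)

lemma glue_Bt:
  assumes "\<omega>m \<in> Bt" "\<omega>p \<in> path_space H" "0 \<le> t"
  shows "glue t (\<omega>m, \<omega>p) \<in> Bt" "distr (\<kappa> \<omega>m) borel (\<Phi> t (\<omega>m, \<omega>p)) = \<kappa> (glue t (\<omega>m, \<omega>p))"
proof -
  have "\<forall>\<omega>m\<in>Bt. \<forall>\<omega>p\<in>path_space H. \<forall>t\<ge>0. glue t (\<omega>m, \<omega>p) \<in> Bt \<and>
      distr (\<kappa> \<omega>m) borel (\<Phi> t (\<omega>m, \<omega>p)) = \<kappa> (glue t (\<omega>m, \<omega>p))"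
    using disintegration unfolding equivariant_disintegration_def by (elim conjE)
  then show "glue t (\<omega>m, \<omega>p) \<in> Bt" "distr (\<kappa> \<omega>m) borel (\<Phi> t (\<omega>m, \<omega>p)) = \<kappa> (glue t (\<omega>m, \<omega>p))"
    using assms by simp_all
qed

lemma space_PP: "\<omega> \<in> space (P \<Otimes>\<^sub>M P) \<longleftrightarrow> fst \<omega> \<in> path_space H \<and> snd \<omega> \<in> path_space H"
  by (cases \<omega>) (simp add: space_pair_measure space_P)

lemma G_Bt: "0 \<le> t \<Longrightarrow> \<omega> \<in> space (P \<Otimes>\<^sub>M P) \<Longrightarrow> G t \<omega> \<in> Bt"
  unfolding G_def by (intro glue_Bt retr_Bt) (auto simp: space_PP)

lemma K_equivariance:
  "0 \<le> t \<Longrightarrow> \<omega> \<in> space (P \<Otimes>\<^sub>M P) \<Longrightarrow> distr (K (fst \<omega>)) borel (V t \<omega>) = K (G t \<omega>)"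
proof -
  assume t: "0 \<le> t" and \<omega>: "\<omega> \<in> space (P \<Otimes>\<^sub>M P)"
  then have "snd \<omega> \<in> path_space H" by (simp add: space_PP)
  from glue_Bt(2)[OF retr_Bt this t] show "distr (K (fst \<omega>)) borel (V t \<omega>) = K (G t \<omega>)"
    unfolding K_def V_def[abs_def] retr_id[OF G_Bt[OF t \<omega>]] unfolding G_def by simp
qed

lemma path_eval [measurable]: "(\<lambda>\<omega>. \<omega> t) \<in> borel_measurable P"
  using measurable_path_eval[OF H(2), of t] by (simp cong: measurable_cong_sets add: sets_P)

lemma G_measurable:
  assumes t: "0 \<le> t"
  shows "G t \<in> measurable (P \<Otimes>\<^sub>M P) P"
proof -
  have "G t \<in> measurable (P \<Otimes>\<^sub>M P) (path_borel H)"
  proof (rule measurable_path_borelI[OF H])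
    show "G t \<omega> \<in> path_space H" if "\<omega> \<in> space (P \<Otimes>\<^sub>M P)" for \<omega>
      using G_Bt[OF t that] Bt(3) by blast
    fix s :: real
    have [measurable]: "(\<lambda>\<omega>. retr (fst \<omega>) u) \<in> borel_measurable (P \<Otimes>\<^sub>M P)"
      "(\<lambda>\<omega>. snd \<omega> u) \<in> borel_measurable (P \<Otimes>\<^sub>M P)" for u
      using measurable_compose[OF measurable_compose[OF measurable_fst retr_measurable] path_eval[of u]]
        measurable_compose[OF measurable_snd path_eval[of u]] by auto
    show "(\<lambda>\<omega>. G t \<omega> s) \<in> borel_measurable (P \<Otimes>\<^sub>M P)"
      unfolding G_def glue_def prod.case by measurable
  qed
  then show ?thesis by (simp cong: measurable_cong_sets add: sets_P)
qed

section \<open>Regularity of the flow of the equation\<close>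

definition lipschitz_const :: real where
  "lipschitz_const = (SOME C. 0 < C \<and> (\<forall>x y. (F y - F x) \<bullet> (y - x) \<le> C * (norm (y - x))\<^sup>2))"

lemma lipschitz_const:
  "0 < lipschitz_const" "(F y - F x) \<bullet> (y - x) \<le> lipschitz_const * (norm (y - x))\<^sup>2"
proof -
  have "\<exists>C. 0 < C \<and> (\<forall>x y. (F y - F x) \<bullet> (y - x) \<le> C * (norm (y - x))\<^sup>2)"
  proof -
    obtain C1 C2 C3 where "0 < C3" "\<And>\<xi>1 \<xi>2. (F \<xi>2 - F \<xi>1) \<bullet> (\<xi>2 - \<xi>1)
        \<le> min (C1 - C2 * (norm (\<xi>2 - \<xi>1))\<^sup>2) (C3 * (norm (\<xi>2 - \<xi>1))\<^sup>2)"
    proof -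
      have "\<exists>C1>0. \<exists>C2>0. \<exists>C3>0. \<forall>\<xi>1 \<xi>2. (F \<xi>2 - F \<xi>1) \<bullet> (\<xi>2 - \<xi>1)
        \<le> min (C1 - C2 * (norm (\<xi>2 - \<xi>1))\<^sup>2) (C3 * (norm (\<xi>2 - \<xi>1))\<^sup>2)"
        using standing unfolding standing_conditions_def by (elim conjE)
      then show ?thesis using that by blast
    qed
    then show ?thesis by (intro exI[of _ C3]) simp
  qed
  from someI_ex[OF this] show "0 < lipschitz_const" "(F y - F x) \<bullet> (y - x) \<le> lipschitz_const * (norm (y - x))\<^sup>2"
    unfolding lipschitz_const_def by auto
qed

lemma F_derivative: "(F has_derivative frechet_derivative F (at x)) (at x)"
proof -
  have "\<forall>\<xi>. F differentiable (at \<xi>)" using standing unfolding standing_conditions_def by (elim conjE)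
  then show ?thesis using frechet_derivative_works by blast
qed

sublocale F: one_sided_lipschitz F lipschitz_const
proof
  show "continuous_on UNIV F"
    by (intro continuous_at_imp_continuous_on ballI has_derivative_continuous[OF F_derivative])
  show "0 \<le> lipschitz_const" using lipschitz_const(1) by (rule less_imp_le)
qed (rule lipschitz_const(2))

definition \<beta> :: "'d path \<times> 'd path \<Rightarrow> real \<Rightarrow> real ^ 'd" where
  "\<beta> \<omega> t = \<sigma> *v driving_fbm D t \<omega>"

lemma \<Phi>_solution:
  assumes "\<omega>m \<in> path_space H" "\<omega>p \<in> path_space H" "0 \<le> T"
  shows "driven_solution F (\<beta> (\<omega>m, \<omega>p)) T x (\<lambda>t. \<Phi> t (\<omega>m, \<omega>p) x)"
proof -
  have "(\<omega>m, \<omega>p) \<in> path_space H \<times> path_space H" using assms by simp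
  then have *: "continuous_on {0..} (\<lambda>t. \<Phi> t (\<omega>m, \<omega>p) x)"
    "\<forall>t\<ge>0. ((\<lambda>s. F (\<Phi> s (\<omega>m, \<omega>p) x)) has_integral
      (\<Phi> t (\<omega>m, \<omega>p) x - x - \<sigma> *v driving_fbm D t (\<omega>m, \<omega>p))) {0..t}"
    using flow[unfolded solution_flow_def, THEN bspec, THEN spec, of "(\<omega>m, \<omega>p)" x] by simp_all
  have "continuous_on {0..T} (\<lambda>t. \<Phi> t (\<omega>m, \<omega>p) x)" by (rule continuous_on_subset[OF *(1)]) auto
  then show ?thesis using *(2) by (simp add: driven_solution_def \<beta>_def)
qed

text \<open>Read off the equation itself: the noise is the solution from 0 minus the integral of F
  along it, and both are continuous in time. This avoids examining D along the moving family
  \<open>glue t\<close>.\<close>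

lemma \<beta>_continuous:
  assumes "\<omega>m \<in> path_space H" "\<omega>p \<in> path_space H" "0 \<le> T"
  shows "continuous_on {0..T} (\<beta> (\<omega>m, \<omega>p))"
proof -
  let ?X = "\<lambda>t. \<Phi> t (\<omega>m, \<omega>p) 0"
  have X: "driven_solution F (\<beta> (\<omega>m, \<omega>p)) T 0 ?X" by (rule \<Phi>_solution[OF assms])
  then have cX: "continuous_on {0..T} ?X" by (simp add: driven_solution_def)
  have eq: "?X t - integral {0..t} (\<lambda>s. F (?X s)) = \<beta> (\<omega>m, \<omega>p) t" if "t \<in> {0..T}" for t
  proof -
    have "((\<lambda>s. F (?X s)) has_integral (?X t - 0 - \<beta> (\<omega>m, \<omega>p) t)) {0..t}"
      using X that unfolding driven_solution_def by blast
    from integral_unique[OF this] show ?thesis by simp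
  qed
  have "continuous_on {0..T} (\<lambda>t. ?X t - integral {0..t} (\<lambda>s. F (?X s)))"
    by (intro continuous_on_diff cX indefinite_integral_continuous_1 integrable_continuous_real
      F.continuous_F_comp)
  then show ?thesis using eq by (rule continuous_on_eq)
qed

lemma D_measurable: "D \<in> measurable P (path_borel (1 - H))"
proof -
  have D: "continuous_map (path_top H) (path_top (1 - H)) D" using frac unfolding frac_operator_def by (elim conjE)
  have top: "topspace (path_top h) = (path_space h :: 'd path set)" for h
    using Metric_space.topspace_mtopology[OF Metric_space_path_space, of h] by (simp add: path_top_def)
  have "D \<in> measurable (path_borel H) (path_borel (1 - H))"
    unfolding path_borel_def[of "1 - H"]
  proof (rule measurable_measure_of)
    show "{U. openin (path_top (1 - H)) U} \<subseteq> Pow (path_space (1 - H) :: 'd path set)"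
      using openin_subset top by blast
    show "D \<in> space (path_borel H) \<rightarrow> path_space (1 - H)"
      using continuous_map_image_subset_topspace[OF D] by (auto simp: top)
    fix U :: "'d path set" assume "U \<in> {U. openin (path_top (1 - H)) U}"
    then have "openin (path_top H) {\<omega> \<in> topspace (path_top H). D \<omega> \<in> U}"
      using openin_continuous_map_preimage[OF D] by blast
    moreover have "{\<omega> \<in> topspace (path_top H). D \<omega> \<in> U} = D -` U \<inter> space (path_borel H)" by (auto simp: top)
    ultimately show "D -` U \<inter> space (path_borel H) \<in> sets (path_borel H)" by (auto simp: sets_path_borel)
  qed
  then show ?thesis by (simp cong: measurable_cong_sets add: sets_P)
qed

lemma \<beta>_measurable:
  assumes t: "0 \<le> t"
  shows "(\<lambda>\<omega>. \<beta> (retr (fst \<omega>), snd \<omega>) t) \<in> borel_measurable (P \<Otimes>\<^sub>M P)"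
proof -
  have "(\<lambda>\<omega>. D (G t \<omega>) (- t)) \<in> borel_measurable (P \<Otimes>\<^sub>M P)"
    using measurable_compose[OF measurable_compose[OF G_measurable[OF t] D_measurable] measurable_path_eval] H by simp
  then have "(\<lambda>\<omega>. - D (G t \<omega>) (- t)) \<in> borel_measurable (P \<Otimes>\<^sub>M P)" by measurable
  moreover have "(\<lambda>v. \<sigma> *v v) \<in> borel_measurable borel"
    by (intro borel_measurable_continuous_onI linear_continuous_on matrix_vector_mul_bounded_linear)
  ultimately have "(\<lambda>\<omega>. \<sigma> *v (- D (G t \<omega>) (- t))) \<in> borel_measurable (P \<Otimes>\<^sub>M P)"
    by (rule measurable_compose)
  then show ?thesis by (simp add: \<beta>_def driving_fbm_def G_def)
qed

lemma V_solution:
  assumes "\<omega> \<in> space (P \<Otimes>\<^sub>M P)" "0 \<le> T"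
  shows "driven_solution F (\<beta> (retr (fst \<omega>), snd \<omega>)) T x (\<lambda>t. V t \<omega> x)"
proof -
  have "snd \<omega> \<in> path_space H" using assms(1) by (simp add: space_PP)
  from \<Phi>_solution[OF retr_path_space this assms(2)] show ?thesis unfolding V_def .
qed

lemma V_noise_continuous:
  assumes "\<omega> \<in> space (P \<Otimes>\<^sub>M P)" "0 \<le> T"
  shows "continuous_on {0..T} (\<beta> (retr (fst \<omega>), snd \<omega>))"
proof -
  have "snd \<omega> \<in> path_space H" using assms(1) by (simp add: space_PP)
  from \<beta>_continuous[OF retr_path_space this assms(2)] show ?thesis .
qed

lemma V_lipschitz:
  assumes "0 \<le> t" "\<omega> \<in> space (P \<Otimes>\<^sub>M P)"
  shows "norm (V t \<omega> y - V t \<omega> x) \<le> exp ((lipschitz_const + 1) * t) * norm (y - x)"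
  by (rule F.driven_solution_lipschitz[OF assms(1) V_solution V_solution, OF assms(2,1) assms(2,1)])

text \<open>For fixed x the solution at time t is a functional of the noise path on [0, t],
  continuous for uniform convergence, so measurability of the noise at each time suffices. Joint
  measurability follows from Lipschitz continuity in x.\<close>

lemma V_measurable:
  assumes t: "0 \<le> t"
  shows "(\<lambda>(x, \<omega>). V t \<omega> x) \<in> borel_measurable (borel \<Otimes>\<^sub>M (P \<Otimes>\<^sub>M P))"
proof (rule measurable_continuous_parameter)
  fix x
  show "(\<lambda>\<omega>. V t \<omega> x) \<in> borel_measurable (P \<Otimes>\<^sub>M P)"
  proof (rule borel_measurable_path_functional[OF t, where \<beta>="\<lambda>s \<omega>. \<beta> (retr (fst \<omega>), snd \<omega>) s"])
    show "(\<lambda>\<omega>. \<beta> (retr (fst \<omega>), snd \<omega>) s) \<in> borel_measurable (P \<Otimes>\<^sub>M P)" if "s \<in> {0..t}" for s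
      using that by (intro \<beta>_measurable) simp
    show "continuous_on {0..t} (\<beta> (retr (fst \<omega>), snd \<omega>))" if "\<omega> \<in> space (P \<Otimes>\<^sub>M P)" for \<omega>
      using that t by (rule V_noise_continuous)
    fix \<omega> and e :: real assume \<omega>: "\<omega> \<in> space (P \<Otimes>\<^sub>M P)" and e: "0 < e"
    show "\<exists>d>0. \<forall>w'\<in>space (P \<Otimes>\<^sub>M P). (\<forall>s\<in>{0..t}. norm (\<beta> (retr (fst w'), snd w') s - \<beta> (retr (fst \<omega>), snd \<omega>) s) \<le> d)
        \<longrightarrow> dist (V t w' x) (V t \<omega> x) < e"
    proof (rule F.driven_solution_noise_continuous[OF t V_solution[OF \<omega> t] V_noise_continuous[OF \<omega> t] e])
      fix d :: real assume d: "0 < d" "\<And>\<beta>' Y. driven_solution F \<beta>' t x Y \<Longrightarrow> continuous_on {0..t} \<beta>' \<Longrightarrow>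
        (\<And>s. s \<in> {0..t} \<Longrightarrow> norm (\<beta>' s - \<beta> (retr (fst \<omega>), snd \<omega>) s) \<le> d) \<Longrightarrow> norm (Y t - V t \<omega> x) < e"
      show ?thesis
      proof (intro exI[of _ d] conjI ballI impI d(1))
        fix w' assume w': "w' \<in> space (P \<Otimes>\<^sub>M P)"
          and near: "\<forall>s\<in>{0..t}. norm (\<beta> (retr (fst w'), snd w') s - \<beta> (retr (fst \<omega>), snd \<omega>) s) \<le> d"
        show "dist (V t w' x) (V t \<omega> x) < e"
          unfolding dist_norm by (rule d(2)[OF V_solution[OF w' t] V_noise_continuous[OF w' t]]) (rule bspec[OF near])
      qed
    qed
  qed
next
  fix \<omega> assume \<omega>: "\<omega> \<in> space (P \<Otimes>\<^sub>M P)"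
  have "(exp ((lipschitz_const + 1) * t))-lipschitz_on UNIV (V t \<omega>)"
    using V_lipschitz[OF t \<omega>] by (intro lipschitz_onI) (auto simp: dist_norm)
  then show "continuous_on UNIV (\<lambda>x. V t \<omega> x)" using lipschitz_on_continuous_on by blast
qed

lemma K_measurable: "K \<in> measurable P (prob_algebra borel)"
proof (rule measurable_prob_algebraI)
  show ps: "prob_space (K \<omega>)" for \<omega> using \<kappa>_prob_space[OF retr_Bt] by (simp add: K_def)
  show "K \<in> measurable P (subprob_algebra borel)"
  proof (rule measurable_subprob_algebra)
    show "subprob_space (K \<omega>)" for \<omega> by (rule prob_space_imp_subprob_space[OF ps])
    show "sets (K \<omega>) = sets borel" for \<omega> using sets_\<kappa>[OF retr_Bt] by (simp add: K_def)
    fix A :: "(real ^ 'd) set" assume "A \<in> sets borel"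
    then have "(\<lambda>\<omega>. emeasure (\<kappa> \<omega>) A) \<in> borel_measurable (restrict_space P Bt)"
      by (rule \<kappa>_measurable)
    moreover have "retr \<in> measurable P (restrict_space P Bt)"
      by (intro measurable_restrict_space2 retr_measurable) (auto simp: retr_Bt)
    ultimately show "(\<lambda>\<omega>. emeasure (K \<omega>) A) \<in> borel_measurable P"
      unfolding K_def by (rule measurable_compose[rotated])
  qed
qed

section \<open>Invariance of the noise law under gluing\<close>

lemma sets_\<mu>: "sets \<mu> = sets (borel \<Otimes>\<^sub>M P)"
  and distr_\<mu>: "distr \<mu> P snd = P"
  and \<mu>_transition: "0 \<le> t \<Longrightarrow> \<Gamma> \<in> sets (borel \<Otimes>\<^sub>M P) \<Longrightarrow> (\<integral>\<^sup>+z. transition P \<Phi> t z \<Gamma> \<partial>\<mu>) = emeasure \<mu> \<Gamma>"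
  using \<mu> by (auto simp: invariant_measure_def)

lemma AE_snd_Bt:
  assumes \<nu>: "sets \<nu> = sets (borel \<Otimes>\<^sub>M P)" "distr \<nu> P snd = P"
  shows "AE z in \<nu>. snd z \<in> Bt"
proof -
  have "snd \<in> measurable \<nu> P" using \<nu>(1) by (simp cong: measurable_cong_sets)
  moreover have "AE \<omega> in distr \<nu> P snd. \<omega> \<in> Bt" unfolding \<nu>(2) by (rule AE_Bt)
  ultimately show ?thesis by (rule AE_distrD)
qed

lemma G_invariance:
  assumes t: "0 \<le> t"
  shows "distr (P \<Otimes>\<^sub>M P) P (G t) = P"
proof (rule measure_eqI)
  fix E assume "E \<in> sets (distr (P \<Otimes>\<^sub>M P) P (G t))"
  then have E[measurable]: "E \<in> sets P" by simp
  note [measurable] = G_measurable[OF t]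
  note cong[measurable_cong] = sets_\<mu>
  define h where "h \<omega> = (\<integral>\<^sup>+\<omega>p. indicator E (G t (\<omega>, \<omega>p)) \<partial>P)" for \<omega>
  have [measurable]: "h \<in> borel_measurable P" unfolding h_def by measurable
  have snd_m: "snd \<in> measurable \<mu> P" by measurable
  have "emeasure (distr (P \<Otimes>\<^sub>M P) P (G t)) E = (\<integral>\<^sup>+\<omega>. indicator E (G t \<omega>) \<partial>(P \<Otimes>\<^sub>M P))"
    using nn_integral_distr[OF G_measurable[OF t], of "indicator E"] by simp
  also have "\<dots> = (\<integral>\<^sup>+\<omega>. h \<omega> \<partial>P)"
    unfolding h_def by (rule P.nn_integral_fst[symmetric]) measurable
  also have "\<dots> = (\<integral>\<^sup>+z. h (snd z) \<partial>\<mu>)"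
    using nn_integral_distr[OF snd_m, of h] by (simp add: distr_\<mu>)
  \<comment> \<open>For an event UNIV \<times> E the transition probability ignores the state. The
    marginal of \<mu> puts the past in Bt almost surely, where the retraction acts as the
    identity.\<close>
  also have "\<dots> = (\<integral>\<^sup>+z. transition P \<Phi> t z (UNIV \<times> E) \<partial>\<mu>)"
  proof (rule nn_integral_cong_AE)
    show "AE z in \<mu>. h (snd z) = transition P \<Phi> t z (UNIV \<times> E)"
      using AE_snd_Bt[OF sets_\<mu> distr_\<mu>]
    proof eventually_elim
      case (elim z)
      then show ?case
        by (cases z) (auto simp: h_def transition_def G_def retr_id indicator_def intro!: nn_integral_cong)
    qed
  qed
  also have "\<dots> = emeasure \<mu> (UNIV \<times> E)" by (rule \<mu>_transition[OF t]) measurable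
  also have "UNIV \<times> E = snd -` E \<inter> space \<mu>"
    using sets_eq_imp_space_eq[OF sets_\<mu>] sets.sets_into_space[OF E] by (auto simp: space_pair_measure)
  also have "emeasure \<mu> (snd -` E \<inter> space \<mu>) = emeasure (distr \<mu> P snd) E"
    by (rule emeasure_distr[OF snd_m E, symmetric])
  also have "\<dots> = emeasure P E" by (simp add: distr_\<mu>)
  finally show "emeasure (distr (P \<Otimes>\<^sub>M P) P (G t)) E = emeasure P E" .
qed simp

sublocale random_flow P G V K
  by unfold_locales (fact G_measurable V_measurable K_measurable G_invariance K_equivariance)+

end

section \<open>Uniqueness and ergodicity\<close>

context fractional_sde
begin

lemma glue_path_space:
  assumes "\<omega>m \<in> Bt" "\<omega>p \<in> path_space H" "0 \<le> t"
  shows "glue t (\<omega>m, \<omega>p) \<in> path_space H"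
  using glue_Bt(1)[OF assms] Bt(3) by blast

text \<open>
  Whether gluing the zero path to \<open>\<omega>\<close> stays in the path space is read off from gluing to some
  path in \<open>Bt\<close>, by linearity.
\<close>

lemma glue_zero_path_space:
  assumes \<omega>: "(\<omega> :: 'd path) \<in> path_space H" and t: "0 \<le> t"
  shows "glue t (\<lambda>_. 0, \<omega>) \<in> path_space H"
proof -
  have "retr \<omega> 0 = 0" using zero_at[OF retr_path_space] by simp
  then show ?thesis
    unfolding glue_zero_left[of "retr \<omega>" t \<omega>, OF \<open>retr \<omega> 0 = 0\<close>]
    by (intro path_space_diff glue_path_space retr_Bt path_space_zero \<omega> t)
qed

text \<open>Up to time t the noise enters through \<open>glue s\<close> with s \<le> t, which reads
  the new path on [-t, 0] only; uniqueness of solutions concludes.\<close>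

lemma \<Phi>_noise_cong:
  assumes \<omega>m: "\<omega>m \<in> path_space H" and \<omega>p: "\<omega>p \<in> path_space H" "\<omega>p' \<in> path_space H" and t: "0 \<le> t"
    and eq: "\<And>u. - t \<le> u \<Longrightarrow> u \<le> 0 \<Longrightarrow> \<omega>p' u = \<omega>p u"
  shows "\<Phi> t (\<omega>m, \<omega>p') x = \<Phi> t (\<omega>m, \<omega>p) x"
proof (rule F.driven_solution_unique[OF t \<Phi>_solution[OF \<omega>m \<omega>p(1) t]])
  have "\<beta> (\<omega>m, \<omega>p') s = \<beta> (\<omega>m, \<omega>p) s" if "s \<in> {0..t}" for s
    using glue_cong[of s t \<omega>p' \<omega>p \<omega>m] that eq by (simp add: \<beta>_def driving_fbm_def)
  then show "driven_solution F (\<beta> (\<omega>m, \<omega>p)) t x (\<lambda>t. \<Phi> t (\<omega>m, \<omega>p') x)"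
    using \<Phi>_solution[OF \<omega>m \<omega>p(2) t, of x] driven_solution_noise_cong[of t "\<beta> (\<omega>m, \<omega>p')" "\<beta> (\<omega>m, \<omega>p)"] by blast
qed

text \<open>Cutting the glued path at -t recovers \<omega>m, but only the segment of \<omega>p over
  [-t, 0], continued by a constant. The solution up to time t does not see beyond this
  segment.\<close>

lemma past_flow_glue:
  assumes \<omega>m: "\<omega>m \<in> Bt" and \<omega>p: "\<omega>p \<in> path_space H" and t: "0 \<le> t"
  shows "past_flow \<Phi> t (glue t (\<omega>m, \<omega>p)) x = \<Phi> t (\<omega>m, \<omega>p) x"
proof -
  have \<omega>m': "\<omega>m \<in> path_space H" using \<omega>m Bt(3) by blast
  let ?a = "glue t (\<omega>m, \<omega>p)"
  have a: "?a \<in> path_space H" by (rule glue_path_space[OF \<omega>m \<omega>p t])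
  show ?thesis
  \<comment> \<open>Time 0 is separate because -t = 0 falls into the nonnegative branch of
    \<open>theta\<close>.\<close>
  proof (cases "t = 0")
    case True
    have "?a = \<omega>m" using zero_at[OF \<omega>m'] zero_at[OF \<omega>p] True by (auto simp: glue_def fun_eq_iff)
    moreover have "glue 0 (\<omega>m, \<lambda>_. 0) = \<omega>m" using zero_at[OF \<omega>m'] by (auto simp: glue_def fun_eq_iff)
    moreover have "Defs.shift 0 (\<lambda>_. 0) = (\<lambda>_. 0 :: real ^ 'd)" by (simp add: Defs.shift_def fun_eq_iff)
    ultimately have "theta (- t) (?a, \<lambda>_. 0) = (\<omega>m, \<lambda>_. 0)" using True by (simp add: theta_def)
    then show ?thesis unfolding past_flow_def
      using \<Phi>_noise_cong[OF \<omega>m' \<omega>p path_space_zero t] zero_at[OF \<omega>p] True by simp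
  next
    case False
    then have "theta (- t) (?a, \<lambda>_. 0) = (\<omega>m, glue t (\<lambda>_. 0, ?a))"
      using t shift_glue[OF t \<omega>m' \<omega>p] by (simp add: theta_def)
    moreover have "\<Phi> t (\<omega>m, glue t (\<lambda>_. 0, ?a)) x = \<Phi> t (\<omega>m, \<omega>p) x"
      using glue_zero_path_space[OF a t] zero_at[OF \<omega>p]
      by (intro \<Phi>_noise_cong[OF \<omega>m' \<omega>p _ t] glue_glue_inner[OF t]) auto
    ultimately show ?thesis by (simp add: past_flow_def)
  qed
qed

lemma transition_eq:
  assumes "0 \<le> t" "\<omega> \<in> Bt"
  shows "transition P \<Phi> t (x, \<omega>) \<Gamma> = (\<integral>\<^sup>+w. indicator \<Gamma> (V t (\<omega>, w) x, G t (\<omega>, w)) \<partial>P)"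
  unfolding transition_def prod.case
  using past_flow_glue[OF assms(2) _ assms(1)] assms(2)
  by (intro nn_integral_cong) (simp add: V_def G_def retr_id space_P)

lemma distr_mixture_snd:
  assumes \<rho>: "\<rho> \<in> measurable P (prob_algebra borel)"
  shows "distr (mixture \<rho>) P snd = P"
proof (rule measure_eqI)
  note [measurable_cong] = sets_mixture[OF \<rho>]
  fix E assume "E \<in> sets (distr (mixture \<rho>) P snd)"
  then have E[measurable]: "E \<in> sets P" by simp
  have "emeasure (distr (mixture \<rho>) P snd) E = emeasure (mixture \<rho>) (UNIV \<times> E)"
    using sets_eq_imp_space_eq[OF sets_mixture[OF \<rho>]] sets.sets_into_space[OF E]
    by (subst emeasure_distr) (auto simp: space_pair_measure intro!: arg_cong[of _ _ "emeasure (mixture \<rho>)"])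
  also have "\<dots> = (\<integral>\<^sup>+\<omega>. emeasure (\<rho> \<omega>) {x. (x, \<omega>) \<in> UNIV \<times> E} \<partial>P)"
    by (rule emeasure_mixture[OF \<rho>]) measurable
  also have "\<dots> = (\<integral>\<^sup>+\<omega>. indicator E \<omega> \<partial>P)"
  proof (rule nn_integral_cong)
    fix \<omega> assume "\<omega> \<in> space P"
    then show "emeasure (\<rho> \<omega>) {x. (x, \<omega>) \<in> UNIV \<times> E} = indicator E \<omega>"
      using prob_space.emeasure_space_1[OF kernel_space(1)[OF \<rho>]] kernel_space(3)[OF \<rho>]
      by (cases "\<omega> \<in> E") auto
  qed
  finally show "emeasure (distr (mixture \<rho>) P snd) E = emeasure P E" by simp
qed simp

text \<open>Over pasts in Bt the transition semigroup is the one-step kernel of V and G, and the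
  marginal P makes this almost sure. An almost everywhere equivariant kernel thus yields an
  invariant measure; through this the uniqueness of \<mu> reaches both K and its atomic
  part.\<close>

lemma invariant_mixture:
  assumes \<rho>: "\<rho> \<in> measurable P (prob_algebra borel)"
    and eq: "\<And>t. 0 \<le> t \<Longrightarrow> AE \<omega> in P \<Otimes>\<^sub>M P. distr (\<rho> (fst \<omega>)) borel (V t \<omega>) = \<rho> (G t \<omega>)"
  shows "mixture \<rho> = \<mu>"
proof (rule \<mu>_unique)
  have "(\<integral>\<^sup>+z. transition P \<Phi> t z \<Gamma> \<partial>mixture \<rho>) = emeasure (mixture \<rho>) \<Gamma>"
    if t: "0 \<le> t" and \<Gamma>: "\<Gamma> \<in> sets (mixture \<rho>)" for t \<Gamma>
  proof -
    have \<Gamma>'[measurable]: "\<Gamma> \<in> sets (borel \<Otimes>\<^sub>M P)" using \<Gamma> sets_mixture[OF \<rho>] by simp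
    have "(\<integral>\<^sup>+z. transition P \<Phi> t z \<Gamma> \<partial>mixture \<rho>) =
        (\<integral>\<^sup>+z. \<integral>\<^sup>+w. indicator \<Gamma> (V t (snd z, w) (fst z), G t (snd z, w)) \<partial>P \<partial>mixture \<rho>)"
    proof (rule nn_integral_cong_AE)
      show "AE z in mixture \<rho>. transition P \<Phi> t z \<Gamma> =
          (\<integral>\<^sup>+w. indicator \<Gamma> (V t (snd z, w) (fst z), G t (snd z, w)) \<partial>P)"
        using AE_snd_Bt[OF sets_mixture[OF \<rho>] distr_mixture_snd[OF \<rho>]]
      proof eventually_elim
        case (elim z)
        then show ?case using transition_eq[OF t, of "snd z" "fst z" \<Gamma>] by simp
      qed
    qed
    also have "\<dots> = (\<integral>\<^sup>+z. indicator \<Gamma> z \<partial>mixture \<rho>)"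
      by (rule nn_integral_mixture_step[OF t \<rho> eq[OF t]]) measurable
    also have "\<dots> = emeasure (mixture \<rho>) \<Gamma>" using \<Gamma> by simp
    finally show ?thesis .
  qed
  then show "invariant_measure P \<Phi> (mixture \<rho>)"
    using prob_space_mixture[OF \<rho>] sets_mixture[OF \<rho>] distr_mixture_snd[OF \<rho>]
    by (simp add: invariant_measure_def)
qed

lemma mixture_K: "mixture K = \<mu>"
  by (rule invariant_mixture[OF K_measurable K_equivariant_AE])

section \<open>The zero-one law for gluing\<close>

definition window_sets :: "'d path set set" where
  "window_sets = {C \<in> sets P. \<exists>T\<ge>0. \<forall>\<omega>\<in>space P. \<forall>\<omega>'\<in>space P.
    (\<forall>s. - T \<le> s \<longrightarrow> s \<le> 0 \<longrightarrow> \<omega> s = \<omega>' s) \<longrightarrow> (\<omega> \<in> C \<longleftrightarrow> \<omega>' \<in> C)}"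

lemma window_sets_Int_stable: "Int_stable window_sets"
proof (rule Int_stableI)
  fix A B assume "A \<in> window_sets" "B \<in> window_sets"
  then obtain S T where S: "0 \<le> S" "A \<in> sets P" "\<And>\<omega> \<omega>'. \<omega> \<in> space P \<Longrightarrow> \<omega>' \<in> space P \<Longrightarrow>
      (\<And>s. - S \<le> s \<Longrightarrow> s \<le> 0 \<Longrightarrow> \<omega> s = \<omega>' s) \<Longrightarrow> \<omega> \<in> A \<longleftrightarrow> \<omega>' \<in> A"
    and T: "0 \<le> T" "B \<in> sets P" "\<And>\<omega> \<omega>'. \<omega> \<in> space P \<Longrightarrow> \<omega>' \<in> space P \<Longrightarrow>
      (\<And>s. - T \<le> s \<Longrightarrow> s \<le> 0 \<Longrightarrow> \<omega> s = \<omega>' s) \<Longrightarrow> \<omega> \<in> B \<longleftrightarrow> \<omega>' \<in> B"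
    unfolding window_sets_def by blast
  have "\<omega> \<in> A \<inter> B \<longleftrightarrow> \<omega>' \<in> A \<inter> B"
    if "\<omega> \<in> space P" "\<omega>' \<in> space P" "\<forall>s. - max S T \<le> s \<longrightarrow> s \<le> 0 \<longrightarrow> \<omega> s = \<omega>' s" for \<omega> \<omega>'
    using S(3)[OF that(1,2)] T(3)[OF that(1,2)] that(3) by auto
  moreover have "0 \<le> max S T" using S(1) by simp
  ultimately show "A \<inter> B \<in> window_sets"
    unfolding window_sets_def using S(2) T(2) by blast
qed

lemma sets_P_window: "sets P = sigma_sets (space P) window_sets"
proof
  have "cylinders H \<subseteq> window_sets"
  proof
    fix X :: "'d path set" assume X: "X \<in> cylinders H"
    then obtain t A where t: "X = {\<omega> \<in> path_space H. \<omega> t \<in> A}" "t < 0" by (auto simp: cylinders_def)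
    have "X \<in> sets P" using X by (simp add: sets_P sets_path_borel_cylinders[OF H] sigma_sets.Basic)
    then show "X \<in> window_sets"
      unfolding window_sets_def using t by (auto simp: space_P intro!: exI[of _ "- t"])
  qed
  then show "sets P \<subseteq> sigma_sets (space P) window_sets"
    using sigma_sets_mono'[of "cylinders H" window_sets "space P"]
    by (simp add: sets_P sets_path_borel_cylinders[OF H] space_P)
  show "sigma_sets (space P) window_sets \<subseteq> sets P"
    by (rule sets.sigma_sets_subset) (auto simp: window_sets_def)
qed

text \<open>
  After gluing a time window of new noise, events of that window are independent of the old noise;
  hence an invariant event is independent of itself.
\<close>

lemma zero_one_law:
  assumes E: "E \<in> sets P"
    and inv: "\<And>t. 0 \<le> t \<Longrightarrow> AE \<omega> in P \<Otimes>\<^sub>M P. G t \<omega> \<in> E \<longleftrightarrow> fst \<omega> \<in> E"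
  shows "emeasure P E = 0 \<or> emeasure P E = 1"
proof -
  note [measurable] = E
  have indep: "emeasure P (E \<inter> C) = emeasure P E * emeasure P C" if C: "C \<in> window_sets" for C
  proof -
    obtain T where T: "0 \<le> T" and dep: "\<And>\<omega> \<omega>'. \<omega> \<in> space P \<Longrightarrow> \<omega>' \<in> space P \<Longrightarrow>
        (\<forall>s. - T \<le> s \<longrightarrow> s \<le> 0 \<longrightarrow> \<omega> s = \<omega>' s) \<Longrightarrow> \<omega> \<in> C \<longleftrightarrow> \<omega>' \<in> C"
      using C unfolding window_sets_def by blast
    have [measurable]: "C \<in> sets P" using C by (simp add: window_sets_def)
    note Gm[measurable] = G_measurable[OF T]
    have bp: "base_path \<in> space P" using Bt(3) retr_Bt[of undefined] some_in_eq[of Bt] Bt(4) by (auto simp: base_path_def space_P)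
    \<comment> \<open>A glued segment of length T fills the whole window, so membership in C depends
      on the new noise alone. The past \<open>base_path\<close> is an arbitrary choice used to
      express this event.\<close>
    define C' where "C' = {w \<in> space P. G T (base_path, w) \<in> C}"
    have [measurable]: "C' \<in> sets P"
      unfolding C'_def using measurable_compose_Pair1[OF bp Gm] by measurable
    have GC: "G T \<omega> \<in> C \<longleftrightarrow> snd \<omega> \<in> C'" if \<omega>: "\<omega> \<in> space (P \<Otimes>\<^sub>M P)" for \<omega>
    proof -
      have w: "snd \<omega> \<in> space P" using \<omega> by (auto simp: space_pair_measure)
      then have pw: "(base_path, snd \<omega>) \<in> space (P \<Otimes>\<^sub>M P)" using bp by (simp add: space_pair_measure)
      have "G T \<omega> \<in> C \<longleftrightarrow> G T (base_path, snd \<omega>) \<in> C"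
        using measurable_space[OF Gm \<omega>] measurable_space[OF Gm pw]
        by (intro dep) (auto simp: G_def glue_inner)
      then show ?thesis using w by (simp add: C'_def)
    qed
    have prod: "emeasure (P \<Otimes>\<^sub>M P) {\<omega> \<in> space (P \<Otimes>\<^sub>M P). fst \<omega> \<in> A \<and> snd \<omega> \<in> C'} = emeasure P A * emeasure P C'"
      if [measurable]: "A \<in> sets P" for A
    proof -
      have "{\<omega> \<in> space (P \<Otimes>\<^sub>M P). fst \<omega> \<in> A \<and> snd \<omega> \<in> C'} = A \<times> C'"
        using sets.sets_into_space[of A P] sets.sets_into_space[of C' P] by (auto simp: space_pair_measure)
      then show ?thesis by (simp add: P.emeasure_pair_measure_Times)
    qed
    have push: "emeasure P A = emeasure (P \<Otimes>\<^sub>M P) {\<omega> \<in> space (P \<Otimes>\<^sub>M P). G T \<omega> \<in> A}"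
      if A[measurable]: "A \<in> sets P" for A
    proof -
      have "emeasure P A = emeasure (distr (P \<Otimes>\<^sub>M P) P (G T)) A" by (simp add: G_invariance[OF T])
      also have "\<dots> = emeasure (P \<Otimes>\<^sub>M P) {\<omega> \<in> space (P \<Otimes>\<^sub>M P). G T \<omega> \<in> A}"
        by (subst emeasure_distr[OF Gm A]) (auto intro!: arg_cong[of _ _ "emeasure (P \<Otimes>\<^sub>M P)"])
      finally show ?thesis .
    qed
    have "emeasure P C = emeasure (P \<Otimes>\<^sub>M P) {\<omega> \<in> space (P \<Otimes>\<^sub>M P). fst \<omega> \<in> space P \<and> snd \<omega> \<in> C'}"
      unfolding push[OF \<open>C \<in> sets P\<close>]
      using GC by (intro arg_cong[of _ _ "emeasure (P \<Otimes>\<^sub>M P)"]) (auto simp: space_pair_measure)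
    also have "\<dots> = emeasure P C'" by (subst prod) (simp_all add: P.emeasure_space_1)
    finally have CC': "emeasure P C = emeasure P C'" .
    have "emeasure P (E \<inter> C) = emeasure (P \<Otimes>\<^sub>M P) {\<omega> \<in> space (P \<Otimes>\<^sub>M P). G T \<omega> \<in> E \<inter> C}"
      by (rule push) measurable
    also have "\<dots> = emeasure (P \<Otimes>\<^sub>M P) {\<omega> \<in> space (P \<Otimes>\<^sub>M P). fst \<omega> \<in> E \<and> snd \<omega> \<in> C'}"
    proof (rule emeasure_eq_AE)
      show "AE \<omega> in P \<Otimes>\<^sub>M P. \<omega> \<in> {\<omega> \<in> space (P \<Otimes>\<^sub>M P). G T \<omega> \<in> E \<inter> C} \<longleftrightarrow>
          \<omega> \<in> {\<omega> \<in> space (P \<Otimes>\<^sub>M P). fst \<omega> \<in> E \<and> snd \<omega> \<in> C'}"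
        using inv[OF T] AE_space by eventually_elim (use GC in auto)
    qed measurable
    also have "\<dots> = emeasure P E * emeasure P C" by (simp add: prod CC')
    finally show ?thesis .
  qed
  \<comment> \<open>Independence of E from all window events says that two finite measures agree on
    a generating family closed under intersection. Evaluating both at E gives P(E) = P(E)^2.\<close>
  have "density P (indicator E) = scale_measure (emeasure P E) P"
  proof (rule measure_eqI_generator_eq[OF window_sets_Int_stable, where A="\<lambda>_. space P"])
    show "window_sets \<subseteq> Pow (space P)" using sets.sets_into_space by (auto simp: window_sets_def)
    show "emeasure (density P (indicator E)) X = emeasure (scale_measure (emeasure P E) P) X"
      if X: "X \<in> window_sets" for X
    proof -
      have "X \<in> sets P" using X by (simp add: window_sets_def)
      then show ?thesis using indep[OF X]
        by (simp add: emeasure_density nn_integral_indicator indicator_inter_arith[symmetric])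
    qed
    show "range (\<lambda>_. space P) \<subseteq> window_sets" by (auto simp: window_sets_def intro: exI[of _ 0])
    show "emeasure (density P (indicator E)) (space P) \<noteq> \<infinity>" for i :: nat
      by (simp add: emeasure_density)
  qed (simp_all add: sets_P_window[symmetric])
  then have "emeasure (density P (indicator E)) E = emeasure (scale_measure (emeasure P E) P) E" by simp
  then have sq: "emeasure P E = emeasure P E * emeasure P E"
    by (simp add: emeasure_density indicator_inter_arith[symmetric])
  then have "P.prob E = P.prob E * P.prob E"
    by (simp add: P.emeasure_eq_measure ennreal_mult[symmetric])
  then have "P.prob E = 0 \<or> P.prob E = 1" by simp
  then show ?thesis by (auto simp: P.emeasure_eq_measure)
qed

sublocale ergodic_random_flow P G V K
proof
  show "mixture \<rho> = mixture K"
    if "\<rho> \<in> measurable P (prob_algebra borel)"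
      "\<And>t. 0 \<le> t \<Longrightarrow> AE \<omega> in P \<Otimes>\<^sub>M P. distr (\<rho> (fst \<omega>)) borel (V t \<omega>) = \<rho> (G t \<omega>)" for \<rho>
    unfolding mixture_K using that by (rule invariant_mixture)
qed (rule zero_one_law)

end

section \<open>Negative exponents\<close>

context fractional_sde
begin

lemma V_differentiable:
  fixes r C p :: real
  assumes \<omega>: "\<omega> \<in> space (P \<Otimes>\<^sub>M P)" and t: "0 \<le> t"
    and holder: "0 < r" "0 < C" "1 \<le> p"
      "\<And>y z. onorm (\<lambda>v. frechet_derivative F (at y) v - frechet_derivative F (at z) v)
         \<le> C * (1 + norm y + norm z) powr p * norm (y - z) powr r"
  shows "V t \<omega> differentiable at x"
proof -
  have "\<exists>C>0. \<exists>N\<ge>1. \<forall>\<xi>. norm (F \<xi>) \<le> C * (1 + norm \<xi>) powr N \<and>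
      onorm (frechet_derivative F (at \<xi>)) \<le> C * (1 + norm \<xi>) powr N"
    using standing unfolding standing_conditions_def by (elim conjE)
  then obtain C' N where growth: "0 < C'" "1 \<le> N"
      "\<And>\<xi>. onorm (frechet_derivative F (at \<xi>)) \<le> C' * (1 + norm \<xi>) powr N" by blast
  show ?thesis
    by (rule F.driven_solution_differentiable[OF t V_solution[OF \<omega> t]
        has_derivative_bounded_linear[OF F_derivative] derivative_locally_bounded[OF growth(3,1,2)]
        holder_derivative_uniformly_differentiable[OF F_derivative holder]])
qed

text \<open>The strict bound on the operator norm leaves a gap that absorbs the remainder of the
  first-order expansion on a small ball. A vanishing derivative, with logarithm minus infinity,
  satisfies the strict bound directly.\<close>

lemma exponential_contraction:
  fixes l :: ereal and b :: real
  assumes \<omega>: "\<omega> \<in> space (P \<Otimes>\<^sub>M P)"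
    and lim: "((\<lambda>t. ereal (1 / t) * ereal_ln (onorm (frechet_derivative (V t \<omega>) (at x)))) \<longlongrightarrow> l) at_top"
    and b: "l < ereal b"
    and diff: "\<And>n::nat. V (real n) \<omega> differentiable at x"
  shows "\<forall>\<^sub>F n in sequentially. \<exists>a\<le>exp (b * real n). \<exists>d>0. \<forall>h.
      norm h < d \<longrightarrow> norm (V (real n) \<omega> (x + h) - V (real n) \<omega> x) \<le> a * norm h"
proof -
  let ?A = "\<lambda>n::nat. onorm (frechet_derivative (V (real n) \<omega>) (at x))"
  have "((\<lambda>n. ereal (1 / real n) * ereal_ln (?A n)) \<longlongrightarrow> l) sequentially"
    by (rule filterlim_compose[OF lim filterlim_real_sequentially])
  then have "\<forall>\<^sub>F n in sequentially. ereal (1 / real n) * ereal_ln (?A n) < ereal b"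
    using b by (rule order_tendstoD)
  moreover have "\<forall>\<^sub>F n::nat in sequentially. 0 < n" by (rule eventually_gt_at_top)
  ultimately have "\<forall>\<^sub>F n in sequentially. ereal (1 / real n) * ereal_ln (?A n) < ereal b \<and> 0 < n"
    by (rule eventually_conj)
  then show ?thesis
  proof (rule eventually_mono)
    fix n assume n: "ereal (1 / real n) * ereal_ln (?A n) < ereal b \<and> 0 < n"
    have "(V (real n) \<omega> has_derivative frechet_derivative (V (real n) \<omega>) (at x)) (at x)"
      using diff[of n] frechet_derivative_works by blast
    then have A: "0 \<le> ?A n" by (intro onorm_pos_le has_derivative_bounded_linear)
    have "?A n < exp (b * real n)"
    proof (cases "?A n = 0")
      case False
      then have "1 / real n * ln (?A n) < b" using n by (simp add: ereal_ln_def)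
      then have "ln (?A n) < b * real n" using n by (simp add: pos_divide_less_eq)
      then have "exp (ln (?A n)) < exp (b * real n)" by (simp only: exp_less_cancel_iff)
      then show ?thesis using False A by simp
    qed simp
    from norm_diff_le_of_onorm_less[OF diff this]
    show "\<exists>a\<le>exp (b * real n). \<exists>d>0. \<forall>h.
      norm h < d \<longrightarrow> norm (V (real n) \<omega> (x + h) - V (real n) \<omega> x) \<le> a * norm h"
      by blast
  qed
qed

lemma AE_pair_Bt: "AE z in \<mu> \<Otimes>\<^sub>M P. snd (fst z) \<in> Bt"
proof -
  interpret M: pair_prob_space "mixture K" P ..
  note [measurable_cong] = sets_mixture[OF K_measurable] and [measurable] = Bt(1)
  have "{z \<in> space (mixture K \<Otimes>\<^sub>M P). snd (fst z) \<in> Bt} \<in> sets (mixture K \<Otimes>\<^sub>M P)" by measurable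
  moreover have "AE z in mixture K. snd z \<in> Bt"
    unfolding mixture_K by (rule AE_snd_Bt[OF sets_\<mu> distr_\<mu>])
  then have "AE z in mixture K. AE w in P. snd (fst (z, w)) \<in> Bt" by eventually_elim simp
  ultimately show ?thesis unfolding mixture_K[symmetric] by (rule M.AE_pair_measure)
qed

lemma negative_exponent:
  assumes lyap: "top_lyapunov_exponent P \<Phi> \<mu> l" "l < 0"
    and holder: "0 < r" "0 < C" "1 \<le> p"
      "\<And>y z. onorm (\<lambda>v. frechet_derivative F (at y) v - frechet_derivative F (at z) v)
         \<le> C * (1 + norm y + norm z) powr p * norm (y - z) powr r"
  shows "\<exists>c>0. contracts_at_rate c"
proof -
  \<comment> \<open>A finite rate strictly between the exponent and 0 is needed, as the exponent may
    be minus infinity.\<close>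
  obtain b :: real where b: "l < ereal b" "ereal b < 0" using ereal_dense2[OF lyap(2)] by blast
  have lim: "AE z in \<mu> \<Otimes>\<^sub>M P. ((\<lambda>t. ereal (1 / t) *
      ereal_ln (onorm (frechet_derivative (\<Phi> t (snd (fst z), snd z)) (at (fst (fst z)))))) \<longlongrightarrow> l) at_top"
    using lyap(1) by (simp add: top_lyapunov_exponent_def case_prod_beta)
  let ?Q = "\<lambda>z. \<forall>\<^sub>F n in sequentially. \<exists>a\<le>exp (b * real n). \<exists>d>0. \<forall>h. norm h < d \<longrightarrow>
      norm (V (real n) (snd (fst z), snd z) (fst (fst z) + h)
        - V (real n) (snd (fst z), snd z) (fst (fst z))) \<le> a * norm h"
  have Q: "?Q z" if "z \<in> space (\<mu> \<Otimes>\<^sub>M P)" and Bt: "snd (fst z) \<in> Bt"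
      and l: "((\<lambda>t. ereal (1 / t) *
        ereal_ln (onorm (frechet_derivative (\<Phi> t (snd (fst z), snd z)) (at (fst (fst z)))))) \<longlongrightarrow> l) at_top"
    for z
  proof (rule exponential_contraction[OF _ _ b(1)])
    have "space \<mu> = UNIV \<times> space P"
      using sets_eq_imp_space_eq[OF sets_\<mu>] by (simp add: space_pair_measure)
    then have "fst z \<in> UNIV \<times> space P" "snd z \<in> space P"
      using that(1) by (simp_all add: space_pair_measure mem_Times_iff)
    then show \<omega>: "(snd (fst z), snd z) \<in> space (P \<Otimes>\<^sub>M P)"
      unfolding space_pair_measure mem_Times_iff by simp
    have V: "V t (snd (fst z), snd z) = \<Phi> t (snd (fst z), snd z)" for t
      using Bt by (simp add: V_def[abs_def] retr_id)
    show "((\<lambda>t. ereal (1 / t) *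
        ereal_ln (onorm (frechet_derivative (V t (snd (fst z), snd z)) (at (fst (fst z)))))) \<longlongrightarrow> l) at_top"
      unfolding V by (rule l)
    show "V (real n) (snd (fst z), snd z) differentiable at (fst (fst z))" for n
      by (rule V_differentiable[OF \<omega> _ holder]) simp
  qed
  have "AE z in \<mu> \<Otimes>\<^sub>M P. ?Q z"
    using AE_conjI[OF lim AE_pair_Bt]
  proof (rule AE_mp[OF _ AE_I2])
    fix z assume "z \<in> space (\<mu> \<Otimes>\<^sub>M P)"
    then show "((\<lambda>t. ereal (1 / t) * ereal_ln (onorm (frechet_derivative
        (\<Phi> t (snd (fst z), snd z)) (at (fst (fst z)))))) \<longlongrightarrow> l) at_top \<and> snd (fst z) \<in> Bt \<longrightarrow> ?Q z"
      by (intro impI, elim conjE) (rule Q)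
  qed
  then have "contracts_at_rate (- b)"
    unfolding contracts_at_rate_def mixture_K minus_minus .
  moreover have "0 < - b" using b(2) by simp
  ultimately show ?thesis by blast
qed

end

lemma discrete_measure_of_average:
  fixes M :: "(real ^ 'd) measure" and b :: "nat \<Rightarrow> real ^ ('d::finite)"
  assumes M: "sets M = sets borel"
    and avg: "\<And>A. A \<in> sets borel \<Longrightarrow> emeasure M A = c * (\<Sum>i=1..p. emeasure (return borel (b i)) A)"
  shows "discrete_measure M"
  unfolding discrete_measure_def
proof (intro bexI conjI)
  let ?S = "b ` {1..p}"
  show S: "?S \<in> sets M" using M by (simp add: borel_closed finite_imp_closed)
  show "countable ?S" by (simp add: countable_finite)
  have "emeasure M (space M - ?S) = c * (\<Sum>i=1..p. emeasure (return borel (b i)) (space M - ?S))"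
    using S M by (intro avg) (metis sets.compl_sets)
  also have "(\<Sum>i=1..p. emeasure (return borel (b i)) (space M - ?S)) = 0"
    using S M sets_eq_imp_space_eq[OF M] by (intro sum.neutral) (auto simp: emeasure_return)
  finally show "emeasure M (space M - ?S) = 0" by simp
qed

theorem proposition3p4:
  fixes H \<alpha> :: real
    and F :: "real ^ 'd \<Rightarrow> real ^ ('d::finite)"
    and \<sigma> :: "real ^ 'd ^ 'd"
    and P :: "'d path measure"
    and D :: "'d path \<Rightarrow> 'd path"
    and \<Phi> :: "real \<Rightarrow> 'd path \<times> 'd path \<Rightarrow> real ^ 'd \<Rightarrow> real ^ 'd"
    and \<mu> :: "((real ^ 'd) \<times> 'd path) measure"
    and Bt :: "'d path set"
    and \<kappa> :: "'d path \<Rightarrow> (real ^ 'd) measure"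
    and lyap :: ereal
  assumes "0 < H" and "H < 1"
    and "wiener_measure H P"
    and "frac_operator H P \<alpha> D"
    and "standing_conditions H F \<sigma>"
    and "solution_flow H D F \<sigma> \<Phi>"
    and "invariant_measure P \<Phi> \<mu>"
    and "\<And>\<nu>. invariant_measure P \<Phi> \<nu> \<Longrightarrow> \<nu> = \<mu>"
    and "equivariant_disintegration H P \<Phi> \<mu> Bt \<kappa>"
    and "top_lyapunov_exponent P \<Phi> \<mu> lyap"
    and "lyap < 0"
    and "\<exists>r C p1. 0 < r \<and> r \<le> 1 \<and> 0 < C \<and> 1 \<le> p1 \<and>
      (\<forall>y z. onorm (\<lambda>v. frechet_derivative F (at y) v - frechet_derivative F (at z) v)
         \<le> C * (1 + norm y + norm z) powr p1 * norm (y - z) powr r)"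
  shows "(\<exists>p::nat. p \<ge> 1 \<and> (\<exists>b :: nat \<Rightarrow> 'd path \<Rightarrow> real ^ 'd.
      (\<forall>i\<in>{1..p}. b i \<in> borel_measurable (restrict_space P Bt)) \<and>
      (AE \<omega> in P. \<omega> \<in> Bt \<and>
        (\<forall>A\<in>sets borel. emeasure (\<kappa> \<omega>) A =
           ennreal (1 / real p) * (\<Sum>i=1..p. emeasure (return borel (b i \<omega>)) A)))))
    \<and> (AE \<omega> in P. discrete_measure (\<kappa> \<omega>))"
    (is "?points \<and> ?discrete")
proof -
  interpret fractional_sde H \<alpha> F \<sigma> P D \<Phi> \<mu> Bt \<kappa> by unfold_locales fact+
  obtain r C p1 where holder: "0 < r" "0 < C" "1 \<le> p1"
      "\<And>y z. onorm (\<lambda>v. frechet_derivative F (at y) v - frechet_derivative F (at z) v)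
         \<le> C * (1 + norm y + norm z) powr p1 * norm (y - z) powr r"
    using assms(12) by blast
  obtain c where c: "0 < c" "contracts_at_rate c"
    using negative_exponent[OF assms(10,11) holder] by blast
  have lip: "norm (V (real n) \<omega> y - V (real n) \<omega> x) \<le> exp ((lipschitz_const + 1) * real n) * norm (y - x)"
    if "\<omega> \<in> space (P \<Otimes>\<^sub>M P)" for n \<omega> x y
    by (rule V_lipschitz[OF _ that]) simp
  \<comment> \<open>The extra 1 is the one in the exponent of the Gronwall bound.\<close>
  have "0 \<le> lipschitz_const + 1" using lipschitz_const(1) by simp
  from positive_atom_probability_of_negative_exponent[OF this c(1) lip c(2)]
  obtain \<delta> where "0 < \<delta>" "0 < emeasure (mixture K) {z \<in> space (mixture K). ennreal \<delta> \<le> ball_mass 0 z}"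
    by blast
  then obtain p where p: "p \<ge> 1" "AE \<omega> in P. \<exists>S. uniform_on_points p S (K \<omega>)"
    using equal_atoms by blast
  from measurable_enumeration_of_atoms[OF p] obtain b where
    b: "(\<forall>i\<in>{1..p}. b i \<in> borel_measurable P) \<and> (AE \<omega> in P. \<forall>A\<in>sets borel. emeasure (K \<omega>) A =
      ennreal (1 / real p) * (\<Sum>i=1..p. emeasure (return borel (b i \<omega>)) A))" ..
  have mass: "AE \<omega> in P. \<omega> \<in> Bt \<and> (\<forall>A\<in>sets borel. emeasure (\<kappa> \<omega>) A =
      ennreal (1 / real p) * (\<Sum>i=1..p. emeasure (return borel (b i \<omega>)) A))"
  proof (rule AE_mp[OF AE_conjI[OF AE_Bt conjunct2[OF b]]], rule AE_I2, rule impI)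
    fix \<omega> assume *: "\<omega> \<in> Bt \<and> (\<forall>A\<in>sets borel. emeasure (K \<omega>) A =
      ennreal (1 / real p) * (\<Sum>i=1..p. emeasure (return borel (b i \<omega>)) A))"
    then have "K \<omega> = \<kappa> \<omega>" unfolding K_def by (simp only: retr_id)
    from *[unfolded this] show "\<omega> \<in> Bt \<and> (\<forall>A\<in>sets borel. emeasure (\<kappa> \<omega>) A =
      ennreal (1 / real p) * (\<Sum>i=1..p. emeasure (return borel (b i \<omega>)) A))" .
  qed
  have "\<forall>i\<in>{1..p}. b i \<in> borel_measurable (restrict_space P Bt)"
    using conjunct1[OF b] measurable_restrict_space1 by blast
  with mass p(1) have ?points by (intro exI[of _ p] exI[of _ b] conjI)
  moreover have ?discrete
  proof (rule AE_mp[OF mass], rule AE_I2, rule impI)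
    fix \<omega> assume \<omega>: "\<omega> \<in> Bt \<and> (\<forall>A\<in>sets borel. emeasure (\<kappa> \<omega>) A =
        ennreal (1 / real p) * (\<Sum>i=1..p. emeasure (return borel (b i \<omega>)) A))"
    show "discrete_measure (\<kappa> \<omega>)"
      by (rule discrete_measure_of_average[OF sets_\<kappa>[OF conjunct1[OF \<omega>]] bspec[OF conjunct2[OF \<omega>]]])
  qed
  ultimately show ?thesis ..
qed

end
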